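(* Let $\theta_0=1,\theta_1,\ldots,\theta_{m-1}$ ($m\ge3$) be a unimodular partition of the unit circle $S^1$ with associated billiard map $\widetilde B$, factor map $B$ and set $\mathcal{S}_B$. Let $X=\{(\arg\sigma,\arg\rho):(\sigma,\rho)\in\mathcal{S}_B\}\subset[0,1)^2$ and write $\widetilde B$ and $B$ also for the conjugates $\arg\circ\widetilde B\circ\arg^{-1}$ (with $\arg$ applied componentwise) on $X$ and $\arg\circ B\circ\arg^{-1}$ on $[0,1)$, respectively. For $a=0,\ldots,m-1$, let $x_a=\arg\theta_a$ (and $x_m=1$), and let $h_a:[0,1)\to\mathbb{R}_{\ge0}$ be the function defined by $$h_a(x)=\frac{\pi}{\tan(\pi(x-x_a))}-\frac{\pi}{\tan(\pi(x-x_{a+1}))}$$ on $(x_a,x_{a+1})$, and having value $0$ elsewhere. Then the following facts hold. (i) The unique (up to constants) $\widetilde B$-invariant measure on $X$ absolutely continuous with respect to the Lebesgue measure is $d\tilde\mu=\pi^2\bigl(\sin(\pi(x-y))\bigr)^{-2}\,dx\,dy$. (ii) The unique (up to constants) $B$-invariant measure on $[0,1)$ absolutely continuous with respect to the Lebesgue measure is $d\mu=\bigl(\sum_a h_a\bigr)\,dx$. (iii) Both systems $(X,\tilde\mu,\widetilde B)$ and $([0,1),\mu,B)$ are ergodic and conservative.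
   Context: $S^1=\{z\in\mathbb{C}:|z|=1\}$ is the boundary of the Poincar\'e disk. A pythagorean triple is $\mathbf{t}=(t_1,t_2,t_3)\in\mathbb{Z}^3$ with $t_3>0$, $\gcd(t_1,t_2,t_3)=1$, $t_1^2+t_2^2=t_3^2$; it is identified with the point $\theta=(t_1+t_2i)/t_3\in S^1\cap\mathbb{Q}(i)$. Let $L=\mathrm{diag}(1,1,-1)$ and $\langle \mathbf{x},\mathbf{y}\rangle=\mathbf{x}^\top L\mathbf{y}$. For distinct pythagorean triples $\mathbf{t},\mathbf{t}'$, the closed arc $[\mathbf{t},\mathbf{t}']$ going counterclockwise from $\mathbf{t}$ to $\mathbf{t}'$ is unimodular if $\mathbf{w}=(L\mathbf{t}'\times L\mathbf{t})/\langle\mathbf{t}',\mathbf{t}\rangle\in\mathbb{Z}^3$. A unimodular partition of $S^1$ is a counterclockwise cyclically ordered $m$-tuple $\mathbf{t}_0,\ldots,\mathbf{t}_{m-1}$ of pythagorean triples, $m\ge3$, such that each arc $[\mathbf{t}_a,\mathbf{t}_{a+1}]$ is unimodular (indices modulo $m$); $\theta_a\in S^1$ is the point identified with $\mathbf{t}_a$, and it is assumed that $\theta_0=1$. Let $I_a=[\theta_a,\theta_{a+1})$ be the half-open counterclockwise arc, and let $\mathscr{A}_a$ be the hyperbolic reflection of the Poincar\'e disk in the geodesic with ideal endpoints $\theta_a,\theta_{a+1}$, acting on $S^1$ by $\mathscr{A}_a*z=\frac{(\theta_a+\theta_{a+1})z-2\theta_a\theta_{a+1}}{2z-(\theta_a+\theta_{a+1})}$.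 The billiard map $\widetilde B$ on $(S^1\times S^1)\setminus(\text{diagonal})$ is $\widetilde B(\sigma,\rho)=(\mathscr{A}_a*\sigma,\mathscr{A}_a*\rho)$, where $a$ is the unique index with $\sigma\in I_a$; the factor map is $B:S^1\to S^1$, $B(\sigma)=\mathscr{A}_a*\sigma$ for $\sigma\in I_a$. A point $\sigma$ is $B$-terminating if $B^h(\sigma)=\theta_a$ for some $h\ge0$ and some $a$. $\mathcal{S}_B$ is the set of pairs $(\sigma,\rho)$ such that both $\sigma$ and $\rho$ are not $B$-terminating, and $\sigma,\rho$ belong to different intervals among $I_0,\ldots,I_{m-1}$; $\widetilde B$ maps $\mathcal{S}_B$ bijectively to itself. The function $\arg:S^1\to[0,1)$ is the normalized argument, $\arg(\exp(2\pi i x))=x$. Measures are understood to be nonzero and $\sigma$-finite. *)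

theory Defs
  imports "HOL-Analysis.Analysis"
begin

section \<open>Pythagorean triples and unimodular partitions of the circle\<close>

definition pythagorean_triple :: "int ^ 3 \<Rightarrow> bool" where
  "pythagorean_triple t \<longleftrightarrow>
     t $ 3 > 0 \<and> gcd (t $ 1) (gcd (t $ 2) (t $ 3)) = 1 \<and>
     (t $ 1)\<^sup>2 + (t $ 2)\<^sup>2 = (t $ 3)\<^sup>2"

definition circle_point :: "int ^ 3 \<Rightarrow> complex" where
  "circle_point t =
     (of_int (t $ 1) + of_int (t $ 2) * \<i>) / of_int (t $ 3)"

definition Lmat :: "real ^ 3 ^ 3" where
  "Lmat = vector [vector [1, 0, 0], vector [0, 1, 0], vector [0, 0, -1]]"

definition Lform :: "real ^ 3 \<Rightarrow> real ^ 3 \<Rightarrow> real" where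
  "Lform x y = x \<bullet> (Lmat *v y)"

definition real_vec :: "int ^ 3 \<Rightarrow> real ^ 3" where
  "real_vec t = (\<chi> i. real_of_int (t $ i))"

definition arc_vector :: "int ^ 3 \<Rightarrow> int ^ 3 \<Rightarrow> real ^ 3" where
  "arc_vector t t' =
     inverse (Lform (real_vec t') (real_vec t)) *\<^sub>R
       cross3 (Lmat *v real_vec t') (Lmat *v real_vec t)"

definition unimodular_arc :: "int ^ 3 \<Rightarrow> int ^ 3 \<Rightarrow> bool" where
  "unimodular_arc t t' \<longleftrightarrow> t \<noteq> t' \<and> (\<forall>i. arc_vector t t' $ i \<in> \<int>)"

definition narg :: "complex \<Rightarrow> real" where
  "narg z = Arg2pi z / (2 * pi)"

text \<open>
  For \<open>z\<close>, \<open>u\<close> on the unit circle, \<open>narg (u / z)\<close> is the normalized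
  counterclockwise distance from \<open>z\<close> to \<open>u\<close>, a number in \<open>[0, 1)\<close>. A tuple of points is
  in counterclockwise cyclic order iff these distances from its first entry strictly increase.
\<close>

definition unimodular_partition :: "nat \<Rightarrow> (nat \<Rightarrow> int ^ 3) \<Rightarrow> bool" where
  "unimodular_partition m t \<longleftrightarrow>
     m \<ge> 3 \<and>
     (\<forall>a<m. pythagorean_triple (t a)) \<and>
     strict_mono_on {..<m} (\<lambda>a. narg (circle_point (t a) / circle_point (t 0))) \<and>
     (\<forall>a<m. unimodular_arc (t a) (t (Suc a mod m)))"

section \<open>The billiard map and its factor\<close>

text \<open>
  From here on \<open>\<theta> 0, \<dots>, \<theta> (m - 1)\<close> are the points of the partition;
  the values \<open>\<theta> a\<close> for \<open>a \<ge> m\<close> are irrelevant.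
\<close>

definition half_open_arc :: "nat \<Rightarrow> (nat \<Rightarrow> complex) \<Rightarrow> nat \<Rightarrow> complex set" where
  "half_open_arc m \<theta> a =
     {z \<in> sphere 0 1. narg (z / \<theta> a) < narg (\<theta> (Suc a mod m) / \<theta> a)}"

definition reflection :: "nat \<Rightarrow> (nat \<Rightarrow> complex) \<Rightarrow> nat \<Rightarrow> complex \<Rightarrow> complex" where
  "reflection m \<theta> a z =
     (let p = \<theta> a; q = \<theta> (Suc a mod m)
      in ((p + q) * z - 2 * p * q) / (2 * z - (p + q)))"

definition arc_index :: "nat \<Rightarrow> (nat \<Rightarrow> complex) \<Rightarrow> complex \<Rightarrow> nat" where
  "arc_index m \<theta> \<sigma> = (THE a. a < m \<and> \<sigma> \<in> half_open_arc m \<theta> a)"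

definition billiard_map ::
    "nat \<Rightarrow> (nat \<Rightarrow> complex) \<Rightarrow> complex \<times> complex \<Rightarrow> complex \<times> complex" where
  "billiard_map m \<theta> = (\<lambda>(\<sigma>, \<rho>).
     let a = arc_index m \<theta> \<sigma> in (reflection m \<theta> a \<sigma>, reflection m \<theta> a \<rho>))"

definition factor_map :: "nat \<Rightarrow> (nat \<Rightarrow> complex) \<Rightarrow> complex \<Rightarrow> complex" where
  "factor_map m \<theta> \<sigma> = reflection m \<theta> (arc_index m \<theta> \<sigma>) \<sigma>"

definition terminating :: "nat \<Rightarrow> (nat \<Rightarrow> complex) \<Rightarrow> complex \<Rightarrow> bool" where
  "terminating m \<theta> \<sigma> \<longleftrightarrow> (\<exists>h. \<exists>a<m. (factor_map m \<theta> ^^ h) \<sigma> = \<theta> a)"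

definition billiard_set :: "nat \<Rightarrow> (nat \<Rightarrow> complex) \<Rightarrow> (complex \<times> complex) set" where
  "billiard_set m \<theta> =
     {(\<sigma>, \<rho>). \<sigma> \<in> sphere 0 1 \<and> \<rho> \<in> sphere 0 1 \<and>
        \<not> terminating m \<theta> \<sigma> \<and> \<not> terminating m \<theta> \<rho> \<and>
        (\<exists>a<m. \<exists>b<m. a \<noteq> b \<and> \<sigma> \<in> half_open_arc m \<theta> a \<and> \<rho> \<in> half_open_arc m \<theta> b)}"

section \<open>The conjugate systems in argument coordinates\<close>

text \<open>The map \<open>x \<mapsto> cis (2 * pi * x)\<close> on \<open>[0, 1)\<close> is the inverse of \<open>narg\<close> on the circle.\<close>

definition unarg :: "real \<Rightarrow> complex" where
  "unarg x = cis (2 * pi * x)"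

definition billiard_set_arg :: "nat \<Rightarrow> (nat \<Rightarrow> complex) \<Rightarrow> (real \<times> real) set" where
  "billiard_set_arg m \<theta> = map_prod narg narg ` billiard_set m \<theta>"

definition billiard_map_arg ::
    "nat \<Rightarrow> (nat \<Rightarrow> complex) \<Rightarrow> real \<times> real \<Rightarrow> real \<times> real" where
  "billiard_map_arg m \<theta> = map_prod narg narg \<circ> billiard_map m \<theta> \<circ> map_prod unarg unarg"

definition factor_map_arg :: "nat \<Rightarrow> (nat \<Rightarrow> complex) \<Rightarrow> real \<Rightarrow> real" where
  "factor_map_arg m \<theta> = narg \<circ> factor_map m \<theta> \<circ> unarg"

definition part_arg :: "nat \<Rightarrow> (nat \<Rightarrow> complex) \<Rightarrow> nat \<Rightarrow> real" where
  "part_arg m \<theta> a = (if a = m then 1 else narg (\<theta> a))"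

definition hfun :: "nat \<Rightarrow> (nat \<Rightarrow> complex) \<Rightarrow> nat \<Rightarrow> real \<Rightarrow> real" where
  "hfun m \<theta> a x =
     (if part_arg m \<theta> a < x \<and> x < part_arg m \<theta> (Suc a)
      then pi / tan (pi * (x - part_arg m \<theta> a)) - pi / tan (pi * (x - part_arg m \<theta> (Suc a)))
      else 0)"

text \<open>
  The coercion \<open>ennreal\<close> maps negative numbers to \<open>0\<close>; by the next lemma it loses nothing
  when applied to \<open>hfun\<close>. Where \<open>tan\<close> has its pole, \<open>tan (pi / 2) = 0\<close> in the library and hence
  \<open>pi / tan (pi / 2) = 0\<close>, which is the right value of the cotangent.
\<close>

lemma hfun_nonneg: "0 \<le> hfun m \<theta> a x"
proof (cases "part_arg m \<theta> a < x \<and> x < part_arg m \<theta> (Suc a)")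
  case True
  define p q where "p = part_arg m \<theta> a" and "q = part_arg m \<theta> (Suc a)"
  have narg: "0 \<le> narg z" "narg z < 1" for z
    using Arg2pi_ge_0[of z] Arg2pi_lt_2pi[of z] by (auto simp: narg_def)
  have b: "0 \<le> p" "q \<le> 1"
    using narg[of "\<theta> a"] narg[of "\<theta> (Suc a)"] by (auto simp: p_def q_def part_arg_def)
  have pq: "p < x" "x < q" using True by (auto simp: p_def q_def)
  define u v where "u = pi * (x - p)" and "v = pi * (q - x)"
  have uv: "0 < u" "0 < v" "u + v \<le> pi"
    using pq b mult_left_mono[of "q - p" 1 pi] by (auto simp: u_def v_def algebra_simps)
  have s: "0 < sin u" "0 < sin v" "0 \<le> sin (u + v)"
    using uv by (auto intro!: sin_gt_zero sin_ge_zero)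
  have "pi / tan u - pi / tan (- v) = pi * (cos u / sin u + cos v / sin v)"
    by (simp add: tan_def algebra_simps)
  also have "cos u / sin u + cos v / sin v = sin (u + v) / (sin u * sin v)"
    using s by (simp add: sin_add field_simps)
  also have "pi * \<dots> \<ge> 0"
    using s by (intro mult_nonneg_nonneg divide_nonneg_nonneg) auto
  finally have "0 \<le> pi / tan u - pi / tan (- v)" .
  moreover have "- v = pi * (x - q)" by (simp add: v_def algebra_simps)
  ultimately show ?thesis
    using True unfolding hfun_def p_def[symmetric] q_def[symmetric] u_def by simp
qed (auto simp: hfun_def)

section \<open>Invariant measures, ergodicity, conservativity\<close>

definition measure_preserving :: "'a measure \<Rightarrow> ('a \<Rightarrow> 'a) \<Rightarrow> bool" where
  "measure_preserving M T \<longleftrightarrow>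
     T \<in> measurable M M \<and>
     (\<forall>A\<in>sets M. emeasure M (T -` A \<inter> space M) = emeasure M A)"

definition ac_invariant_measure ::
    "'a::euclidean_space set \<Rightarrow> ('a \<Rightarrow> 'a) \<Rightarrow> 'a measure \<Rightarrow> bool" where
  "ac_invariant_measure \<Omega> T \<nu> \<longleftrightarrow>
     sets \<nu> = sets (restrict_space lborel \<Omega>) \<and>
     emeasure \<nu> (space \<nu>) \<noteq> 0 \<and>
     sigma_finite_measure \<nu> \<and>
     absolutely_continuous (restrict_space lborel \<Omega>) \<nu> \<and>
     measure_preserving \<nu> T"

definition unique_ac_invariant_measure ::
    "'a::euclidean_space set \<Rightarrow> ('a \<Rightarrow> 'a) \<Rightarrow> 'a measure \<Rightarrow> bool" where
  "unique_ac_invariant_measure \<Omega> T \<mu> \<longleftrightarrow>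
     ac_invariant_measure \<Omega> T \<mu> \<and>
     (\<forall>\<nu>. ac_invariant_measure \<Omega> T \<nu> \<longrightarrow>
        (\<exists>c::real. c > 0 \<and> \<nu> = scale_measure (ennreal c) \<mu>))"

definition ergodic :: "'a measure \<Rightarrow> ('a \<Rightarrow> 'a) \<Rightarrow> bool" where
  "ergodic M T \<longleftrightarrow>
     (\<forall>A\<in>sets M. T -` A \<inter> space M = A \<longrightarrow>
        emeasure M A = 0 \<or> emeasure M (space M - A) = 0)"

text \<open>Conservative: there is no wandering set of positive measure.\<close>

definition conservative :: "'a measure \<Rightarrow> ('a \<Rightarrow> 'a) \<Rightarrow> bool" where
  "conservative M T \<longleftrightarrow>
     (\<forall>W\<in>sets M. disjoint_family (\<lambda>n. (T ^^ n) -` W \<inter> space M) \<longrightarrow> emeasure M W = 0)"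

end

theory Submission
  imports Defs
begin

text \<open>
  In the Cayley coordinate \<open>u\<close> of the circle, \<open>\<pi>\<^sup>2 sin (\<pi>(x - y))\<^bsup>-2\<^esup> dx dy\<close> becomes \<open>du dw / (u - w)\<^sup>2\<close>,
  which every Moebius map preserves; hence it is invariant under the billiard map \<open>T\<close>, and integrating
  out \<open>w\<close> gives the invariant density of the factor map. The points whose first three sides
  \<open>a\<^sub>0, a\<^sub>1, a\<^sub>2\<close> satisfy \<open>a\<^sub>0 \<noteq> a\<^sub>2\<close> form a set of finite measure which almost every orbit visits
  infinitely often: this gives conservativity, and uniqueness will follow from ergodicity.

  For ergodicity, let \<open>E\<close> be invariant. The fibre measures \<open>du / (u - w)\<^sup>2\<close> are permuted by \<open>T\<close> up to
  constants, so the density of \<open>E\<close> in the cylinder of length \<open>n\<close> around \<open>u\<close> in the fibre over \<open>w\<close> equals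
  the density of \<open>E\<close> in the whole fibre through \<open>T\<^sup>n (u, w)\<close>. Almost everywhere on \<open>E\<close> the former tends
  to 1, since cylinders shrink to points; by recurrence the latter is then equal to 1. So \<open>E\<close> is a union
  of fibres over the second coordinate, by symmetry also over the first one, and so it is null or full.
\<close>

section \<open>Infinite measure-preserving systems with a sweeping set\<close>

text \<open>The obstacle is that the invariant measure is infinite. Every vertex is a parabolic
  fixed point: \<open>S \<circ> S\<close> is tangent to the identity there, and orbits linger.
  Expansion is therefore not uniform. Two points that share an itinerary are only known to gain an
  amount quadratic in their distance at a visit to a bounded side, and infinitely many such visits
  have to make up for it. Uniqueness meets a second obstacle. A competing measure \<nu> is only
  \<sigma>-finite and may be infinite on the sweeping set, so its density with respect to the known
  measure \<open>M\<close> cannot be estimated on that set. The roles are exchanged: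
  \<open>M\<close> has a density between 0 and 1 with respect to \<open>M + \<nu>\<close>, and
  \<open>M\<close> is finite on the set; that is enough to make the density invariant. Both systems
  of the theorem are factors of one system on the line, \<open>X\<close> by a change of coordinates
  and the interval by projection to the first coordinate. So the dynamics is studied once, and on
  nonterminating points, where every formula is regular.\<close>

lemma measure_preserving_measurable: "measure_preserving M T \<Longrightarrow> T \<in> measurable M M"
  by (simp add: measure_preserving_def)

lemma measure_preserving_emeasure:
  "measure_preserving M T \<Longrightarrow> A \<in> sets M \<Longrightarrow> emeasure M (T -` A \<inter> space M) = emeasure M A"
  by (simp add: measure_preserving_def)

lemma measurable_funpow: "T \<in> measurable M M \<Longrightarrow> (T ^^ n) \<in> measurable M M"
  by (induction n) (auto intro: measurable_comp simp: measurable_ident)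

lemma vimage_funpow_Suc_Int:
  "T \<in> measurable M M \<Longrightarrow>
    (T ^^ Suc n) -` A \<inter> space M = T -` ((T ^^ n) -` A \<inter> space M) \<inter> space M"
  by (auto simp: funpow_swap1 measurable_space)

lemma measure_preserving_funpow:
  assumes "measure_preserving M T"
  shows "measure_preserving M (T ^^ n)"
proof (induction n)
  case 0
  then show ?case by (simp add: measure_preserving_def)
next
  case (Suc n)
  note T = measure_preserving_measurable[OF assms]
  note Tn = measurable_funpow[OF T]
  have "emeasure M ((T ^^ Suc n) -` A \<inter> space M) = emeasure M A" if "A \<in> sets M" for A
    using measure_preserving_emeasure[OF assms measurable_sets[OF Tn that, of n]]
      measure_preserving_emeasure[OF Suc that]
    by (simp only: vimage_funpow_Suc_Int[OF T])
  then show ?case using Tn by (simp add: measure_preserving_def del: funpow.simps)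
qed

text \<open>Borel-Cantelli: the integral of the number of visits to \<open>D\<close> is finite, so
  almost every orbit visits \<open>D\<close> finitely often, against \<open>io\<close>. In the
  applications \<open>K\<close> is not invariant: it is the restriction of an invariant measure to a
  wandering set, or has the density \<open>(g x - g (T x))\<^sup>2\<close>.\<close>

lemma sweeping_summable_imp_null:
  fixes K :: "'a measure"
  assumes T: "T \<in> measurable K K" and D: "D \<in> sets K"
    and fin: "(\<Sum>n. emeasure K ((T ^^ n) -` D \<inter> space K)) < \<infinity>"
    and io: "AE x in K. \<exists>\<^sub>\<infinity>n. (T ^^ n) x \<in> D"
  shows "emeasure K (space K) = 0"
proof -
  define A where "A n = (T ^^ n) -` D \<inter> space K" for n
  have A[measurable]: "A n \<in> sets K" for n
    using D measurable_funpow[OF T] by (auto simp: A_def measurable_sets)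
  have "AE x in K. \<not> (\<exists>\<^sub>\<infinity>n. (T ^^ n) x \<in> D)"
  proof -
    have "(\<integral>\<^sup>+x. (\<Sum>n. indicator (A n) x) \<partial>K) = (\<Sum>n. emeasure K (A n))"
      by (subst nn_integral_suminf) auto
    then have "(\<integral>\<^sup>+x. (\<Sum>n. indicator (A n) x) \<partial>K) \<noteq> \<infinity>"
      using fin by (auto simp: A_def)
    then have "AE x in K. (\<Sum>n. indicator (A n) x :: ennreal) \<noteq> \<infinity>"
      by (intro nn_integral_PInf_AE) auto
    then show ?thesis
    proof (rule AE_mp, intro AE_I2 impI)
      fix x assume x: "x \<in> space K" and f: "(\<Sum>n. indicator (A n) x :: ennreal) \<noteq> \<infinity>"
      have "summable (\<lambda>n. indicator (A n) x :: real)"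
        using f by (intro summable_suminf_not_top) (auto simp: ennreal_indicator)
      then have "(\<lambda>n. indicator (A n) x :: real) \<longlonglongrightarrow> 0"
        by (rule summable_LIMSEQ_zero)
      then have "eventually (\<lambda>n. (indicator (A n) x :: real) < 1) sequentially"
        by (rule order_tendstoD) simp
      then have "eventually (\<lambda>n. x \<notin> A n) sequentially"
        by eventually_elim (auto simp: indicator_def split: if_splits)
      then show "\<not> (\<exists>\<^sub>\<infinity>n. (T ^^ n) x \<in> D)"
        using x by (auto simp: A_def frequently_def cofinite_eq_sequentially)
    qed
  qed
  then have "AE x in K. False" using io by eventually_elim auto
  then show ?thesis by (simp add: AE_iff_null null_setsD1 ae_filter_eq_bot_iff)
qed

lemma disjoint_family_wandering:
  assumes T: "T \<in> measurable M M"
    and "\<And>x n. x \<in> W \<Longrightarrow> x \<in> space M \<Longrightarrow> n > 0 \<Longrightarrow> (T ^^ n) x \<notin> W"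
  shows "disjoint_family (\<lambda>n. (T ^^ n) -` W \<inter> space M)"
proof -
  have *: "False" if "i < j" "x \<in> space M" "(T ^^ i) x \<in> W" "(T ^^ j) x \<in> W" for i j x
  proof -
    have "(T ^^ j) x = (T ^^ (j - i)) ((T ^^ i) x)"
      using that by (metis funpow_add le_add_diff_inverse2 less_imp_le o_apply)
    then show False
      using that assms(2)[of "(T ^^ i) x" "j - i"] measurable_space[OF measurable_funpow[OF T]] by auto
  qed
  show ?thesis
    unfolding disjoint_family_on_def
  proof (intro ballI impI)
    fix i j :: nat assume "i \<noteq> j"
    then consider "i < j" | "j < i" by linarith
    then show "((T ^^ i) -` W \<inter> space M) \<inter> ((T ^^ j) -` W \<inter> space M) = {}"
      by cases (use *[of i j] *[of j i] in auto)
  qed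
qed

text \<open>For a wandering set \<open>W\<close>, the points of \<open>W\<close> that are in
  \<open>D\<close> at time \<open>n\<close> are pulled back by \<open>N - n\<close> further steps.
  The results are disjoint for different \<open>n\<close>, as they lie in different preimages of
  \<open>W\<close>, and all of them are in \<open>D\<close> at time \<open>N\<close>. So the
  measures of these sets add up to at most that of \<open>D\<close>, and summability contradicts
  sweeping unless \<open>W\<close> is null.\<close>

lemma conservative_if_sweeping:
  assumes mp: "measure_preserving M T" and D: "D \<in> sets M" "emeasure M D < \<infinity>"
    and io: "AE x in M. \<exists>\<^sub>\<infinity>n. (T ^^ n) x \<in> D"
  shows "conservative M T"
  unfolding conservative_def
proof (intro ballI impI)
  fix W assume W: "W \<in> sets M" and dis: "disjoint_family (\<lambda>n. (T ^^ n) -` W \<inter> space M)"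
  note T = measure_preserving_measurable[OF mp]
  note Tn = measurable_funpow[OF T]
  define A where "A n = (T ^^ n) -` D \<inter> space M" for n
  have A: "A n \<in> sets M" for n using D Tn by (auto simp: A_def measurable_sets)
  define K where "K = density M (indicator W)"
  have sp: "space K = space M" "sets K = sets M" by (auto simp: K_def)
  have em: "emeasure K B = emeasure M (W \<inter> B)" if "B \<in> sets M" for B
    using that W by (simp add: K_def emeasure_density indicator_inter_arith[symmetric] nn_integral_indicator)
  have bd: "(\<Sum>n<N. emeasure M (W \<inter> A n)) \<le> emeasure M D" for N
  proof -
    define B where "B n = (T ^^ (N - n)) -` (W \<inter> A n) \<inter> space M" for n
    have "(\<Sum>n<N. emeasure M (W \<inter> A n)) = (\<Sum>n<N. emeasure M (B n))"
      unfolding B_def using W A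
      by (intro sum.cong refl measure_preserving_emeasure[symmetric] measure_preserving_funpow mp) auto
    also have "\<dots> = emeasure M (\<Union>n<N. B n)"
    proof (rule sum_emeasure)
      show "B ` {..<N} \<subseteq> sets M"
        using W A Tn by (auto simp: B_def intro!: measurable_sets)
      show "disjoint_family_on B {..<N}"
        unfolding disjoint_family_on_def
      proof (intro ballI impI)
        fix i j assume "i \<in> {..<N}" "j \<in> {..<N}" "i \<noteq> j"
        then have "N - i \<noteq> N - j" by auto
        then have "((T ^^ (N - i)) -` W \<inter> space M) \<inter> ((T ^^ (N - j)) -` W \<inter> space M) = {}"
          using dis by (auto simp: disjoint_family_on_def)
        then show "B i \<inter> B j = {}" by (auto simp: B_def)
      qed
    qed auto
    also have "\<dots> \<le> emeasure M (A N)"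
    proof (rule emeasure_mono[OF _ A])
      show "(\<Union>n<N. B n) \<subseteq> A N"
      proof
        fix x assume "x \<in> (\<Union>n<N. B n)"
        then obtain n where n: "n < N" "x \<in> space M" "(T ^^ n) ((T ^^ (N - n)) x) \<in> D"
          by (auto simp: B_def A_def)
        then have "(T ^^ N) x \<in> D"
          by (metis funpow_add le_add_diff_inverse less_imp_le o_apply)
        then show "x \<in> A N" using n by (auto simp: A_def)
      qed
    qed
    also have "\<dots> = emeasure M D"
      unfolding A_def by (intro measure_preserving_emeasure measure_preserving_funpow mp D)
    finally show ?thesis .
  qed
  have "emeasure K (space K) = 0"
  proof (rule sweeping_summable_imp_null)
    show "T \<in> measurable K K" using T by (simp add: measurable_cong_sets[OF sp(2) sp(2)])
    show "D \<in> sets K" using D by (simp add: sp)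
    have "(\<Sum>n. emeasure K ((T ^^ n) -` D \<inter> space K)) = (\<Sum>n. emeasure M (W \<inter> A n))"
      using em A by (auto simp: sp A_def)
    also have "\<dots> \<le> emeasure M D"
      using bd by (intro suminf_le_const) auto
    also have "\<dots> < \<infinity>" by (rule D)
    finally show "(\<Sum>n. emeasure K ((T ^^ n) -` D \<inter> space K)) < \<infinity>" .
    show "AE x in K. \<exists>\<^sub>\<infinity>n. (T ^^ n) x \<in> D"
      unfolding K_def using io W by (subst AE_density) auto
  qed
  then show "emeasure M W = 0"
    using em[of "space M"] W sets.sets_into_space[OF W] by (simp add: sp Int_absorb2)
qed

text \<open>Poincare recurrence with conservativity in place of finite measure: the points of
  \<open>A\<close> that never come back form a wandering set, and the last visit of an orbit that
  visits \<open>A\<close> finitely often would lie in it.\<close>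

lemma AE_recurrent:
  assumes mp: "measure_preserving M T" and cons: "conservative M T" and A: "A \<in> sets M"
  shows "AE x in M. x \<in> A \<longrightarrow> (\<exists>\<^sub>\<infinity>n. (T ^^ n) x \<in> A)"
proof -
  note T = measure_preserving_measurable[OF mp]
  note Tn[measurable] = measurable_funpow[OF T]
  note A[measurable]
  define W where "W = {x \<in> space M. x \<in> A \<and> (\<forall>n>0. (T ^^ n) x \<notin> A)}"
  have W[measurable]: "W \<in> sets M" unfolding W_def by measurable
  have "emeasure M W = 0"
    using cons W disjoint_family_wandering[OF T, of W] by (auto simp: conservative_def W_def)
  then have "emeasure M ((T ^^ n) -` W \<inter> space M) = 0" for n
    using measure_preserving_emeasure[OF measure_preserving_funpow[OF mp] W] by simp
  then have "AE x in M. (T ^^ n) x \<notin> W" for n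
    by (intro AE_I[of _ _ "(T ^^ n) -` W \<inter> space M"]) auto
  then have "AE x in M. \<forall>n. (T ^^ n) x \<notin> W" by (simp add: AE_all_countable)
  moreover have *: "\<exists>\<^sub>\<infinity>n. (T ^^ n) x \<in> A"
    if x: "x \<in> space M" and nW: "\<forall>n. (T ^^ n) x \<notin> W" and xA: "x \<in> A" for x
  proof (rule ccontr)
    assume "\<not> (\<exists>\<^sub>\<infinity>n. (T ^^ n) x \<in> A)"
    then have fin: "finite {n. (T ^^ n) x \<in> A}" by (simp add: frequently_cofinite)
    define n where "n = Max {n. (T ^^ n) x \<in> A}"
    have "n \<in> {n. (T ^^ n) x \<in> A}"
      unfolding n_def using fin xA by (intro Max_in) (auto intro!: exI[of _ 0])
    moreover have "(T ^^ k) ((T ^^ n) x) \<notin> A" if "k > 0" for k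
    proof
      assume "(T ^^ k) ((T ^^ n) x) \<in> A"
      then have "k + n \<in> {n. (T ^^ n) x \<in> A}" by (simp add: funpow_add)
      then have "k + n \<le> n" unfolding n_def using fin by (intro Max_ge) auto
      with that show False by simp
    qed
    ultimately have "(T ^^ n) x \<in> W"
      using x measurable_space[OF Tn] by (auto simp: W_def)
    with nW show False by blast
  qed
  ultimately show ?thesis
    using AE_space by eventually_elim (use * in blast)
qed

lemma measure_preserving_distr: "measure_preserving M T \<Longrightarrow> distr M M T = M"
  by (intro measure_eqI) (auto simp: emeasure_distr measure_preserving_def)

text \<open>
  As \<open>g d\<sigma>\<close> is invariant, \<open>g\<close> and \<open>g \<circ> T\<close> have the same inner product on \<open>T\<^bsup>-1\<^esup> A\<close> as \<open>g\<close> has with itself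
  on \<open>A\<close>. So the squared distance of \<open>g\<close> and \<open>g \<circ> T\<close> on \<open>T\<^bsup>-n-1\<^esup> D\<close> is an increment of \<open>\<integral> g\<^sup>2 d\<sigma>\<close>, taken over
  \<open>T\<^bsup>-n\<^esup> D\<close>, and these integrals are bounded by \<open>\<integral> g d\<sigma>\<close> over \<open>D\<close>.
\<close>

lemma AE_invariant_density:
  fixes \<sigma> :: "'a measure" and g :: "'a \<Rightarrow> real"
  defines "M \<equiv> density \<sigma> (\<lambda>x. ennreal (g x))"
  assumes mp: "measure_preserving \<sigma> T" and mp_M: "measure_preserving M T"
    and g[measurable]: "g \<in> borel_measurable \<sigma>" and g01: "\<And>x. 0 \<le> g x" "\<And>x. g x \<le> 1"
    and D[measurable]: "D \<in> sets \<sigma>" and fin: "emeasure M D < \<infinity>"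
    and io: "AE x in \<sigma>. \<exists>\<^sub>\<infinity>n. (T ^^ n) x \<in> D"
  shows "AE x in \<sigma>. g (T x) = g x"
proof -
  have T[measurable]: "T \<in> measurable \<sigma> \<sigma>" using mp by (rule measure_preserving_measurable)
  note Tn[measurable] = measurable_funpow[OF T]
  define K where "K = density \<sigma> (\<lambda>x. ennreal ((g x - g (T x))\<^sup>2))"
  define I where "I A = (\<integral>\<^sup>+x\<in>A. ennreal ((g x)\<^sup>2) \<partial>\<sigma>)" for A
  have T_M: "T \<in> measurable M M" by (simp add: M_def)
  have nn_M: "(\<integral>\<^sup>+x. f x \<partial>M) = (\<integral>\<^sup>+x. ennreal (g x) * f x \<partial>\<sigma>)" if "f \<in> borel_measurable \<sigma>" for f
    unfolding M_def using that by (intro nn_integral_density) auto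
  have I_le: "I A \<le> emeasure M A" if [measurable]: "A \<in> sets \<sigma>" for A
    unfolding I_def M_def using g01 mult_left_le[OF g01(2) g01(1)]
    by (subst emeasure_density) (auto intro!: nn_integral_mono mult_right_mono simp: power2_eq_square ennreal_leI)
  have step: "emeasure K (T -` A \<inter> space \<sigma>) + I A = I (T -` A \<inter> space \<sigma>)"
    if A[measurable]: "A \<in> sets \<sigma>" and finA: "emeasure M A < \<infinity>" for A
  proof -
    let ?B = "T -` A \<inter> space \<sigma>"
    have B[measurable]: "?B \<in> sets \<sigma>" by measurable
    have ind: "indicator ?B x = (indicator A (T x) :: ennreal)" if "x \<in> space \<sigma>" for x
      using that by (simp add: indicator_def)
    have sq: "(\<integral>\<^sup>+x\<in>?B. ennreal ((g (T x))\<^sup>2) \<partial>\<sigma>) = I A"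
    proof -
      have "I A = (\<integral>\<^sup>+x\<in>A. ennreal ((g x)\<^sup>2) \<partial>distr \<sigma> \<sigma> T)"
        unfolding I_def measure_preserving_distr[OF mp] ..
      then show ?thesis by (simp add: nn_integral_distr ind cong: nn_integral_cong)
    qed
    have inner: "(\<integral>\<^sup>+x\<in>?B. ennreal (g x * g (T x)) \<partial>\<sigma>) = I A"
    proof -
      have "I A = (\<integral>\<^sup>+x. ennreal (g x) * indicator A x \<partial>M)"
        unfolding I_def using g01
        by (subst nn_M) (auto intro!: nn_integral_cong simp: power2_eq_square ennreal_mult mult_ac)
      also have "\<dots> = (\<integral>\<^sup>+x. ennreal (g x) * indicator A x \<partial>distr M M T)"
        unfolding measure_preserving_distr[OF mp_M] ..
      also have "\<dots> = (\<integral>\<^sup>+x. ennreal (g (T x)) * indicator A (T x) \<partial>M)"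
        using T_M by (intro nn_integral_distr) (auto simp: M_def)
      also have "\<dots> = (\<integral>\<^sup>+x\<in>?B. ennreal (g x * g (T x)) \<partial>\<sigma>)"
        using g01 by (subst nn_M) (auto intro!: nn_integral_cong simp: ind ennreal_mult mult_ac)
      finally show ?thesis ..
    qed
    have "emeasure K ?B + (I A + I A) =
        (\<integral>\<^sup>+x\<in>?B. ennreal ((g x - g (T x))\<^sup>2) \<partial>\<sigma>) +
        ((\<integral>\<^sup>+x\<in>?B. ennreal (g x * g (T x)) \<partial>\<sigma>) + (\<integral>\<^sup>+x\<in>?B. ennreal (g x * g (T x)) \<partial>\<sigma>))"
      unfolding K_def inner by (subst emeasure_density) auto
    also have "\<dots> = (\<integral>\<^sup>+x\<in>?B. ennreal ((g x)\<^sup>2) \<partial>\<sigma>) + (\<integral>\<^sup>+x\<in>?B. ennreal ((g (T x))\<^sup>2) \<partial>\<sigma>)"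
      using g01
      by (simp add: nn_integral_add[symmetric] distrib_right[symmetric] ennreal_plus[symmetric] del: ennreal_plus)
        (auto intro!: nn_integral_cong simp: power2_eq_square algebra_simps split: split_indicator)
    also have "\<dots> = I ?B + I A" unfolding sq I_def ..
    finally have "I A + (emeasure K ?B + I A) = I A + I ?B" by (simp add: add_ac)
    moreover have "I A \<noteq> \<infinity>" using I_le[OF A] finA by auto
    ultimately show ?thesis by (simp only: ennreal_add_left_cancel) auto
  qed
  define A where "A n = (T ^^ n) -` D \<inter> space \<sigma>" for n
  have A[measurable]: "A n \<in> sets \<sigma>" for n unfolding A_def by measurable
  have M_A: "emeasure M (A n) = emeasure M D" for n
    using measure_preserving_emeasure[OF measure_preserving_funpow[OF mp_M], of D n]
    by (simp add: A_def M_def)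
  have A_Suc: "A (Suc n) = T -` A n \<inter> space \<sigma>" for n
    unfolding A_def by (rule vimage_funpow_Suc_Int[OF T])
  have tele: "(\<Sum>k<n. emeasure K (A (Suc k))) + I (A 0) = I (A n)" for n
  proof (induction n)
    case (Suc n)
    have "emeasure K (A (Suc n)) + I (A n) = I (A (Suc n))"
      unfolding A_Suc by (rule step) (use M_A fin in auto)
    moreover have "(\<Sum>k<Suc n. emeasure K (A (Suc k))) + I (A 0) =
        emeasure K (A (Suc n)) + ((\<Sum>k<n. emeasure K (A (Suc k))) + I (A 0))"
      by (simp add: add_ac)
    ultimately show ?case using Suc by simp
  qed simp
  \<comment> \<open>The telescoping sum controls \<open>emeasure K\<close> on the sets
    \<open>A (Suc n)\<close> only, so the sweeping set is replaced by its preimage, one step earlier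
    on each orbit.\<close>
  define D' where "D' = T -` D \<inter> space \<sigma>"
  have "emeasure K (space K) = 0"
  proof (rule sweeping_summable_imp_null)
    show "T \<in> measurable K K" "D' \<in> sets K" by (auto simp: K_def D'_def)
    have pre: "(T ^^ n) -` D' \<inter> space K = A (Suc n)" for n
      using measurable_space[OF Tn] by (auto simp: A_def D'_def K_def)
    have "(\<Sum>n. emeasure K (A (Suc n))) \<le> emeasure M D"
    proof (rule suminf_le_const)
      fix n
      have "(\<Sum>k<n. emeasure K (A (Suc k))) \<le> I (A n)" unfolding tele[of n, symmetric] by simp
      also have "\<dots> \<le> emeasure M D" using I_le[OF A, of n] by (simp add: M_A)
      finally show "(\<Sum>k<n. emeasure K (A (Suc k))) \<le> emeasure M D" .
    qed simp
    then show "(\<Sum>n. emeasure K ((T ^^ n) -` D' \<inter> space K)) < \<infinity>"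
      unfolding pre using fin by (rule le_less_trans)
    have "AE x in \<sigma>. \<exists>\<^sub>\<infinity>n. (T ^^ n) x \<in> D'"
      using io AE_space
    proof eventually_elim
      fix x assume x: "\<exists>\<^sub>\<infinity>n. (T ^^ n) x \<in> D" "x \<in> space \<sigma>"
      have "\<exists>n\<ge>k. (T ^^ n) x \<in> D'" for k
      proof -
        obtain n where n: "n \<ge> Suc k" "(T ^^ n) x \<in> D" using x(1) unfolding INFM_nat_le by blast
        then obtain n' where "n = Suc n'" by (cases n) auto
        then show ?thesis
          using n x(2) measurable_space[OF Tn] by (intro exI[of _ n']) (auto simp: D'_def)
      qed
      then show "\<exists>\<^sub>\<infinity>n. (T ^^ n) x \<in> D'" unfolding INFM_nat_le by blast
    qed
    then show "AE x in K. \<exists>\<^sub>\<infinity>n. (T ^^ n) x \<in> D'"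
      unfolding K_def by (subst AE_density) auto
  qed
  then have "AE x in \<sigma>. ennreal ((g x - g (T x))\<^sup>2) = 0"
    unfolding K_def by (simp add: emeasure_density nn_integral_0_iff_AE cong: nn_integral_cong)
  then show ?thesis by eventually_elim simp
qed

text \<open>Ergodicity is stated for strictly invariant sets. The set of points that visit
  \<open>A\<close> infinitely often is strictly invariant even when \<open>A\<close> is not, because
  a shift of time does not change whether there are infinitely many visits.\<close>

lemma ergodic_limsup:
  assumes mp: "measure_preserving M T" and erg: "ergodic M T" and A[measurable]: "A \<in> sets M"
  shows "(AE x in M. \<exists>\<^sub>\<infinity>n. (T ^^ n) x \<in> A) \<or> (AE x in M. \<not> (\<exists>\<^sub>\<infinity>n. (T ^^ n) x \<in> A))"
proof -
  have T[measurable]: "T \<in> measurable M M" using mp by (rule measure_preserving_measurable)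
  note Tn[measurable] = measurable_funpow[OF T]
  define L where "L = {x \<in> space M. \<forall>k. \<exists>n\<ge>k. (T ^^ n) x \<in> A}"
  have L[measurable]: "L \<in> sets M" unfolding L_def by measurable
  have io: "(\<exists>\<^sub>\<infinity>n. (T ^^ n) x \<in> A) \<longleftrightarrow> x \<in> L" if "x \<in> space M" for x
    using that by (simp add: L_def INFM_nat_le)
  have "(\<forall>k. \<exists>n\<ge>k. (T ^^ n) (T x) \<in> A) \<longleftrightarrow> (\<forall>k. \<exists>n\<ge>k. (T ^^ n) x \<in> A)" for x
  proof
    assume *: "\<forall>k. \<exists>n\<ge>k. (T ^^ n) (T x) \<in> A"
    show "\<forall>k. \<exists>n\<ge>k. (T ^^ n) x \<in> A"
    proof
      fix k
      from * obtain n where "n \<ge> k" "(T ^^ n) (T x) \<in> A" by blast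
      then show "\<exists>n\<ge>k. (T ^^ n) x \<in> A" by (intro exI[of _ "Suc n"]) (simp add: funpow_swap1)
    qed
  next
    assume *: "\<forall>k. \<exists>n\<ge>k. (T ^^ n) x \<in> A"
    show "\<forall>k. \<exists>n\<ge>k. (T ^^ n) (T x) \<in> A"
    proof
      fix k
      from * obtain n where n: "n \<ge> Suc k" "(T ^^ n) x \<in> A" by blast
      then obtain n' where "n = Suc n'" by (cases n) auto
      with n show "\<exists>n\<ge>k. (T ^^ n) (T x) \<in> A" by (intro exI[of _ n']) (simp add: funpow_swap1)
    qed
  qed
  then have "T -` L \<inter> space M = L"
    using measurable_space[OF T] by (auto simp: L_def)
  then have "emeasure M L = 0 \<or> emeasure M (space M - L) = 0"
    using erg L by (auto simp: ergodic_def)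
  then show ?thesis
  proof
    assume "emeasure M L = 0"
    then have "AE x in M. x \<notin> L" by (intro AE_not_in) (auto simp: null_sets_def)
    then have "AE x in M. \<not> (\<exists>\<^sub>\<infinity>n. (T ^^ n) x \<in> A)"
      using AE_space by eventually_elim (use io in blast)
    then show ?thesis ..
  next
    assume "emeasure M (space M - L) = 0"
    then have "AE x in M. x \<notin> space M - L" by (intro AE_not_in) (auto simp: null_sets_def)
    then have "AE x in M. \<exists>\<^sub>\<infinity>n. (T ^^ n) x \<in> A"
      using AE_space by eventually_elim (use io in blast)
    then show ?thesis ..
  qed
qed

text \<open>The hypothesis carries a visit at any time back to time 0, so almost every point that
  visits \<open>A\<close> infinitely often lies in \<open>A\<close>; recurrence gives the converse.
  Thus \<open>A\<close> agrees up to a null set with a strictly invariant set. This serves for the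
  sublevel sets of a density that is invariant only almost everywhere.\<close>

lemma ergodic_subinvariant:
  assumes mp: "measure_preserving M T" and erg: "ergodic M T" and cons: "conservative M T"
    and A: "A \<in> sets M" and sub: "AE x in M. T x \<in> A \<longrightarrow> x \<in> A"
  shows "(AE x in M. x \<in> A) \<or> (AE x in M. x \<notin> A)"
proof -
  have T[measurable]: "T \<in> measurable M M" using mp by (rule measure_preserving_measurable)
  note Tn = measurable_funpow[OF T]
  note [measurable] = A
  have "AE x in M. T ((T ^^ n) x) \<in> A \<longrightarrow> (T ^^ n) x \<in> A" for n
  proof -
    have "AE x in distr M M (T ^^ n). T x \<in> A \<longrightarrow> x \<in> A"
      unfolding measure_preserving_distr[OF measure_preserving_funpow[OF mp]] by (rule sub)
    then show ?thesis by (subst (asm) AE_distr_iff) (auto intro: Tn)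
  qed
  then have "AE x in M. \<forall>n. T ((T ^^ n) x) \<in> A \<longrightarrow> (T ^^ n) x \<in> A"
    by (simp add: AE_all_countable)
  then have io_A: "AE x in M. (\<exists>\<^sub>\<infinity>n. (T ^^ n) x \<in> A) \<longrightarrow> x \<in> A"
  proof eventually_elim
    fix x assume *: "\<forall>n. T ((T ^^ n) x) \<in> A \<longrightarrow> (T ^^ n) x \<in> A"
    have "x \<in> A" if "(T ^^ n) x \<in> A" for n
      using that * by (induction n) auto
    then show "(\<exists>\<^sub>\<infinity>n. (T ^^ n) x \<in> A) \<longrightarrow> x \<in> A"
      by (auto dest: INFM_EX)
  qed
  from ergodic_limsup[OF mp erg A] show ?thesis
  proof
    assume "AE x in M. \<exists>\<^sub>\<infinity>n. (T ^^ n) x \<in> A"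
    with io_A have "AE x in M. x \<in> A" by eventually_elim auto
    then show ?thesis ..
  next
    assume "AE x in M. \<not> (\<exists>\<^sub>\<infinity>n. (T ^^ n) x \<in> A)"
    with AE_recurrent[OF mp cons A] have "AE x in M. x \<notin> A" by eventually_elim auto
    then show ?thesis ..
  qed
qed

lemma unique_invariant_density:
  assumes sf: "sigma_finite_measure M" and mp: "measure_preserving M T" and erg: "ergodic M T"
    and D: "D \<in> sets M" "emeasure M D < \<infinity>"
    and io: "AE x in M. \<exists>\<^sub>\<infinity>n. (T ^^ n) x \<in> D"
    and \<nu>: "sets \<nu> = sets M" "sigma_finite_measure \<nu>" "absolutely_continuous M \<nu>"
      "measure_preserving \<nu> T" "emeasure \<nu> (space \<nu>) \<noteq> 0"
  shows "\<exists>c::real. c > 0 \<and> \<nu> = scale_measure (ennreal c) M"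
proof -
  interpret M: sigma_finite_measure M by fact
  have T[measurable]: "T \<in> measurable M M" using mp by (rule measure_preserving_measurable)
  have cons: "conservative M T" by (rule conservative_if_sweeping[OF mp D io])
  define f where "f = RN_deriv M \<nu>"
  have f[measurable]: "f \<in> borel_measurable M" by (simp add: f_def)
  have f_fin: "AE x in M. f x \<noteq> \<infinity>" unfolding f_def by (rule M.RN_deriv_finite[OF \<nu>(2,3,1)])
  define h where "h x = enn2real (f x)" for x
  have h[measurable]: "h \<in> borel_measurable M" unfolding h_def by measurable
  have h_nonneg: "0 \<le> h x" for x by (simp add: h_def)
  have "density M (\<lambda>x. ennreal (h x)) = density M f"
    using f_fin by (intro density_cong) (auto simp: h_def less_top elim!: eventually_mono)
  then have \<nu>_h: "density M (\<lambda>x. ennreal (h x)) = \<nu>"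
    unfolding f_def by (simp add: M.density_RN_deriv[OF \<nu>(3,1)])
  \<comment> \<open>With respect to the sum of the two measures, \<open>M\<close> has the density
    \<open>1 / (1 + h)\<close>, a function with values in the unit interval. The density of
    \<open>\<nu>\<close> is bounded too, but \<open>\<nu>\<close> may be infinite on
    \<open>D\<close>.\<close>
  define \<sigma> where "\<sigma> = density M (\<lambda>x. ennreal (1 + h x))"
  have em: "emeasure \<sigma> A = emeasure M A + emeasure \<nu> A" if [measurable]: "A \<in> sets M" for A
    unfolding \<sigma>_def \<nu>_h[symmetric] using h_nonneg
    by (simp add: emeasure_density ennreal_plus distrib_right nn_integral_add)
  have mp_\<sigma>: "measure_preserving \<sigma> T"
    unfolding measure_preserving_def
  proof (intro conjI ballI)
    show "T \<in> measurable \<sigma> \<sigma>" by (simp add: \<sigma>_def)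
    fix A assume "A \<in> sets \<sigma>"
    then have A: "A \<in> sets M" by (simp add: \<sigma>_def)
    have "space \<nu> = space M" using \<nu>(1) by (rule sets_eq_imp_space_eq)
    then show "emeasure \<sigma> (T -` A \<inter> space \<sigma>) = emeasure \<sigma> A"
      using measure_preserving_emeasure[OF mp A] measure_preserving_emeasure[OF \<nu>(4), of A] A
        em[OF A] em[OF measurable_sets[OF T A]] \<nu>(1) by (simp add: \<sigma>_def)
  qed
  have pos: "0 < 1 + h x" for x using h_nonneg[of x] by simp
  have M_\<sigma>: "density \<sigma> (\<lambda>x. ennreal (1 / (1 + h x))) = M"
  proof -
    have "ennreal (1 + h x) * ennreal (1 / (1 + h x)) = 1" for x
      using pos[of x] by (simp add: ennreal_mult[symmetric] less_imp_le)
    then show ?thesis unfolding \<sigma>_def by (simp add: density_density_eq density_1)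
  qed
  have "AE x in \<sigma>. 1 / (1 + h (T x)) = 1 / (1 + h x)"
  proof (rule AE_invariant_density[OF mp_\<sigma>, where D = D])
    show "AE x in \<sigma>. \<exists>\<^sub>\<infinity>n. (T ^^ n) x \<in> D"
      unfolding \<sigma>_def using io by (subst AE_density) auto
    show "1 / (1 + h x) \<le> 1" for x using h_nonneg[of x] by simp
  qed (use mp D h_nonneg M_\<sigma> in \<open>auto simp: \<sigma>_def\<close>)
  then have h_T: "AE x in M. h (T x) = h x"
    unfolding \<sigma>_def using pos by (subst (asm) AE_density) (auto simp: frac_eq_eq elim!: eventually_mono)
  have zero_one: "(AE x in M. h x \<le> r) \<or> (AE x in M. h x > r)" for r
  proof -
    have "{x \<in> space M. h x \<le> r} \<in> sets M" by measurable
    moreover from h_T AE_space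
    have "AE x in M. T x \<in> {x \<in> space M. h x \<le> r} \<longrightarrow> x \<in> {x \<in> space M. h x \<le> r}"
      by eventually_elim auto
    ultimately have "(AE x in M. x \<in> {x \<in> space M. h x \<le> r}) \<or> (AE x in M. x \<notin> {x \<in> space M. h x \<le> r})"
      by (rule ergodic_subinvariant[OF mp erg cons])
    then show ?thesis
    proof
      assume "AE x in M. x \<notin> {x \<in> space M. h x \<le> r}"
      then have "AE x in M. h x > r" using AE_space by eventually_elim auto
      then show ?thesis ..
    qed (auto elim!: eventually_mono)
  qed
  \<comment> \<open>Otherwise every real number, negative ones included, would be an essential upper
    bound of \<open>h\<close>, and there would be no infimum to take.\<close>
  have nontriv: "\<not> (AE x in M. False)"
  proof
    assume "AE x in M. False"
    then have "emeasure \<nu> (space \<nu>) = 0"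
      unfolding \<nu>_h[symmetric] by (auto simp: emeasure_density nn_integral_0_iff_AE elim: AE_mp)
    with \<nu>(5) show False by simp
  qed
  \<comment> \<open>The essential upper bounds of \<open>h\<close>. By the zero-one law, a number
    that is not one of them is almost everywhere below \<open>h\<close>, so \<open>h\<close> equals
    their infimum almost everywhere.\<close>
  define C where "C = {r. AE x in M. h x \<le> r}"
  have "C \<noteq> {}"
  proof
    assume "C = {}"
    then have "AE x in M. h x > real n" for n using zero_one[of "real n"] by (auto simp: C_def)
    then have "AE x in M. \<forall>n. h x > real n" by (simp add: AE_all_countable)
    then have "AE x in M. False" by eventually_elim (metis less_asym reals_Archimedean2)
    with nontriv show False by simp
  qed
  have C_ge: "r \<ge> 0" if "r \<in> C" for r
  proof (rule ccontr)
    assume "\<not> r \<ge> 0"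
    then have "h x > r" for x using h_nonneg[of x] by linarith
    moreover have "AE x in M. h x \<le> r" using that by (simp add: C_def)
    ultimately have "AE x in M. False" by (auto simp: not_le[symmetric] elim!: eventually_mono)
    with nontriv show False by simp
  qed
  define c where "c = Inf C"
  have bdd: "bdd_below C" using C_ge by (auto simp: bdd_below_def)
  have "AE x in M. h x \<le> c + 1 / real (Suc n)" for n
  proof -
    obtain r where r: "r \<in> C" "r < c + 1 / real (Suc n)"
      using cInf_lessD[OF \<open>C \<noteq> {}\<close>, of "c + 1 / real (Suc n)"] by (auto simp: c_def)
    from r(1) have "AE x in M. h x \<le> r" by (simp add: C_def)
    then show ?thesis by eventually_elim (use r(2) in linarith)
  qed
  moreover have "AE x in M. h x > c - 1 / real (Suc n)" for n
  proof -
    have "c - 1 / real (Suc n) \<notin> C"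
    proof
      assume "c - 1 / real (Suc n) \<in> C"
      then have "c \<le> c - 1 / real (Suc n)" unfolding c_def using bdd by (rule cInf_lower)
      then show False by simp
    qed
    then show ?thesis using zero_one by (auto simp: C_def)
  qed
  ultimately have "AE x in M. \<forall>n. \<bar>h x - c\<bar> \<le> 1 / real (Suc n)"
    unfolding AE_all_countable
  proof (intro allI)
    fix n
    assume "\<And>n. AE x in M. h x \<le> c + 1 / real (Suc n)" "\<And>n. AE x in M. h x > c - 1 / real (Suc n)"
    from this(1)[of n] this(2)[of n] show "AE x in M. \<bar>h x - c\<bar> \<le> 1 / real (Suc n)"
      by eventually_elim linarith
  qed
  then have h_c: "AE x in M. h x = c"
  proof eventually_elim
    fix x assume *: "\<forall>n. \<bar>h x - c\<bar> \<le> 1 / real (Suc n)"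
    show "h x = c"
    proof (rule ccontr)
      assume "h x \<noteq> c"
      then obtain n where "1 / real (Suc n) < \<bar>h x - c\<bar>"
        using nat_approx_posE[of "\<bar>h x - c\<bar>"] by auto
      with * show False by (metis not_le)
    qed
  qed
  have "density M (\<lambda>x. ennreal (h x)) = density M (\<lambda>_. ennreal c)"
    by (rule density_cong) (use h_c in \<open>auto elim: eventually_mono\<close>)
  then have \<nu>_c: "\<nu> = scale_measure (ennreal c) M"
    using \<nu>_h by (intro measure_eqI) (auto simp: emeasure_density nn_integral_cmult_indicator \<nu>(1))
  moreover have "c > 0"
  proof (rule ccontr)
    assume "\<not> c > 0"
    then have "ennreal c = 0" by (simp add: ennreal_neg)
    with \<nu>_c \<nu>(5) show False by simp
  qed
  ultimately show ?thesis by blast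
qed

text \<open>The semiconjugacy is imposed at the points of \<open>M\<close> only, and
  \<open>M'\<close> sees nothing but the image of \<open>p\<close>. So \<open>T'\<close> is free
  outside that image; for the interval this concerns the terminating points, which have no
  counterpart in the system on the line.\<close>

locale measure_factor =
  fixes M :: "'a measure" and T :: "'a \<Rightarrow> 'a" and M' :: "'b measure" and T' :: "'b \<Rightarrow> 'b"
    and p :: "'a \<Rightarrow> 'b"
  assumes p: "p \<in> measurable M M'" and distr_p: "distr M M' p = M'"
    and T': "T' \<in> measurable M' M'"
    and semiconj: "x \<in> space M \<Longrightarrow> p (T x) = T' (p x)"
begin

lemma emeasure_factor: "A \<in> sets M' \<Longrightarrow> emeasure M' A = emeasure M (p -` A \<inter> space M)"
  using p by (subst distr_p[symmetric]) (simp add: emeasure_distr)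

lemma vimage_factor:
  "T \<in> measurable M M \<Longrightarrow>
    p -` (T' -` A \<inter> space M') \<inter> space M = T -` (p -` A \<inter> space M) \<inter> space M"
  using measurable_space[OF p] by (auto simp: semiconj measurable_space)

lemma measure_preserving_factor:
  assumes "measure_preserving M T"
  shows "measure_preserving M' T'"
  unfolding measure_preserving_def
proof (intro conjI ballI T')
  fix A assume A: "A \<in> sets M'"
  show "emeasure M' (T' -` A \<inter> space M') = emeasure M' A"
    unfolding emeasure_factor[OF measurable_sets[OF T' A]] emeasure_factor[OF A]
      vimage_factor[OF measure_preserving_measurable[OF assms]]
    by (rule measure_preserving_emeasure[OF assms measurable_sets[OF p A]])
qed

lemma ergodic_factor:
  assumes "ergodic M T" and T: "T \<in> measurable M M"
  shows "ergodic M' T'"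
  unfolding ergodic_def
proof (intro ballI impI)
  fix A assume A: "A \<in> sets M'" and inv: "T' -` A \<inter> space M' = A"
  have "T -` (p -` A \<inter> space M) \<inter> space M = p -` A \<inter> space M"
    unfolding vimage_factor[OF T, symmetric] inv ..
  moreover have "p -` A \<inter> space M \<in> sets M" using p A by (rule measurable_sets)
  moreover have "p -` (space M' - A) \<inter> space M = space M - (p -` A \<inter> space M)"
    using measurable_space[OF p] by auto
  ultimately show "emeasure M' A = 0 \<or> emeasure M' (space M' - A) = 0"
    using assms(1) A by (auto simp: ergodic_def emeasure_factor)
qed

lemma sweeping_factor:
  assumes T: "T \<in> measurable M M" and D': "D' \<in> sets M'"
    and io: "AE x in M. \<exists>\<^sub>\<infinity>n. (T ^^ n) x \<in> p -` D'"
  shows "AE x in M'. \<exists>\<^sub>\<infinity>n. (T' ^^ n) x \<in> D'"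
proof -
  note [measurable] = p T' D' measurable_funpow[OF T']
  have pn: "p ((T ^^ n) x) = (T' ^^ n) (p x)" if "x \<in> space M" for n x
    using that by (induction n) (auto simp: semiconj measurable_space[OF measurable_funpow[OF T]])
  have "{x \<in> space M'. \<forall>k. \<exists>n\<ge>k. (T' ^^ n) x \<in> D'} \<in> sets M'" by measurable
  then have "(AE x in distr M M' p. \<forall>k. \<exists>n\<ge>k. (T' ^^ n) x \<in> D') \<longleftrightarrow>
      (AE x in M. \<forall>k. \<exists>n\<ge>k. (T' ^^ n) (p x) \<in> D')"
    by (intro AE_distr_iff) (use p in auto)
  moreover have "AE x in M. \<forall>k. \<exists>n\<ge>k. (T' ^^ n) (p x) \<in> D'"
    using io AE_space by eventually_elim (auto simp: INFM_nat_le pn)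
  ultimately have "AE x in M'. \<forall>k. \<exists>n\<ge>k. (T' ^^ n) x \<in> D'" unfolding distr_p by blast
  then show ?thesis by (simp add: INFM_nat_le)
qed

end

text \<open>The positive density makes the null sets of \<open>M'\<close> Lebesgue null, so every
  competitor that is absolutely continuous with respect to Lebesgue measure is so with respect to
  \<open>M'\<close>. Invariance, ergodicity and sweeping are inherited from \<open>M\<close>;
  \<sigma>-finiteness comes from the density being real-valued.\<close>

lemma measure_factor_conclusion:
  fixes \<Omega> :: "'b::euclidean_space set" and f :: "'b \<Rightarrow> real"
  assumes factor: "measure_factor M T M' T' p"
    and mp: "measure_preserving M T" and erg: "ergodic M T" and nz: "emeasure M (space M) \<noteq> 0"
    and D: "D \<in> sets M'" "emeasure M (p -` D \<inter> space M) < \<infinity>"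
    and io: "AE x in M. \<exists>\<^sub>\<infinity>n. (T ^^ n) x \<in> p -` D \<inter> space M"
    and \<Omega>: "\<Omega> \<in> sets borel" and f: "f \<in> borel_measurable (restrict_space lborel \<Omega>)"
    and pos: "AE x in restrict_space lborel \<Omega>. 0 < f x"
    and M': "M' = density (restrict_space lborel \<Omega>) (\<lambda>x. ennreal (f x))"
  shows "unique_ac_invariant_measure \<Omega> T' M' \<and> ergodic M' T' \<and> conservative M' T'"
proof -
  interpret measure_factor M T M' T' p by fact
  note T = measure_preserving_measurable[OF mp]
  have mp': "measure_preserving M' T'" by (rule measure_preserving_factor[OF mp])
  have erg': "ergodic M' T'" by (rule ergodic_factor[OF erg T])
  have D': "emeasure M' D < \<infinity>" using D by (simp add: emeasure_factor)
  have "AE x in M. \<exists>\<^sub>\<infinity>n. (T ^^ n) x \<in> p -` D"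
    using io by eventually_elim (auto elim!: INFM_mono)
  then have io': "AE x in M'. \<exists>\<^sub>\<infinity>n. (T' ^^ n) x \<in> D" by (rule sweeping_factor[OF T D(1)])
  have nz': "emeasure M' (space M') \<noteq> 0"
  proof -
    have "p -` space M' \<inter> space M = space M" using measurable_space[OF p] by auto
    then show ?thesis using nz by (simp add: emeasure_factor)
  qed
  let ?L = "restrict_space lborel \<Omega>"
  interpret L: sigma_finite_measure ?L
    by (rule sigma_finite_measure_restrict_space) (use \<Omega> sigma_finite_lborel in auto)
  have fm: "(\<lambda>x. ennreal (f x)) \<in> borel_measurable ?L" using f by simp
  have sf: "sigma_finite_measure M'"
    unfolding M' using f by (subst L.sigma_finite_iff_density_finite) auto
  have sets: "sets M' = sets ?L" by (simp add: M')
  have ac: "absolutely_continuous ?L M'"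
    unfolding M' by (rule absolutely_continuousI_density[OF fm])
  have null: "null_sets M' \<subseteq> null_sets ?L"
  proof
    fix A assume "A \<in> null_sets M'"
    then have A: "A \<in> sets ?L" "AE x in ?L. x \<in> A \<longrightarrow> ennreal (f x) = 0"
      unfolding M' null_sets_density_iff[OF fm] by auto
    from A(2) pos have "AE x in ?L. x \<notin> A" by eventually_elim auto
    then show "A \<in> null_sets ?L" using A(1) by (subst AE_iff_null_sets)
  qed
  have "\<exists>c::real. c > 0 \<and> \<nu> = scale_measure (ennreal c) M'" if \<nu>: "ac_invariant_measure \<Omega> T' \<nu>" for \<nu>
  proof (rule unique_invariant_density[OF sf mp' erg' D(1) D' io'])
    show "absolutely_continuous M' \<nu>"
      using \<nu> null by (auto simp: ac_invariant_measure_def absolutely_continuous_def)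
  qed (use \<nu> sets in \<open>auto simp: ac_invariant_measure_def\<close>)
  moreover have "ac_invariant_measure \<Omega> T' M'"
    unfolding ac_invariant_measure_def using sets nz' sf ac mp' by blast
  ultimately show ?thesis
    using erg' conservative_if_sweeping[OF mp' D(1) D' io'] by (simp add: unique_ac_invariant_measure_def)
qed

section \<open>Change of variables\<close>

lemma nn_integral_change_of_variables_real:
  fixes g g' :: "real \<Rightarrow> real" and f :: "real \<Rightarrow> ennreal"
  assumes S[measurable]: "S \<in> sets borel" and gS[measurable]: "g ` S \<in> sets borel"
    and g[measurable]: "g \<in> borel_measurable borel" and g'[measurable]: "g' \<in> borel_measurable borel"
    and deriv: "\<And>x. x \<in> S \<Longrightarrow> (g has_field_derivative g' x) (at x)"
    and inj: "inj_on g S" and f[measurable]: "f \<in> borel_measurable borel"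
  shows "(\<integral>\<^sup>+x\<in>S. f (g x) * ennreal \<bar>g' x\<bar> \<partial>lborel) = (\<integral>\<^sup>+x\<in>g ` S. f x \<partial>lborel)"
proof -
  let ?L = "distr (density lborel (\<lambda>x. ennreal \<bar>g' x\<bar> * indicator S x)) borel g"
  let ?R = "density lborel (indicator (g ` S))"
  have bd: "emeasure ?L A = emeasure ?R A" if A[measurable]: "A \<in> sets borel" and "bounded A" for A
  proof -
    define S' where "S' = S \<inter> g -` A"
    have S'[measurable]: "S' \<in> sets borel" unfolding S'_def by measurable
    have gS': "g ` S' = A \<inter> g ` S" by (auto simp: S'_def)
    have gS'_b: "A \<inter> g ` S \<in> lmeasurable"
      using that by (intro bounded_set_imp_lmeasurable) (auto intro: bounded_Int)
    have "(\<lambda>x. \<bar>g' x\<bar> * 1 :: real) absolutely_integrable_on S' \<and>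
        integral S' (\<lambda>x. \<bar>g' x\<bar> * 1) = measure lebesgue (A \<inter> g ` S)"
    proof (subst has_absolute_integral_change_of_variables_1'[where g = g])
      show "(g has_field_derivative g' x) (at x within S')" if "x \<in> S'" for x
        using that deriv by (auto simp: S'_def intro: has_field_derivative_at_within)
      show "inj_on g S'" using inj by (auto simp: S'_def inj_on_def)
      show "(\<lambda>x. 1 :: real) absolutely_integrable_on g ` S' \<and> integral (g ` S') (\<lambda>x. 1) = measure lebesgue (A \<inter> g ` S)"
      proof
        have int: "(\<lambda>x. 1 :: real) integrable_on A \<inter> g ` S"
          using gS'_b by (simp add: lmeasurable_iff_integrable_on)
        show "(\<lambda>x. 1 :: real) absolutely_integrable_on g ` S'"
          unfolding gS' by (rule nonnegative_absolutely_integrable_1[OF int]) simp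
        show "integral (g ` S') (\<lambda>x. 1) = measure lebesgue (A \<inter> g ` S)"
          unfolding gS' by (simp add: lmeasure_integral[OF gS'_b])
      qed
    qed auto
    then have "((\<lambda>x. \<bar>g' x\<bar>) has_integral measure lebesgue (A \<inter> g ` S)) S'"
      by (auto simp: has_integral_iff absolutely_integrable_on_def)
    then have "(\<integral>\<^sup>+x. ennreal (indicator S' x * \<bar>g' x\<bar>) \<partial>lborel) = ennreal (measure lebesgue (A \<inter> g ` S))"
      by (intro nn_integral_has_integral_lebesgue[where f = "\<lambda>x. \<bar>g' x\<bar>"]) auto
    also have "\<dots> = emeasure lborel (A \<inter> g ` S)"
      using emeasure_eq_measure2[OF gS'_b] by (simp add: emeasure_completion)
    also have "(\<integral>\<^sup>+x. ennreal (indicator S' x * \<bar>g' x\<bar>) \<partial>lborel) = emeasure ?L A"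
      by (subst emeasure_distr, simp, simp, subst emeasure_density)
        (auto simp: S'_def measurable_sets_borel[OF g A] intro!: nn_integral_cong split: split_indicator)
    also have "emeasure lborel (A \<inter> g ` S) = emeasure ?R A"
      by (subst emeasure_density)
        (auto simp: nn_integral_indicator[symmetric] intro!: nn_integral_cong split: split_indicator
          simp del: nn_integral_indicator)
    finally show ?thesis .
  qed
  have "?L = ?R"
  proof (rule measure_eqI)
    fix A assume "A \<in> sets ?L"
    then have A[measurable]: "A \<in> sets borel" by simp
    have un: "(\<Union>n. A \<inter> ball 0 (real n)) = A"
      using reals_Archimedean2 by (auto simp: dist_real_def)
    have inc: "incseq (\<lambda>n. A \<inter> ball 0 (real n))" by (auto simp: incseq_def)
    have "emeasure ?L A = (SUP n. emeasure ?L (A \<inter> ball 0 (real n)))"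
      by (subst SUP_emeasure_incseq[OF _ inc]) (auto simp: un simp del: UN_simps)
    also have "\<dots> = (SUP n. emeasure ?R (A \<inter> ball 0 (real n)))"
      by (intro SUP_cong refl bd) (auto intro: bounded_Int)
    also have "\<dots> = emeasure ?R A"
      by (subst SUP_emeasure_incseq[OF _ inc]) (auto simp: un simp del: UN_simps)
    finally show "emeasure ?L A = emeasure ?R A" .
  qed simp
  then have "(\<integral>\<^sup>+x. f x \<partial>?L) = (\<integral>\<^sup>+x. f x \<partial>?R)" by simp
  then show ?thesis
    by (simp add: nn_integral_distr nn_integral_density mult_ac)
qed

lemma emeasure_density_restrict_prod:
  fixes k :: "real \<Rightarrow> real \<Rightarrow> ennreal"
  assumes \<Omega>: "\<Omega> \<in> sets (borel \<Otimes>\<^sub>M borel)"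
    and k: "(\<lambda>z. k (fst z) (snd z)) \<in> borel_measurable (borel \<Otimes>\<^sub>M borel)"
    and A: "A \<in> sets (restrict_space lborel \<Omega>)"
  shows "emeasure (density (restrict_space lborel \<Omega>) (\<lambda>(x, y). k x y)) A =
    (\<integral>\<^sup>+x. \<integral>\<^sup>+y. indicator A (x, y) * k x y \<partial>lborel \<partial>lborel)"
proof -
  have "A \<in> sets (restrict_space (borel \<Otimes>\<^sub>M borel) \<Omega>)" using A by (simp add: sets_restrict_space borel_prod)
  then have A': "A \<in> sets (borel \<Otimes>\<^sub>M borel)" "A \<subseteq> \<Omega>"
    using \<Omega> by (auto simp: sets_restrict_space_iff)
  have \<Omega>b: "\<Omega> \<in> sets borel" using \<Omega> unfolding borel_prod .
  note [measurable] = k A'(1)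
  have "(\<lambda>z. k (fst z) (snd z)) \<in> borel_measurable (restrict_space lborel \<Omega>)"
    by (intro measurable_restrict_space1) (use k in \<open>simp add: borel_prod\<close>)
  then have "emeasure (density (restrict_space lborel \<Omega>) (\<lambda>(x, y). k x y)) A =
      (\<integral>\<^sup>+z. k (fst z) (snd z) * indicator A z \<partial>restrict_space lborel \<Omega>)"
    using A by (simp add: case_prod_beta' emeasure_density)
  also have "\<dots> = (\<integral>\<^sup>+z. indicator A z * k (fst z) (snd z) \<partial>(lborel \<Otimes>\<^sub>M lborel))"
    using A' \<Omega>b by (subst nn_integral_restrict_space)
      (auto simp: lborel_prod borel_prod mult_ac intro!: nn_integral_cong split: split_indicator)
  also have "\<dots> = (\<integral>\<^sup>+x. \<integral>\<^sup>+y. indicator A (x, y) * k x y \<partial>lborel \<partial>lborel)"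
    by (subst lborel.nn_integral_fst[symmetric]) auto
  finally show ?thesis .
qed

section \<open>The billiard on the real line\<close>

text \<open>Counting the vertices to the left makes every bounded side left-open and right-closed,
  the opposite of the half-open arcs of the circle. The two conventions differ at vertices only, and
  these are terminating.\<close>

definition side_index :: "nat \<Rightarrow> (nat \<Rightarrow> real) \<Rightarrow> real \<Rightarrow> nat" where
  "side_index m v x = card {b \<in> {1..<m}. v b < x}"

definition side_reflection :: "nat \<Rightarrow> (nat \<Rightarrow> real) \<Rightarrow> nat \<Rightarrow> real \<Rightarrow> real" where
  "side_reflection m v a x =
     (if a = 0 then 2 * v 1 - x else if Suc a = m then 2 * v a - x
      else ((v a + v (Suc a)) * x - 2 * v a * v (Suc a)) / (2 * x - (v a + v (Suc a))))"

text \<open>Away from the centre this is the absolute value of the derivative of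
  \<open>side_reflection\<close>; the derivative itself is negative, since reflections reverse the
  orientation.\<close>

definition side_jacobian :: "nat \<Rightarrow> (nat \<Rightarrow> real) \<Rightarrow> nat \<Rightarrow> real \<Rightarrow> real" where
  "side_jacobian m v a x =
     (if a = 0 \<or> Suc a = m then 1
      else (v (Suc a) - v a)\<^sup>2 / (2 * x - (v a + v (Suc a)))\<^sup>2)"

text \<open>
  The Cayley transform turns the circle into the real line with the vertex \<open>\<theta> 0 = 1\<close> at infinity.
  The vertices \<open>v 1 < \<dots> < v (m - 1)\<close> cut the line into \<open>m\<close> sides; the outer sides \<open>0\<close> and \<open>m - 1\<close> are
  half-lines, on which the reflection is Euclidean, and the value \<open>v 0\<close> is irrelevant. At the centre
  of an inner side, whose image is infinity, \<open>side_reflection\<close> has the junk value \<open>0\<close>.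
\<close>

locale polygon_vertices =
  fixes m :: nat and v :: "nat \<Rightarrow> real"
  assumes m_ge_3: "3 \<le> m"
    and v_less: "1 \<le> a \<Longrightarrow> a < b \<Longrightarrow> b < m \<Longrightarrow> v a < v b"
begin

abbreviation "idx \<equiv> side_index m v"
abbreviation "R \<equiv> side_reflection m v"
abbreviation "jac \<equiv> side_jacobian m v"

lemma idx_less: "idx x < m"
proof -
  have "card {b \<in> {1..<m}. v b < x} \<le> card {1..<m}" by (intro card_mono) auto
  then show ?thesis using m_ge_3 by (simp add: side_index_def)
qed

lemma v_le: "1 \<le> a \<Longrightarrow> a \<le> b \<Longrightarrow> b < m \<Longrightarrow> v a \<le> v b"
  using v_less[of a b] by (cases "a = b") auto

lemma idx_eqI:
  assumes a: "a < m" and l: "0 < a \<Longrightarrow> v a < x" and r: "Suc a < m \<Longrightarrow> x \<le> v (Suc a)"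
  shows "idx x = a"
proof -
  have "{b \<in> {1..<m}. v b < x} = {1..a}"
  proof (intro set_eqI iffI)
    fix b assume b: "b \<in> {b \<in> {1..<m}. v b < x}"
    have "b \<le> a"
    proof (rule ccontr)
      assume "\<not> b \<le> a"
      then have "v (Suc a) \<le> v b" "Suc a < m" using b v_le[of "Suc a" b] by auto
      then show False using r b by auto
    qed
    then show "b \<in> {1..a}" using b by auto
  next
    fix b assume b: "b \<in> {1..a}"
    then show "b \<in> {b \<in> {1..<m}. v b < x}" using l a v_le[of b a] by force
  qed
  then show ?thesis by (simp add: side_index_def)
qed

lemma idx_iff:
  assumes a: "a < m"
  shows "idx x = a \<longleftrightarrow> (0 < a \<longrightarrow> v a < x) \<and> (Suc a < m \<longrightarrow> x \<le> v (Suc a))"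
proof
  assume ia: "idx x = a"
  define B where "B = {b \<in> {1..<m}. v b < x}"
  define c where "c = (if B = {} then 0 else Max B)"
  have fin: "finite B" by (simp add: B_def)
  have cB: "c \<in> B" if "B \<noteq> {}" using that fin by (simp add: c_def)
  have 1: "c < m" using cB m_ge_3 by (cases "B = {}") (auto simp: c_def B_def)
  have 2: "v c < x" if "0 < c" using that cB by (cases "B = {}") (auto simp: c_def B_def)
  have 3: "x \<le> v (Suc c)" if "Suc c < m"
  proof (rule ccontr)
    assume "\<not> x \<le> v (Suc c)"
    then have *: "Suc c \<in> B" using that by (auto simp: B_def)
    then have "Suc c \<le> Max B" using fin by (intro Max_ge) auto
    then show False using * by (auto simp: c_def split: if_splits)
  qed
  have "idx x = c" by (rule idx_eqI[OF 1 2 3])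
  then show "(0 < a \<longrightarrow> v a < x) \<and> (Suc a < m \<longrightarrow> x \<le> v (Suc a))" using ia 2 3 by auto
qed (use a m_ge_3 in \<open>auto intro!: idx_eqI\<close>)

lemma idx_gt: "0 < idx x \<Longrightarrow> v (idx x) < x"
  and idx_le: "Suc (idx x) < m \<Longrightarrow> x \<le> v (Suc (idx x))"
  using idx_iff[OF idx_less, of x x] by auto

text \<open>The endpoints of a side are fixed by its reflection. The factored form shows by signs
  alone whether an image lies left or right of an endpoint.\<close>

lemma reflection_diff_left:
  assumes "0 < a" "Suc a < m" "2 * x - (v a + v (Suc a)) \<noteq> 0"
  shows "R a x - v a = (v (Suc a) - v a) * (x - v a) / (2 * x - (v a + v (Suc a)))"
proof -
  have "R a x = ((v a + v (Suc a)) * x - 2 * v a * v (Suc a)) / (2 * x - (v a + v (Suc a)))"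
    using assms by (simp add: side_reflection_def)
  then show ?thesis using assms(3) by (simp add: field_simps)
qed

lemma reflection_diff_right:
  assumes "0 < a" "Suc a < m" "2 * x - (v a + v (Suc a)) \<noteq> 0"
  shows "v (Suc a) - R a x = (v (Suc a) - v a) * (x - v (Suc a)) / (2 * x - (v a + v (Suc a)))"
proof -
  have "R a x = ((v a + v (Suc a)) * x - 2 * v a * v (Suc a)) / (2 * x - (v a + v (Suc a)))"
    using assms by (simp add: side_reflection_def)
  then show ?thesis using assms(3) by (simp add: field_simps)
qed

lemma reflection_reflection_regular:
  assumes "a < m" and center: "0 < a \<Longrightarrow> Suc a < m \<Longrightarrow> 2 * x - (v a + v (Suc a)) \<noteq> 0"
  shows "R a (R a x) = x"
proof (cases "a = 0 \<or> Suc a = m")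
  case True
  then show ?thesis by (auto simp: side_reflection_def)
next
  case False
  define p q where "p = v a" and "q = v (Suc a)"
  have nz: "2 * x - (p + q) \<noteq> 0"
    using center False assms(1) by (auto simp: p_def q_def)
  have pq: "p < q" using v_less[of a "Suc a"] False assms(1) by (auto simp: p_def q_def)
  have e: "2 * R a x - (p + q) = (q - p)\<^sup>2 / (2 * x - (p + q))"
    using nz False unfolding side_reflection_def p_def[symmetric] q_def[symmetric]
    by (simp add: field_simps power2_eq_square)
  have "R a (R a x) = ((p + q) * R a x - 2 * p * q) / (2 * R a x - (p + q))"
    using False unfolding side_reflection_def p_def[symmetric] q_def[symmetric] by simp
  also have "(p + q) * R a x - 2 * p * q = (q - p)\<^sup>2 * x / (2 * x - (p + q))"
    using nz False unfolding side_reflection_def p_def[symmetric] q_def[symmetric]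
    by (simp add: field_simps power2_eq_square)
  finally show ?thesis unfolding e using nz pq by simp
qed

text \<open>A reflection interchanges its side and the complement. Vertices are excluded because the
  endpoints of the side are fixed, the centre because its image infinity is replaced by a junk
  value.\<close>

lemma idx_reflection_regular:
  assumes a: "a < m" and not_v: "\<And>b. 1 \<le> b \<Longrightarrow> b < m \<Longrightarrow> x \<noteq> v b"
    and center: "0 < a \<Longrightarrow> Suc a < m \<Longrightarrow> 2 * x - (v a + v (Suc a)) \<noteq> 0"
  shows "idx (R a x) = a \<longleftrightarrow> idx x \<noteq> a"
proof -
  consider "a = 0" | "Suc a = m" "a \<noteq> 0" | "0 < a" "Suc a < m" using a by linarith
  then show ?thesis
  proof cases
    case 1
    then have "R a x = 2 * v 1 - x" by (simp add: side_reflection_def)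
    then show ?thesis using idx_iff[OF a, of x] idx_iff[OF a, of "R a x"] not_v[of 1] m_ge_3 1
      by auto
  next
    case 2
    then have "R a x = 2 * v a - x" by (simp add: side_reflection_def)
    moreover have "\<not> Suc a < m" using 2 by simp
    ultimately show ?thesis
      using idx_iff[OF a, of x] idx_iff[OF a, of "R a x"] not_v[of a] m_ge_3 2(2) a by force
  next
    case 3
    define p q where "p = v a" and "q = v (Suc a)"
    have pq: "p < q" using v_less[of a "Suc a"] 3 by (auto simp: p_def q_def)
    have xn: "x \<noteq> p" "x \<noteq> q" using not_v[of a] not_v[of "Suc a"] 3 by (auto simp: p_def q_def)
    have nz: "2 * x - (p + q) \<noteq> 0"
      using center 3 by (auto simp: p_def q_def)
    have l: "R a x - p = (q - p) * (x - p) / (2 * x - (p + q))"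
      and r: "q - R a x = (q - p) * (x - q) / (2 * x - (p + q))"
      using reflection_diff_left[of a x] reflection_diff_right[of a x] 3 nz by (auto simp: p_def q_def)
    have L: "p < R a x \<longleftrightarrow> 0 < (x - p) / (2 * x - (p + q))"
    proof -
      have "R a x - p = (q - p) * ((x - p) / (2 * x - (p + q)))" using l by simp
      then show ?thesis using pq by (metis diff_gt_0_iff_gt zero_less_mult_pos zero_less_mult_iff)
    qed
    have Rr: "R a x \<le> q \<longleftrightarrow> 0 \<le> (x - q) / (2 * x - (p + q))"
    proof -
      have "q - R a x = (q - p) * ((x - q) / (2 * x - (p + q)))" using r by simp
      then have "0 \<le> q - R a x \<longleftrightarrow> 0 \<le> (x - q) / (2 * x - (p + q))"
        using pq by (simp only: zero_le_mult_iff) auto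
      then show ?thesis by auto
    qed
    \<comment> \<open>Right of the centre the condition at \<open>p\<close> holds anyway and the one
      at \<open>q\<close> says \<open>q < x\<close>; left of the centre the condition at
      \<open>q\<close> holds anyway and the one at \<open>p\<close> says
      \<open>x < p\<close>.\<close>
    have "p < R a x \<and> R a x \<le> q \<longleftrightarrow> \<not> (p < x \<and> x \<le> q)"
      unfolding L Rr zero_less_divide_iff zero_le_divide_iff using pq xn nz by auto
    then show ?thesis using 3 by (auto simp: idx_iff[OF a] p_def q_def)
  qed
qed

end

text \<open>\<open>N\<close> will be the set of nonterminating points.\<close>

locale ideal_polygon = polygon_vertices +
  fixes N :: "real set"
  assumes countable_compl: "countable (- N)"
    and v_notin: "1 \<le> a \<Longrightarrow> a < m \<Longrightarrow> v a \<notin> N"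
    and center_notin: "1 \<le> a \<Longrightarrow> Suc a < m \<Longrightarrow> (v a + v (Suc a)) / 2 \<notin> N"
    and reflection_in: "a < m \<Longrightarrow> x \<in> N \<Longrightarrow> R a x \<in> N"
begin

definition S :: "real \<Rightarrow> real" where
  "S x = R (idx x) x"

definition T :: "real \<times> real \<Rightarrow> real \<times> real" where
  "T = (\<lambda>(x, y). (R (idx x) x, R (idx x) y))"

definition XR :: "(real \<times> real) set" where
  "XR = {(x, y). x \<in> N \<and> y \<in> N \<and> idx x \<noteq> idx y}"

definition \<kappa> :: "real \<Rightarrow> real \<Rightarrow> ennreal" where
  "\<kappa> x y = ennreal (1 / (x - y)\<^sup>2)"

definition MR :: "(real \<times> real) measure" where
  "MR = density (restrict_space lborel XR) (\<lambda>(x, y). \<kappa> x y)"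

lemma not_v: "x \<in> N \<Longrightarrow> 1 \<le> a \<Longrightarrow> a < m \<Longrightarrow> x \<noteq> v a"
  using v_notin by auto

lemma not_center: "x \<in> N \<Longrightarrow> 1 \<le> a \<Longrightarrow> Suc a < m \<Longrightarrow> 2 * x - (v a + v (Suc a)) \<noteq> 0"
proof
  assume x: "x \<in> N" and a: "1 \<le> a" "Suc a < m" and "2 * x - (v a + v (Suc a)) = 0"
  then have "(v a + v (Suc a)) / 2 = x" by simp
  then show False using center_notin[OF a] x by simp
qed

text \<open>For a Moebius map, the squared difference quotient at two points is the product of the
  derivatives there. The invariance of the measure rests on this identity.\<close>

lemma reflection_diff:
  assumes "a < m" and x: "x \<in> N" and y: "y \<in> N"
  shows "\<bar>R a x - R a y\<bar> * \<bar>R a x - R a y\<bar> = jac a x * jac a y * (x - y)\<^sup>2"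
proof (cases "a = 0 \<or> Suc a = m")
  case True
  then show ?thesis by (auto simp: side_reflection_def side_jacobian_def power2_eq_square algebra_simps)
next
  case False
  define p q where "p = v a" and "q = v (Suc a)"
  have nz: "2 * x - (p + q) \<noteq> 0" "2 * y - (p + q) \<noteq> 0"
    using not_center[OF x, of a] not_center[OF y, of a] False assms(1) by (auto simp: p_def q_def)
  have "R a x - R a y = - ((q - p)\<^sup>2 * (x - y)) / ((2 * x - (p + q)) * (2 * y - (p + q)))"
    using nz False unfolding side_reflection_def p_def[symmetric] q_def[symmetric]
    by (simp add: field_simps power2_eq_square)
  then show ?thesis using False nz unfolding side_jacobian_def p_def[symmetric] q_def[symmetric]
    by (simp add: power2_eq_square mult_ac)
qed

lemma reflection_reflection: "a < m \<Longrightarrow> x \<in> N \<Longrightarrow> R a (R a x) = x"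
  by (rule reflection_reflection_regular) (use not_center in auto)

lemma idx_reflection: "a < m \<Longrightarrow> x \<in> N \<Longrightarrow> idx (R a x) = a \<longleftrightarrow> idx x \<noteq> a"
  by (rule idx_reflection_regular) (use not_center not_v in auto)

lemma jac_pos: "a < m \<Longrightarrow> x \<in> N \<Longrightarrow> 0 < jac a x"
  using v_less[of a "Suc a"] not_center[of x a] by (auto simp: side_jacobian_def)

lemma jac_nonneg: "0 \<le> jac a x"
  by (auto simp: side_jacobian_def)

text \<open>The two Jacobians are those of the substitution in each variable, so a double integral
  absorbs them. On the diagonal both sides vanish, as \<open>1 / 0 = 0\<close>.\<close>

lemma \<kappa>_reflection:
  assumes "a < m" "x \<in> N" "y \<in> N"
  shows "\<kappa> x y = \<kappa> (R a x) (R a y) * ennreal (jac a x) * ennreal (jac a y)"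
proof -
  have "(R a x - R a y)\<^sup>2 = jac a x * jac a y * (x - y)\<^sup>2"
    using reflection_diff[OF assms] by (simp add: power2_eq_square flip: abs_mult)
  then have "1 / (x - y)\<^sup>2 = 1 / (R a x - R a y)\<^sup>2 * jac a x * jac a y"
    using jac_pos[OF assms(1,2)] jac_pos[OF assms(1,3)] by (auto simp: field_simps)
  then show ?thesis by (simp add: \<kappa>_def ennreal_mult[symmetric] jac_nonneg del: times_divide_eq_left times_divide_eq_right)
qed

lemma S_in: "x \<in> N \<Longrightarrow> S x \<in> N"
  by (simp add: S_def reflection_in idx_less)

lemma idx_S: "x \<in> N \<Longrightarrow> idx (S x) \<noteq> idx x"
  using idx_reflection[OF idx_less, of x x] by (auto simp: S_def)

lemma T_in: "z \<in> XR \<Longrightarrow> T z \<in> XR"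
  using idx_reflection[OF idx_less, of "fst z" "fst z"] idx_reflection[OF idx_less, of "snd z" "fst z"]
  by (auto simp: XR_def T_def reflection_in idx_less)

text \<open>The swap conjugates \<open>T\<close> to its inverse, so that statements about the fibres over the second
  coordinate carry over to those over the first one.\<close>

lemma swap_T_swap_T: "z \<in> XR \<Longrightarrow> prod.swap (T (prod.swap (T z))) = z"
proof -
  assume "z \<in> XR"
  then obtain x y where z: "z = (x, y)" "x \<in> N" "y \<in> N" "idx x \<noteq> idx y" by (auto simp: XR_def)
  have "idx (R (idx x) y) = idx x" using idx_reflection[OF idx_less, of y x] z by auto
  then show ?thesis using z by (simp add: T_def reflection_reflection idx_less)
qed

lemma swap_in_XR: "prod.swap z \<in> XR \<longleftrightarrow> z \<in> XR"
  by (auto simp: XR_def)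

lemma idx_measurable[measurable]: "idx \<in> measurable borel (count_space UNIV)"
proof -
  have "idx = (\<lambda>x. \<Sum>b\<in>{1..<m}. if v b < x then 1 else 0)"
    by (auto simp: side_index_def fun_eq_iff sum.If_cases Int_def intro!: arg_cong[where f = card])
  moreover have "(\<lambda>x::real. \<Sum>b\<in>{1..<m}. if v b < x then 1 else 0 :: nat) \<in> measurable borel (count_space UNIV)"
    by measurable
  ultimately show ?thesis by simp
qed

lemma R_measurable[measurable]: "R a \<in> borel_measurable borel"
proof -
  have "(\<lambda>x. if a = 0 then 2 * v 1 - x else if Suc a = m then 2 * v a - x
      else ((v a + v (Suc a)) * x - 2 * v a * v (Suc a)) / (2 * x - (v a + v (Suc a)))) \<in> borel_measurable borel"
    by measurable
  then show ?thesis by (simp add: side_reflection_def[abs_def])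
qed

lemma jac_measurable[measurable]: "jac a \<in> borel_measurable borel"
proof -
  have "(\<lambda>x. if a = 0 \<or> Suc a = m then 1
      else (v (Suc a) - v a)\<^sup>2 / (2 * x - (v a + v (Suc a)))\<^sup>2) \<in> borel_measurable borel"
    by measurable
  then show ?thesis by (simp add: side_jacobian_def[abs_def])
qed

lemma S_measurable[measurable]: "S \<in> borel_measurable borel"
  unfolding S_def[abs_def] by (rule measurable_compose_countable[of R]) measurable

lemma T_measurable[measurable]: "T \<in> measurable (borel \<Otimes>\<^sub>M borel) (borel \<Otimes>\<^sub>M borel)"
proof -
  have "(\<lambda>z. (R (idx (fst z)) (fst z), R (idx (fst z)) (snd z))) \<in> measurable (borel \<Otimes>\<^sub>M borel) (borel \<Otimes>\<^sub>M borel)"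
    by (rule measurable_compose_countable[where f = "\<lambda>a z. (R a (fst z), R a (snd z))" and g = "\<lambda>z. idx (fst z)"])
      (auto intro!: measurable_Pair measurable_compose[OF measurable_fst] measurable_compose[OF measurable_snd])
  then show ?thesis by (simp add: T_def case_prod_beta')
qed

lemma N_borel[measurable]: "N \<in> sets borel"
proof -
  have "- N \<in> sets borel" using countable_compl by (rule sets.countable[rotated]) auto
  then show ?thesis by (metis double_complement borel_comp)
qed

lemma XR_borel[measurable]: "XR \<in> sets (borel \<Otimes>\<^sub>M borel)"
proof -
  have "{z \<in> space (borel \<Otimes>\<^sub>M borel). fst z \<in> N \<and> snd z \<in> N \<and>
      (\<exists>a. idx (fst z) = a \<and> \<not> idx (snd z) = a)} \<in> sets (borel \<Otimes>\<^sub>M borel)"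
    by measurable
  moreover have "XR = {z \<in> space (borel \<Otimes>\<^sub>M borel). fst z \<in> N \<and> snd z \<in> N \<and>
      (\<exists>a. idx (fst z) = a \<and> \<not> idx (snd z) = a)}"
    by (auto simp: XR_def space_pair_measure)
  ultimately show ?thesis by simp
qed

lemma AE_N: "AE x in lborel. x \<in> N"
  using countable_compl by (intro AE_I[of _ _ "- N"]) (auto simp: countable_imp_null_set_lborel null_setsD1)

section \<open>Invariance of the measure with density \<open>\<kappa>\<close>\<close>

lemma reflection_deriv:
  assumes a: "a < m" and x: "x \<in> N"
  shows "(R a has_field_derivative - jac a x) (at x)"
proof (cases "a = 0 \<or> Suc a = m")
  case True
  then have "R a = (\<lambda>x. (if a = 0 then 2 * v 1 else 2 * v a) - x)" "jac a x = 1"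
    by (auto simp: side_reflection_def side_jacobian_def fun_eq_iff)
  then show ?thesis by (auto intro!: derivative_eq_intros)
next
  case False
  define p q where "p = v a" and "q = v (Suc a)"
  have nz: "2 * x - (p + q) \<noteq> 0" using not_center[OF x, of a] False a by (auto simp: p_def q_def)
  have "((\<lambda>x. ((p + q) * x - 2 * p * q) / (2 * x - (p + q))) has_field_derivative
      ((p + q) * (2 * x - (p + q)) - ((p + q) * x - 2 * p * q) * 2) /
        ((2 * x - (p + q)) * (2 * x - (p + q)))) (at x)"
    using nz by (auto intro!: derivative_eq_intros)
  moreover have "(p + q) * (2 * x - (p + q)) - ((p + q) * x - 2 * p * q) * 2 = - (q - p)\<^sup>2"
    by (simp add: power2_eq_square algebra_simps)
  moreover have "R a = (\<lambda>x. ((p + q) * x - 2 * p * q) / (2 * x - (p + q)))"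
    and "jac a x = (q - p)\<^sup>2 / (2 * x - (p + q))\<^sup>2"
    using False by (auto simp: side_reflection_def side_jacobian_def p_def q_def fun_eq_iff)
  ultimately show ?thesis by (simp add: power2_eq_square)
qed

text \<open>\<open>R a\<close> is an involution of \<open>N\<close> and so maps \<open>N\<close>
  onto itself. The substitution is carried out on \<open>N\<close>, where no centre occurs, and the
  countable complement does not affect the integrals.\<close>

lemma nn_integral_reflection:
  fixes f :: "real \<Rightarrow> ennreal"
  assumes a: "a < m" and f: "f \<in> borel_measurable borel"
  shows "(\<integral>\<^sup>+x. f (R a x) * ennreal (jac a x) \<partial>lborel) = (\<integral>\<^sup>+x. f x \<partial>lborel)"
proof -
  have im: "R a ` N = N"
  proof (intro equalityI subsetI)
    fix x assume "x \<in> N"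
    then have "R a x \<in> N" "x = R a (R a x)" using reflection_reflection[OF a] reflection_in[OF a] by auto
    then show "x \<in> R a ` N" by (rule rev_image_eqI)
  qed (use reflection_in[OF a] in auto)
  have inj: "inj_on (R a) N"
    by (rule inj_on_inverseI[where g = "R a"]) (rule reflection_reflection[OF a])
  have on_N: "(\<integral>\<^sup>+x. g x \<partial>lborel) = (\<integral>\<^sup>+x\<in>N. g x \<partial>lborel)" for g :: "real \<Rightarrow> ennreal"
    using AE_N by (intro nn_integral_cong_AE) auto
  have "(\<integral>\<^sup>+x\<in>N. f (R a x) * ennreal \<bar>- jac a x\<bar> \<partial>lborel) = (\<integral>\<^sup>+x\<in>R a ` N. f x \<partial>lborel)"
    by (rule nn_integral_change_of_variables_real) (use reflection_deriv[OF a] inj f in \<open>auto simp: im\<close>)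
  then show ?thesis using on_N by (simp add: im jac_nonneg)
qed

lemma \<kappa>_measurable[measurable]:
  "(\<lambda>z. \<kappa> (fst z) (snd z)) \<in> borel_measurable (borel \<Otimes>\<^sub>M borel)"
  unfolding \<kappa>_def by measurable

lemma \<kappa>_measurable'[measurable (raw)]:
  assumes [measurable]: "f \<in> borel_measurable M" "g \<in> borel_measurable M"
  shows "(\<lambda>z. \<kappa> (f z) (g z)) \<in> borel_measurable M"
  unfolding \<kappa>_def by measurable

lemma sets_MR: "sets MR = sets (restrict_space (borel \<Otimes>\<^sub>M borel) XR)"
  by (simp add: MR_def sets_restrict_space borel_prod)

lemma space_MR: "space MR = XR"
  by (simp add: MR_def space_restrict_space)

lemma in_sets_MR: "A \<in> sets MR \<longleftrightarrow> A \<in> sets (borel \<Otimes>\<^sub>M borel) \<and> A \<subseteq> XR"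
  unfolding sets_MR by (subst sets_restrict_space_iff) auto

lemma emeasure_MR:
  assumes "A \<in> sets MR"
  shows "emeasure MR A = (\<integral>\<^sup>+x. \<integral>\<^sup>+y. indicator A (x, y) * \<kappa> x y \<partial>lborel \<partial>lborel)"
  using assms unfolding MR_def
  by (intro emeasure_density_restrict_prod[OF XR_borel \<kappa>_measurable]) simp

lemma T_measurable_MR: "T \<in> measurable MR MR"
proof -
  have "T \<in> measurable (restrict_space (borel \<Otimes>\<^sub>M borel) XR) (restrict_space (borel \<Otimes>\<^sub>M borel) XR)"
    by (intro measurable_restrict_space2 measurable_restrict_space1)
      (auto simp: space_restrict_space T_in)
  then show ?thesis by (simp add: measurable_cong_sets[OF sets_MR sets_MR])
qed

lemma nn_integral_\<kappa>_reflection: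
  assumes a: "a < m" and F[measurable]: "F \<in> borel_measurable (borel \<Otimes>\<^sub>M borel)"
  shows "(\<integral>\<^sup>+x. \<integral>\<^sup>+y. F (R a x, R a y) * \<kappa> x y \<partial>lborel \<partial>lborel) =
    (\<integral>\<^sup>+x. \<integral>\<^sup>+y. F (x, y) * \<kappa> x y \<partial>lborel \<partial>lborel)"
proof -
  define G where "G x y = F (x, y) * \<kappa> x y" for x y
  have G[measurable]: "(\<lambda>z. G (fst z) (snd z)) \<in> borel_measurable (borel \<Otimes>\<^sub>M borel)"
    unfolding G_def by measurable
  have G2: "(\<lambda>z. G (f z) (g z)) \<in> borel_measurable M"
    if "f \<in> borel_measurable M" "g \<in> borel_measurable M" for f g and M :: "'c measure"
    unfolding G_def using that by measurable
  have "(\<integral>\<^sup>+x. \<integral>\<^sup>+y. F (R a x, R a y) * \<kappa> x y \<partial>lborel \<partial>lborel) =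
      (\<integral>\<^sup>+x. \<integral>\<^sup>+y. ennreal (jac a x) * (G (R a x) (R a y) * ennreal (jac a y)) \<partial>lborel \<partial>lborel)"
    using AE_N
  proof (intro nn_integral_cong_AE, eventually_elim)
    fix x assume x: "x \<in> N"
    show "(\<integral>\<^sup>+y. F (R a x, R a y) * \<kappa> x y \<partial>lborel) =
        (\<integral>\<^sup>+y. ennreal (jac a x) * (G (R a x) (R a y) * ennreal (jac a y)) \<partial>lborel)"
      using AE_N
    proof (intro nn_integral_cong_AE, eventually_elim)
      fix y assume y: "y \<in> N"
      show "F (R a x, R a y) * \<kappa> x y = ennreal (jac a x) * (G (R a x) (R a y) * ennreal (jac a y))"
        unfolding \<kappa>_reflection[OF a x y] G_def by (simp add: mult_ac)
    qed
  qed
  also have "\<dots> = (\<integral>\<^sup>+x. ennreal (jac a x) * (\<integral>\<^sup>+y. G (R a x) (R a y) * ennreal (jac a y) \<partial>lborel) \<partial>lborel)"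
    by (intro nn_integral_cong nn_integral_cmult borel_measurable_times_ennreal G2) measurable
  also have "\<dots> = (\<integral>\<^sup>+x. (\<integral>\<^sup>+y. G (R a x) y \<partial>lborel) * ennreal (jac a x) \<partial>lborel)"
    by (intro nn_integral_cong, subst nn_integral_reflection[OF a, of "G _"]) (auto simp: mult_ac intro: G2)
  also have "\<dots> = (\<integral>\<^sup>+x. \<integral>\<^sup>+y. G x y \<partial>lborel \<partial>lborel)"
  proof (rule nn_integral_reflection[OF a])
    have "(\<lambda>x. \<integral>\<^sup>+y. (case (x, y) of (x, y) \<Rightarrow> G x y) \<partial>lborel) \<in> borel_measurable borel"
      by (rule lborel.borel_measurable_nn_integral_fst) (simp add: case_prod_beta')
    then show "(\<lambda>x. \<integral>\<^sup>+y. G x y \<partial>lborel) \<in> borel_measurable borel" by simp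
  qed
  finally show ?thesis by (simp add: G_def)
qed

text \<open>\<open>T\<close> maps the part of \<open>XR\<close> with first coordinate in side
  \<open>a\<close> onto the part with second coordinate in side \<open>a\<close>, by the single
  reflection \<open>R a\<close>. So \<open>A\<close> is cut according to the side of the second
  coordinate, and each piece is pulled back by a map that preserves the kernel.\<close>

lemma emeasure_MR_vimage_T:
  assumes A: "A \<in> sets MR"
  shows "emeasure MR (T -` A \<inter> space MR) = emeasure MR A"
proof -
  have A'[measurable]: "A \<in> sets (borel \<Otimes>\<^sub>M borel)" and AX: "A \<subseteq> XR"
    using A by (auto simp: in_sets_MR)
  define F :: "nat \<Rightarrow> real \<times> real \<Rightarrow> ennreal"
    where "F a z = indicator A z * indicator {z. idx (snd z) = a} z" for a z
  have idxm: "{z. idx (snd z) = a} \<in> sets (borel \<Otimes>\<^sub>M borel)" for a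
  proof -
    have "{z \<in> space (borel \<Otimes>\<^sub>M borel). idx (snd z) = a} \<in> sets (borel \<Otimes>\<^sub>M borel)" by measurable
    then show ?thesis by (simp add: space_pair_measure)
  qed
  have F[measurable]: "F a \<in> borel_measurable (borel \<Otimes>\<^sub>M borel)" for a
    unfolding F_def using idxm[of a] by measurable
  have Fm: "(\<lambda>z. F a (f z, g z)) \<in> borel_measurable M"
    if [measurable]: "f \<in> borel_measurable M" "g \<in> borel_measurable M" for f g a and M :: "'c measure"
    by measurable
  have sumF: "indicator A z = (\<Sum>a<m. F a z)" for z
    using idx_less[of "snd z"] by (simp add: F_def indicator_def sum_distrib_left[symmetric] of_bool_def sum.If_cases Int_def)
  have key: "indicator (T -` A \<inter> space MR) (x, y) = (\<Sum>a<m. F a (R a x, R a y))"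
    if x: "x \<in> N" and y: "y \<in> N" for x y
  proof -
    \<comment> \<open>A different \<open>a\<close> puts \<open>R a x\<close> into side
      \<open>a\<close>; the second coordinate of a point of the piece lies in side \<open>a\<close>
      too, which is impossible in \<open>XR\<close>.\<close>
    have 0: "F a (R a x, R a y) = 0" if "a < m" "a \<noteq> idx x" for a
    proof (rule ccontr)
      assume "F a (R a x, R a y) \<noteq> 0"
      then have "(R a x, R a y) \<in> A" "idx (R a y) = a" by (auto simp: F_def indicator_def split: if_splits)
      with AX have "idx (R a x) \<noteq> a" by (auto simp: XR_def)
      then show False using idx_reflection[OF that(1) x] that(2) by simp
    qed
    have "(\<Sum>a<m. F a (R a x, R a y)) = F (idx x) (R (idx x) x, R (idx x) y)"
      using 0 idx_less[of x] by (subst sum.remove[of _ "idx x"]) auto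
    also have "\<dots> = indicator (T -` A \<inter> space MR) (x, y)"
      using idx_reflection[OF idx_less y, of x] x y T_in[of "(x, y)"] AX
      by (auto simp: F_def T_def space_MR XR_def indicator_def)
    finally show ?thesis ..
  qed
  have "T -` A \<inter> space MR \<in> sets MR" using T_measurable_MR A by (rule measurable_sets)
  then have "emeasure MR (T -` A \<inter> space MR) =
      (\<integral>\<^sup>+x. \<integral>\<^sup>+y. indicator (T -` A \<inter> space MR) (x, y) * \<kappa> x y \<partial>lborel \<partial>lborel)"
    by (rule emeasure_MR)
  also have "\<dots> = (\<integral>\<^sup>+x. \<integral>\<^sup>+y. (\<Sum>a<m. F a (R a x, R a y) * \<kappa> x y) \<partial>lborel \<partial>lborel)"
    using AE_N
  proof (intro nn_integral_cong_AE, eventually_elim)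
    fix x assume x: "x \<in> N"
    show "(\<integral>\<^sup>+y. indicator (T -` A \<inter> space MR) (x, y) * \<kappa> x y \<partial>lborel) =
        (\<integral>\<^sup>+y. (\<Sum>a<m. F a (R a x, R a y) * \<kappa> x y) \<partial>lborel)"
      using AE_N by (intro nn_integral_cong_AE, eventually_elim) (simp only: key[OF x] sum_distrib_right)
  qed
  also have "\<dots> = (\<Sum>a<m. \<integral>\<^sup>+x. \<integral>\<^sup>+y. F a (R a x, R a y) * \<kappa> x y \<partial>lborel \<partial>lborel)"
    by (subst nn_integral_sum[symmetric])
      (auto intro!: nn_integral_cong nn_integral_sum lborel.borel_measurable_nn_integral Fm
        borel_measurable_times_ennreal simp: case_prod_beta')
  also have "\<dots> = (\<Sum>a<m. \<integral>\<^sup>+x. \<integral>\<^sup>+y. F a (x, y) * \<kappa> x y \<partial>lborel \<partial>lborel)"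
    by (intro sum.cong refl nn_integral_\<kappa>_reflection) auto
  also have "\<dots> = (\<integral>\<^sup>+x. \<integral>\<^sup>+y. (\<Sum>a<m. F a (x, y) * \<kappa> x y) \<partial>lborel \<partial>lborel)"
    by (subst nn_integral_sum[symmetric])
      (auto intro!: nn_integral_cong nn_integral_sum[symmetric] lborel.borel_measurable_nn_integral Fm
        borel_measurable_times_ennreal simp: case_prod_beta')
  also have "\<dots> = emeasure MR A"
    by (simp add: emeasure_MR[OF A] sumF sum_distrib_right)
  finally show ?thesis .
qed

lemma measure_preserving_T: "measure_preserving MR T"
  using T_measurable_MR emeasure_MR_vimage_T by (simp add: measure_preserving_def)

section \<open>Expansion along orbits and shrinking of cylinders\<close>

lemma v_first_less_last: "v 1 < v (m - 1)"
  by (rule v_less) (use m_ge_3 in auto)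

lemma S_in_funpow: "x \<in> N \<Longrightarrow> (S ^^ n) x \<in> N"
  by (induction n) (auto simp: S_in)

text \<open>
  On a bounded side \<open>S\<close> is strictly expanding. Two points of the side whose images lie in the same side
  are not separated by the centre.
\<close>

lemma abs_S_diff:
  assumes x: "x \<in> N" and y: "y \<in> N" and i: "idx x = idx y" and i': "idx (S x) = idx (S y)"
  shows "\<bar>x - y\<bar> \<le> \<bar>S x - S y\<bar>"
    and "0 < idx x \<Longrightarrow> Suc (idx x) < m \<Longrightarrow>
      \<bar>x - y\<bar> \<le> v (m - 1) - v 1 \<and>
      \<bar>x - y\<bar> + 2 * \<bar>x - y\<bar>\<^sup>2 / (v (m - 1) - v 1) \<le> \<bar>S x - S y\<bar>"
proof -
  have main: "\<bar>x - y\<bar> \<le> v (m - 1) - v 1 \<and>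
      \<bar>x - y\<bar> + 2 * \<bar>x - y\<bar>\<^sup>2 / (v (m - 1) - v 1) \<le> \<bar>S x - S y\<bar>"
    if a: "0 < idx x" "Suc (idx x) < m"
  proof -
    define a where "a = idx x"
    define p q where "p = v a" and "q = v (Suc a)"
    have a: "0 < a" "Suc a < m" "idx y = a" "idx x = a" using a i by (auto simp: a_def)
    have pq: "p < q" using v_less[of a "Suc a"] a by (auto simp: p_def q_def)
    have L: "q - p \<le> v (m - 1) - v 1"
    proof -
      have *: "1 \<le> a" "a < m" "1 \<le> Suc a" "Suc a \<le> m - 1" "m - 1 < m" using a m_ge_3 by linarith+
      show ?thesis using v_le[OF _ *(1,2)] v_le[OF *(3,4,5)] by (simp add: p_def q_def)
    qed
    have bx: "p < x" "x < q" and by': "p < y" "y < q"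
      using idx_gt[of x] idx_le[of x] idx_gt[of y] idx_le[of y] a
        not_v[OF x, of "Suc a"] not_v[OF y, of "Suc a"]
      by (simp_all add: p_def q_def order_less_le[of _ "v (Suc a)"])
    define X Y where "X = 2 * x - (p + q)" and "Y = 2 * y - (p + q)"
    have nz: "X \<noteq> 0" "Y \<noteq> 0"
      using not_center[OF x, of a] not_center[OF y, of a] a by (auto simp: X_def Y_def p_def q_def)
    have Sx: "S x = R a x" "S y = R a y" using a by (auto simp: S_def)
    have l: "R a z - p = (q - p) * (z - p) / (2 * z - (p + q))"
      and r: "q - R a z = (q - p) * (z - q) / (2 * z - (p + q))" if "2 * z - (p + q) \<noteq> 0" for z
      using reflection_diff_left[of a z] reflection_diff_right[of a z] a that by (auto simp: p_def q_def)
    \<comment> \<open>An image left of the side comes from its left half; by \<open>high\<close>, an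
      image right of the side comes from its right half.\<close>
    have low: "2 * z - (p + q) < 0" if z: "z \<in> N" "p < z" "2 * z - (p + q) \<noteq> 0" "idx (R a z) < a" for z
    proof -
      have "R a z \<le> v (Suc (idx (R a z)))" using idx_le[of "R a z"] z(4) a by auto
      also have "\<dots> \<le> p" unfolding p_def using z(4) a by (intro v_le) auto
      finally have "(q - p) * (z - p) / (2 * z - (p + q)) \<le> 0" using l[OF z(3)] by simp
      then show ?thesis using pq z by (auto simp: divide_le_0_iff mult_le_0_iff)
    qed
    have high: "0 < 2 * z - (p + q)" if z: "z \<in> N" "z < q" "2 * z - (p + q) \<noteq> 0" "a < idx (R a z)" for z
    proof -
      have "q \<le> v (idx (R a z))" unfolding q_def using z(4) a idx_less[of "R a z"] by (intro v_le) auto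
      also have "\<dots> < R a z" using idx_gt[of "R a z"] z(4) by auto
      finally have "(q - p) * (z - q) / (2 * z - (p + q)) < 0" using r[OF z(3)] by simp
      then show ?thesis using pq z by (auto simp: divide_less_0_iff mult_less_0_iff zero_less_mult_iff)
    qed
    have same: "(X > 0 \<and> Y > 0) \<or> (X < 0 \<and> Y < 0)"
      using low[OF x] low[OF y] high[OF x] high[OF y] nz bx by' i' idx_S[OF x] a
      unfolding X_def Y_def Sx by (metis linorder_neqE_nat)
    define d where "d = \<bar>x - y\<bar>"
    define W where "W = q - p"
    have W: "W > 0" using pq by (simp add: W_def)
    have XY: "0 < X * Y" using same by (auto intro: mult_pos_pos mult_neg_neg)
    have dW: "d \<le> W" using bx by' by (auto simp: d_def W_def)
    \<comment> \<open>\<open>X\<close> and \<open>Y\<close> are twice the signed distances from the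
      centre. As they have the same sign, their absolute values differ by \<open>2 * d\<close>, and
      the larger is at most \<open>W\<close>; so the smaller is at most
      \<open>W - 2 * d\<close>.\<close>
    have XYle: "X * Y \<le> W * (W - 2 * d)"
    proof -
      define lo hi where "lo = min \<bar>X\<bar> \<bar>Y\<bar>" and "hi = max \<bar>X\<bar> \<bar>Y\<bar>"
      have "hi - lo = 2 * d" using same
        unfolding lo_def hi_def d_def X_def Y_def by (auto simp: abs_if min_def max_def)
      moreover have "hi \<le> W" using bx by' by (auto simp: hi_def X_def Y_def W_def)
      moreover have "lo \<ge> 0" by (simp add: lo_def)
      moreover have "X * Y = lo * hi"
        using same by (auto simp: lo_def hi_def min_def max_def mult.commute)
      ultimately show ?thesis using W
        by (simp add: mult.commute mult_mono)
    qed
    have pos2: "0 < W - 2 * d" using XY XYle W by (metis less_le_trans zero_less_mult_pos)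
    have "R a x - R a y = - (W\<^sup>2 * (x - y)) / (X * Y)"
    proof -
      have "R a z = ((p + q) * z - 2 * p * q) / (2 * z - (p + q))" for z
        using a by (simp add: side_reflection_def p_def q_def)
      then show ?thesis using nz unfolding X_def Y_def W_def
        by (simp add: field_simps power2_eq_square)
    qed
    then have e: "\<bar>S x - S y\<bar> = W\<^sup>2 * d / (X * Y)"
      using abs_of_pos[OF XY] unfolding Sx by (simp only: abs_divide abs_minus_cancel) (simp add: abs_mult d_def)
    \<comment> \<open>The right-hand side is \<open>d / (1 - 2 * d / W)\<close>, and the left-hand
      side consists of the first two terms of its geometric series.\<close>
    have "d + 2 * d\<^sup>2 / W \<le> W * d / (W - 2 * d)"
    proof -
      have "(d + 2 * d\<^sup>2 / W) * (W - 2 * d) = W * d - 4 * d ^ 3 / W"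
        using W by (simp add: field_simps power2_eq_square power3_eq_cube)
      also have "\<dots> \<le> W * d" using W by (simp add: d_def)
      finally show ?thesis using pos2 by (simp add: pos_le_divide_eq)
    qed
    also have "\<dots> = W\<^sup>2 * d / (W * (W - 2 * d))" using W pos2 by (simp add: field_simps power2_eq_square)
    also have "\<dots> \<le> W\<^sup>2 * d / (X * Y)"
      using XY XYle W by (intro divide_left_mono) (auto simp: d_def intro!: mult_pos_pos pos2)
    finally have "d + 2 * d\<^sup>2 / W \<le> \<bar>S x - S y\<bar>" unfolding e .
    moreover have "2 * d\<^sup>2 / (v (m - 1) - v 1) \<le> 2 * d\<^sup>2 / W"
      using W L by (intro divide_left_mono) (auto simp: W_def)
    ultimately show ?thesis using dW L by (simp add: d_def W_def)
  qed
  then show "0 < idx x \<Longrightarrow> Suc (idx x) < m \<Longrightarrow>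
      \<bar>x - y\<bar> \<le> v (m - 1) - v 1 \<and>
      \<bar>x - y\<bar> + 2 * \<bar>x - y\<bar>\<^sup>2 / (v (m - 1) - v 1) \<le> \<bar>S x - S y\<bar>" .
  show "\<bar>x - y\<bar> \<le> \<bar>S x - S y\<bar>"
  proof (cases "idx x = 0 \<or> Suc (idx x) = m")
    case True
    then show ?thesis using i by (auto simp: S_def side_reflection_def)
  next
    case False
    then have *: "0 < idx x" "Suc (idx x) < m" using idx_less[of x] by auto
    have "0 \<le> 2 * \<bar>x - y\<bar>\<^sup>2 / (v (m - 1) - v 1)"
      using v_first_less_last by simp
    then show ?thesis using main[OF *] by linarith
  qed
qed

text \<open>An orbit that alternates between the two half-lines is translated by \<open>S \<circ> S\<close> until it leaves them.\<close>

lemma inner_side_visited: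
  assumes x: "x \<in> N"
  shows "\<exists>k\<ge>n. 0 < idx ((S ^^ k) x) \<and> Suc (idx ((S ^^ k) x)) < m"
proof (rule ccontr)
  assume "\<not> ?thesis"
  then have outer: "idx ((S ^^ k) x) = 0 \<or> Suc (idx ((S ^^ k) x)) = m" if "k \<ge> n" for k
    using that idx_less[of "(S ^^ k) x"] by (metis Suc_lessI not_gr0)
  have alt: "idx ((S ^^ Suc k) x) \<noteq> idx ((S ^^ k) x)" for k
    using idx_S[OF S_in_funpow[OF x]] by simp
  obtain k0 where k0: "k0 \<ge> n" "idx ((S ^^ k0) x) = 0"
  proof (cases "idx ((S ^^ n) x) = 0")
    case False
    then have "idx ((S ^^ Suc n) x) = 0" using outer[of n] outer[of "Suc n"] alt[of n] by auto
    then show ?thesis using that[of "Suc n"] by auto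
  qed (use that in auto)
  define w where "w = v (m - 1) - v 1"
  have w: "w > 0" using v_first_less_last by (simp add: w_def)
  have "idx ((S ^^ (k0 + 2 * j)) x) = 0 \<and> (S ^^ (k0 + 2 * j)) x = (S ^^ k0) x + 2 * real j * w" for j
  proof (induction j)
    case 0
    then show ?case using k0 by simp
  next
    case (Suc j)
    define u where "u = (S ^^ (k0 + 2 * j)) x"
    have u0: "idx u = 0" using Suc unfolding u_def by blast
    have u: "u = (S ^^ k0) x + 2 * real j * w" using Suc unfolding u_def by blast
    have u1: "(S ^^ Suc (k0 + 2 * j)) x = S u" and u2: "(S ^^ Suc (Suc (k0 + 2 * j))) x = S (S u)"
      by (auto simp: u_def)
    have i1: "Suc (idx (S u)) = m"
      using outer[of "Suc (k0 + 2 * j)"] alt[of "k0 + 2 * j"] k0(1) u0 unfolding u1 u_def[symmetric] by auto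
    have i2: "idx (S (S u)) = 0"
      using outer[of "Suc (Suc (k0 + 2 * j))"] alt[of "Suc (k0 + 2 * j)"] k0(1) i1
      unfolding u1 u2 by auto
    have "idx (S u) = m - 1" "m - 1 \<noteq> 0" "Suc (m - 1) = m" using i1 m_ge_3 by auto
    then have "S (S u) = 2 * v (m - 1) - S u" by (simp add: S_def[of "S u"] side_reflection_def)
    moreover have "S u = 2 * v 1 - u" using u0 by (simp add: S_def side_reflection_def)
    ultimately have "S (S u) = (S ^^ k0) x + 2 * real (Suc j) * w"
      unfolding u w_def by (simp add: algebra_simps)
    moreover have "k0 + 2 * Suc j = Suc (Suc (k0 + 2 * j))" by simp
    ultimately show ?case using u2 i2 by metis
  qed
  note * = this
  have "(S ^^ k0) x + 2 * real j * w \<le> v 1" for j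
  proof -
    have "Suc 0 < m" using m_ge_3 by simp
    then show ?thesis using idx_le[of "(S ^^ (k0 + 2 * j)) x"] *[of j] by (metis One_nat_def)
  qed
  moreover obtain j where "v 1 - (S ^^ k0) x < real j * w"
    using w reals_Archimedean3 by blast
  ultimately have "(S ^^ k0) x + 2 * real j * w \<le> v 1" "v 1 - (S ^^ k0) x < real j * w" "0 \<le> real j * w"
    using w by auto
  then show False by linarith
qed

definition cyl :: "nat \<Rightarrow> real \<Rightarrow> real set" where
  "cyl n x = {y \<in> N. \<forall>i<n. idx ((S ^^ i) y) = idx ((S ^^ i) x)}"

text \<open>If \<open>y\<close> shares the sides of \<open>x\<close> for long but keeps the initial
  distance \<open>\<delta>\<close> or more, the distance of the orbits never shrinks, and it grows
  by \<open>\<eta>\<close> or more at each visit to a bounded side, while at such a visit it is at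
  most the total length \<open>L\<close> of the bounded sides. So the number of visits is bounded.
  Their times depend on \<open>x\<close> only, which makes the bound uniform in
  \<open>y\<close>.\<close>

lemma cyl_subset_ball:
  assumes x: "x \<in> N" and \<delta>: "\<delta> > 0"
  shows "\<exists>n. \<forall>k\<ge>n. cyl k x \<subseteq> ball x \<delta>"
proof -
  define d where "d y n = \<bar>(S ^^ n) y - (S ^^ n) x\<bar>" for y n
  define L where "L = v (m - 1) - v 1"
  define \<eta> where "\<eta> = 2 * \<delta>\<^sup>2 / L"
  have L: "L > 0" using v_first_less_last by (simp add: L_def)
  have \<eta>: "\<eta> > 0" using \<delta> L by (simp add: \<eta>_def)
  define far where "far n = {y \<in> cyl n x. \<delta> \<le> \<bar>y - x\<bar>}" for n
  have far_le: "far j \<subseteq> far i" if "i \<le> j" for i j using that by (auto simp: far_def cyl_def)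
  \<comment> \<open>\<open>Suc k < n\<close> rather than \<open>k < n\<close>: the expansion
    estimate needs the images to share a side as well.\<close>
  have one_step: "d y k \<le> d y (Suc k) \<and> (0 < idx ((S ^^ k) x) \<longrightarrow> Suc (idx ((S ^^ k) x)) < m \<longrightarrow>
      d y k \<le> L \<and> d y k + 2 * (d y k)\<^sup>2 / L \<le> d y (Suc k))"
    if y: "y \<in> far n" "Suc k < n" for y k n
  proof -
    have y': "y \<in> N" "idx ((S ^^ k) y) = idx ((S ^^ k) x)" "idx ((S ^^ Suc k) y) = idx ((S ^^ Suc k) x)"
      using y by (auto simp: far_def cyl_def simp del: funpow.simps)
    have "idx (S ((S ^^ k) y)) = idx (S ((S ^^ k) x))" using y'(3) by simp
    from abs_S_diff[OF S_in_funpow[OF y'(1)] S_in_funpow[OF x] y'(2) this]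
    show ?thesis using y'(2) by (simp add: d_def L_def)
  qed
  have mono: "d y i \<le> d y j" if y: "y \<in> far n" and "i \<le> j" "j < n" for y n i j
    using \<open>i \<le> j\<close> \<open>j < n\<close>
  proof (induction j rule: dec_induct)
    case (step j)
    then show ?case using one_step[OF y, of j] by linarith
  qed simp
  have grow: "d y k \<le> L \<and> d y k + \<eta> \<le> d y (Suc k)"
    if k: "0 < idx ((S ^^ k) x)" "Suc (idx ((S ^^ k) x)) < m" and y: "y \<in> far n" "Suc k < n" for k y n
  proof -
    have *: "d y k \<le> L" "d y k + 2 * (d y k)\<^sup>2 / L \<le> d y (Suc k)"
      using one_step[OF y] k by auto
    have "\<delta> \<le> d y 0" using y(1) by (simp add: far_def d_def)
    also have "\<dots> \<le> d y k" using mono[OF y(1), of 0 k] y(2) by simp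
    finally have "\<delta>\<^sup>2 \<le> (d y k)\<^sup>2" using \<delta> by (intro power_mono) auto
    then have "\<eta> \<le> 2 * (d y k)\<^sup>2 / L" unfolding \<eta>_def using L by (intro divide_right_mono) auto
    with * show ?thesis by linarith
  qed
  have "\<exists>k. \<forall>y\<in>far (Suc k). real j * \<eta> \<le> d y k" for j
  proof (induction j)
    case 0
    then show ?case by (intro exI[of _ 0]) (simp add: d_def)
  next
    case (Suc j)
    then obtain k where k: "\<And>y. y \<in> far (Suc k) \<Longrightarrow> real j * \<eta> \<le> d y k" by blast
    obtain k' where k': "k' \<ge> k" "0 < idx ((S ^^ k') x)" "Suc (idx ((S ^^ k') x)) < m"
      using inner_side_visited[OF x] by blast
    have "real (Suc j) * \<eta> \<le> d y (Suc k')" if y: "y \<in> far (Suc (Suc k'))" for y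
    proof -
      have "real j * \<eta> \<le> d y k" using k[of y] far_le[of "Suc k" "Suc (Suc k')"] y k'(1) by auto
      also have "\<dots> \<le> d y k'" using mono[OF y k'(1)] by simp
      also have "\<dots> \<le> d y (Suc k') - \<eta>" using grow[OF k'(2,3) y] by simp
      finally show ?thesis by (simp add: algebra_simps)
    qed
    then show ?case by blast
  qed
  moreover obtain j where j: "L < real j * \<eta>" using \<eta> reals_Archimedean3 by blast
  ultimately obtain k where k: "\<And>y. y \<in> far (Suc k) \<Longrightarrow> real j * \<eta> \<le> d y k" by blast
  obtain k' where k': "k' \<ge> k" "0 < idx ((S ^^ k') x)" "Suc (idx ((S ^^ k') x)) < m"
    using inner_side_visited[OF x] by blast
  have "far (Suc (Suc k')) = {}"
  proof (rule ccontr)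
    assume "far (Suc (Suc k')) \<noteq> {}"
    then obtain y where y: "y \<in> far (Suc (Suc k'))" by blast
    have "real j * \<eta> \<le> d y k" using k[of y] far_le[of "Suc k" "Suc (Suc k')"] y k'(1) by auto
    also have "\<dots> \<le> d y k'" using mono[OF y k'(1)] by simp
    also have "\<dots> \<le> L" using grow[OF k'(2,3) y] by simp
    finally show False using j by simp
  qed
  then have "cyl k x \<subseteq> ball x \<delta>" if "k \<ge> Suc (Suc k')" for k
    using far_le[OF that] by (fastforce simp: far_def dist_real_def abs_minus_commute)
  then show ?thesis by blast
qed

lemma itinerary_inject:
  assumes x: "x \<in> N" and y: "y \<in> N" and same: "\<And>n. idx ((S ^^ n) x) = idx ((S ^^ n) y)"
  shows "x = y"
proof (rule ccontr)
  assume "x \<noteq> y"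
  then obtain n where "cyl n x \<subseteq> ball x \<bar>x - y\<bar>" using cyl_subset_ball[OF x, of "\<bar>x - y\<bar>"] by auto
  moreover have "y \<in> cyl n x" using y same by (simp add: cyl_def)
  ultimately show False by (auto simp: dist_real_def)
qed

text \<open>
  Close to a vertex, infinity included, the orbit alternates between the two adjacent sides. Hence \<open>D\<close>
  is bounded and stays away from the vertices, and a point that visits \<open>D\<close> only finitely often has an
  eventually 2-periodic itinerary.
\<close>

definition D :: "real set" where
  "D = {x \<in> N. idx (S (S x)) \<noteq> idx x}"

lemma D_borel[measurable]: "D \<in> sets borel"
proof -
  have "{x \<in> space borel. x \<in> N \<and> \<not> (\<exists>a. idx (S (S x)) = a \<and> idx x = a)} \<in> sets borel" by measurable
  moreover have "D = {x \<in> space borel. x \<in> N \<and> \<not> (\<exists>a. idx (S (S x)) = a \<and> idx x = a)}"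
    by (auto simp: D_def)
  ultimately show ?thesis by simp
qed

section \<open>Finite measure of the sweeping set\<close>

lemma nn_integral_inverse_square:
  assumes d: "(0::real) < d"
  shows "(\<integral>\<^sup>+u. ennreal (1 / u\<^sup>2) * indicator {d..} u \<partial>lborel) = ennreal (1 / d)"
proof -
  have "(\<integral>\<^sup>+u. ennreal (1 / u\<^sup>2) * indicator {d..} u \<partial>lborel) = ennreal (0 - (- (1 / d)))"
  proof (rule nn_integral_FTC_atLeast)
    show "((\<lambda>u::real. - (1 / u)) has_real_derivative 1 / u\<^sup>2) (at u)" if "d \<le> u" for u
      using that d by (auto intro!: derivative_eq_intros simp: power2_eq_square field_simps)
    show "((\<lambda>u::real. - (1 / u)) \<longlongrightarrow> 0) at_top"
      using tendsto_minus[OF tendsto_inverse_0_at_top[OF filterlim_ident]] by (simp add: inverse_eq_divide)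
  qed auto
  then show ?thesis by simp
qed

lemma nn_integral_\<kappa>_right:
  assumes "x < b"
  shows "(\<integral>\<^sup>+y. \<kappa> x y * indicator {b..} y \<partial>lborel) = ennreal (1 / (b - x))"
  unfolding \<kappa>_def using nn_integral_inverse_square[of "b - x"] assms
  by (subst nn_integral_real_affine[where c = 1 and t = x])
    (auto simp: indicator_def algebra_simps)

lemma nn_integral_\<kappa>_left:
  assumes "b < x"
  shows "(\<integral>\<^sup>+y. \<kappa> x y * indicator {..b} y \<partial>lborel) = ennreal (1 / (x - b))"
  unfolding \<kappa>_def using nn_integral_inverse_square[of "x - b"] assms
  by (subst nn_integral_real_affine[where c = "-1" and t = x])
    (auto simp: indicator_def algebra_simps)

lemma nn_integral_\<kappa>_far:
  assumes d: "d > 0"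
  shows "(\<integral>\<^sup>+y. \<kappa> x y * indicator {y. d \<le> \<bar>x - y\<bar>} y \<partial>lborel) \<le> ennreal (2 / d)"
proof -
  have "(\<integral>\<^sup>+y. \<kappa> x y * indicator {y. d \<le> \<bar>x - y\<bar>} y \<partial>lborel) \<le>
      (\<integral>\<^sup>+y. \<kappa> x y * indicator {x + d..} y + \<kappa> x y * indicator {..x - d} y \<partial>lborel)"
    by (intro nn_integral_mono) (auto simp: indicator_def)
  also have "\<dots> = ennreal (1 / d) + ennreal (1 / d)"
    using d nn_integral_\<kappa>_right[of x "x + d"] nn_integral_\<kappa>_left[of "x - d" x]
    by (subst nn_integral_add) auto
  also have "\<dots> = ennreal (2 / d)" using d by (simp flip: ennreal_plus)
  finally show ?thesis .
qed

lemma reflection_fixes_vertex: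
  assumes b: "1 \<le> b" "b < m" and a: "a = b \<or> Suc a = b"
  shows "R a (v b) = v b" "isCont (R a) (v b)"
proof -
  have "R a (v b) = v b \<and> isCont (R a) (v b)"
  proof (cases "a = 0 \<or> Suc a = m")
    case True
    then have "b = (if a = 0 then 1 else a)" using a b by auto
    moreover have "R a = (\<lambda>x. (if a = 0 then 2 * v 1 else 2 * v a) - x)"
      using True by (auto simp: side_reflection_def fun_eq_iff)
    ultimately show ?thesis by (auto intro!: continuous_intros)
  next
    case False
    define p q where "p = v a" and "q = v (Suc a)"
    have pq: "p < q" using v_less[of a "Suc a"] False a b by (auto simp: p_def q_def)
    have vb: "v b = p \<or> v b = q" using a by (auto simp: p_def q_def)
    have R: "R a = (\<lambda>x. ((p + q) * x - 2 * p * q) / (2 * x - (p + q)))"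
      using False by (simp add: side_reflection_def p_def q_def fun_eq_iff)
    have nz: "2 * v b - (p + q) \<noteq> 0" using vb pq by auto
    have "((p + q) * v b - 2 * p * q) = v b * (2 * v b - (p + q))"
      using vb by (auto simp: algebra_simps)
    then have "R a (v b) = v b" unfolding R using nz by simp
    moreover have "isCont (R a) (v b)" unfolding R using nz by (intro continuous_intros) auto
    ultimately show ?thesis ..
  qed
  then show "R a (v b) = v b" "isCont (R a) (v b)" by auto
qed

lemma D_away_from_vertex:
  assumes b: "1 \<le> b" "b < m"
  shows "\<exists>d>0. \<forall>x\<in>D. d \<le> \<bar>x - v b\<bar>"
proof -
  define P where "P e \<longleftrightarrow> e > 0 \<and> (\<forall>x\<in>N. \<bar>x - v b\<bar> < e \<longrightarrow> idx x = b \<or> Suc (idx x) = b)" for e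
  have "\<exists>e. P e"
  proof -
    define e1 where "e1 = (if Suc b < m then v (Suc b) - v b else 1)"
    define e2 where "e2 = (if 1 < b then v b - v (b - 1) else 1)"
    have e: "e1 > 0" "e2 > 0" using v_less[of b "Suc b"] v_less[of "b - 1" b] b by (auto simp: e1_def e2_def)
    have "P (min e1 e2)" unfolding P_def
    proof (intro conjI ballI impI)
      fix x assume x: "x \<in> N" "\<bar>x - v b\<bar> < min e1 e2"
      show "idx x = b \<or> Suc (idx x) = b"
      proof (cases "x > v b")
        case True
        have "idx x = b" by (rule idx_eqI) (use x b True in \<open>auto simp: e1_def split: if_splits\<close>)
        then show ?thesis ..
      next
        case False
        have "idx x = b - 1" by (rule idx_eqI) (use x b False in \<open>auto simp: e2_def split: if_splits\<close>)
        then show ?thesis using b by simp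
      qed
    qed (use e in simp)
    then show ?thesis by blast
  qed
  then obtain e where e: "P e" by blast
  \<comment> \<open>Both adjacent reflections are continuous at the vertex and fix it, so one step
    keeps points close to \<open>v b\<close> within \<open>e'\<close>. Two applications confine
    \<open>x\<close>, \<open>S x\<close> and \<open>S (S x)\<close> to the two sides at
    \<open>v b\<close>; successive sides differ, so the first and the third agree.\<close>
  have shrink: "\<exists>d>0. d \<le> e' \<and> (\<forall>x\<in>N. \<bar>x - v b\<bar> < d \<longrightarrow> \<bar>S x - v b\<bar> < e')" if "e' > 0" "e' \<le> e" for e'
  proof -
    have "\<exists>d>0. \<forall>x. \<bar>x - v b\<bar> < d \<longrightarrow> \<bar>R a x - v b\<bar> < e'" if a: "a = b \<or> Suc a = b" for a
      using reflection_fixes_vertex[OF b a] \<open>e' > 0\<close>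
      by (auto simp: continuous_at_eps_delta dist_real_def)
    from this[of b] this[of "b - 1"] obtain d1 d2 where d: "d1 > 0" "d2 > 0"
      "\<And>x. \<bar>x - v b\<bar> < d1 \<Longrightarrow> \<bar>R b x - v b\<bar> < e'" "\<And>x. \<bar>x - v b\<bar> < d2 \<Longrightarrow> \<bar>R (b - 1) x - v b\<bar> < e'"
      using b by auto
    show ?thesis
    proof (intro exI[of _ "min e' (min d1 d2)"] conjI ballI impI)
      fix x assume x: "x \<in> N" "\<bar>x - v b\<bar> < min e' (min d1 d2)"
      then have "idx x = b \<or> idx x = b - 1" using e \<open>e' \<le> e\<close> b by (force simp: P_def)
      then show "\<bar>S x - v b\<bar> < e'" using d x by (auto simp: S_def)
    qed (use d that in auto)
  qed
  obtain d where d: "d > 0" "d \<le> e" "\<And>x. x \<in> N \<Longrightarrow> \<bar>x - v b\<bar> < d \<Longrightarrow> \<bar>S x - v b\<bar> < e"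
    using shrink[of e] e by (auto simp: P_def)
  obtain d' where d': "d' > 0" "d' \<le> d" "\<And>x. x \<in> N \<Longrightarrow> \<bar>x - v b\<bar> < d' \<Longrightarrow> \<bar>S x - v b\<bar> < d"
    using shrink[of d] d by auto
  have "d' \<le> \<bar>x - v b\<bar>" if "x \<in> D" for x
  proof (rule ccontr)
    assume *: "\<not> d' \<le> \<bar>x - v b\<bar>"
    have x: "x \<in> N" "idx (S (S x)) \<noteq> idx x" using that by (auto simp: D_def)
    have near: "\<bar>x - v b\<bar> < e" "\<bar>S x - v b\<bar> < e" "\<bar>S (S x) - v b\<bar> < e"
      using * x d d' S_in[OF x(1)] by (auto intro: less_le_trans)
    have "idx z = b \<or> Suc (idx z) = b" if "z \<in> N" "\<bar>z - v b\<bar> < e" for z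
      using e that by (auto simp: P_def)
    from this[OF x(1) near(1)] this[OF S_in[OF x(1)] near(2)] this[OF S_in[OF S_in[OF x(1)]] near(3)]
    show False using x idx_S[OF x(1)] idx_S[OF S_in[OF x(1)]] by auto
  qed
  then show ?thesis using d'(1) by blast
qed

text \<open>This is the vertex at infinity. Far out, \<open>S \<circ> S\<close> translates inwards
  by \<open>2 * (w - v 1)\<close>, where \<open>w\<close> is the last vertex; the bounds
  \<open>3 * w - 2 * v 1\<close> and \<open>3 * v 1 - 2 * w\<close> are the thresholds past which
  the translated point is still on the same half-line.\<close>

lemma D_bounded: "\<exists>L. \<forall>x\<in>D. \<bar>x\<bar> \<le> L"
proof -
  define w where "w = v (m - 1)"
  have w: "v 1 < w" using v_first_less_last by (simp add: w_def)
  have i0: "idx x = 0" if "x \<le> v 1" for x by (rule idx_eqI) (use that m_ge_3 in auto)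
  have iw: "idx x = m - 1" if "w < x" for x by (rule idx_eqI) (use that m_ge_3 w_def in auto)
  have S0: "S x = 2 * v 1 - x" if "x \<le> v 1" for x using i0[OF that] by (simp add: S_def side_reflection_def)
  have Sw: "S x = 2 * w - x" if "w < x" for x
    using iw[OF that] m_ge_3 by (simp add: S_def side_reflection_def w_def)
  have "x \<le> 3 * w - 2 * v 1" if "x \<in> D" for x
  proof (rule ccontr)
    assume *: "\<not> x \<le> 3 * w - 2 * v 1"
    then have "w < x" using w by linarith
    then have 1: "S x = 2 * w - x" "idx x = m - 1" using Sw iw by blast+
    then have 2: "S x \<le> v 1" using * w by linarith
    then have "S (S x) = 2 * v 1 - (2 * w - x)" using S0[OF 2] 1 by simp
    then have "w < S (S x)" using * w by linarith
    then show False using iw 1 that by (auto simp: D_def)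
  qed
  moreover have "3 * v 1 - 2 * w \<le> x" if "x \<in> D" for x
  proof (rule ccontr)
    assume *: "\<not> 3 * v 1 - 2 * w \<le> x"
    then have "x \<le> v 1" using w by linarith
    then have 1: "S x = 2 * v 1 - x" "idx x = 0" using S0 i0 by blast+
    then have 2: "w < S x" using * w by linarith
    then have "S (S x) = 2 * w - (2 * v 1 - x)" using Sw[OF 2] 1 by simp
    then have "S (S x) \<le> v 1" using * w by linarith
    then show False using i0 1 that by (auto simp: D_def)
  qed
  ultimately have "\<forall>x\<in>D. \<bar>x\<bar> \<le> \<bar>3 * w - 2 * v 1\<bar> + \<bar>3 * v 1 - 2 * w\<bar>" by (auto simp: abs_le_iff) (smt (verit))+
  then show ?thesis by blast
qed

lemma D_gap: "\<exists>d>0. \<forall>x\<in>D. \<forall>b\<in>{1..<m}. d \<le> \<bar>x - v b\<bar>"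
proof -
  have "\<forall>b\<in>{1..<m}. \<exists>d>0. \<forall>x\<in>D. d \<le> \<bar>x - v b\<bar>" using D_away_from_vertex by auto
  then obtain f where f: "\<And>b. b \<in> {1..<m} \<Longrightarrow> f b > 0 \<and> (\<forall>x\<in>D. f b \<le> \<bar>x - v b\<bar>)"
    by (metis (no_types))
  have ne: "finite (f ` {1..<m})" "f ` {1..<m} \<noteq> {}" using m_ge_3 by auto
  show ?thesis
  proof (intro exI[of _ "Min (f ` {1..<m})"] conjI ballI)
    show "Min (f ` {1..<m}) > 0" using ne f by (subst Min_gr_iff) auto
    fix x b assume "x \<in> D" "b \<in> {1..<m}"
    then have "Min (f ` {1..<m}) \<le> f b" "f b \<le> \<bar>x - v b\<bar>"
      using f[of b] ne(1) by (auto intro: Min_le)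
    then show "Min (f ` {1..<m}) \<le> \<bar>x - v b\<bar>" by (rule order_trans)
  qed
qed

lemma separated_by_vertex:
  assumes "idx x \<noteq> idx y" and far: "\<forall>b\<in>{1..<m}. d \<le> \<bar>x - v b\<bar>"
  shows "d \<le> \<bar>x - y\<bar>"
proof -
  consider "idx x < idx y" | "idx y < idx x" using assms(1) by linarith
  then show ?thesis
  proof cases
    case 1
    let ?b = "Suc (idx x)"
    have b: "?b \<in> {1..<m}" using 1 idx_less[of y] by auto
    have "x \<le> v ?b" using idx_le[of x] b by auto
    moreover have "v ?b \<le> v (idx y)" using 1 idx_less[of y] by (intro v_le) auto
    moreover have "v (idx y) < y" using idx_gt[of y] 1 by auto
    moreover have "d \<le> \<bar>x - v ?b\<bar>" using far b by blast
    ultimately show ?thesis by linarith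
  next
    case 2
    let ?b = "idx x"
    have b: "?b \<in> {1..<m}" using 2 idx_less[of x] by auto
    have "v ?b < x" using idx_gt[of x] b by auto
    moreover have "v (Suc (idx y)) \<le> v ?b" using 2 idx_less[of x] by (intro v_le) auto
    moreover have "y \<le> v (Suc (idx y))" using idx_le[of y] 2 idx_less[of x] by auto
    moreover have "d \<le> \<bar>x - v ?b\<bar>" using far b by blast
    ultimately show ?thesis by linarith
  qed
qed

definition D2 :: "(real \<times> real) set" where
  "D2 = {z \<in> XR. fst z \<in> D}"

lemma D2_sets: "D2 \<in> sets MR"
proof -
  have "D2 = XR \<inter> (D \<times> UNIV)" by (auto simp: D2_def)
  moreover have "XR \<inter> (D \<times> UNIV) \<in> sets (borel \<Otimes>\<^sub>M borel)" by (intro sets.Int pair_measureI) auto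
  ultimately show ?thesis by (simp add: in_sets_MR)
qed

text \<open>A point of \<open>D\<close> keeps a distance \<open>d\<close> from all vertices, and a
  vertex separates it from every partner in another side. So each row has measure at most
  \<open>2 / d\<close>, and the rows range over a bounded set.\<close>

lemma emeasure_D2: "emeasure MR D2 < \<infinity>"
proof -
  obtain d where d: "d > 0" "\<And>x. x \<in> D \<Longrightarrow> \<forall>b\<in>{1..<m}. d \<le> \<bar>x - v b\<bar>" using D_gap by blast
  obtain L where L: "\<And>x. x \<in> D \<Longrightarrow> \<bar>x\<bar> \<le> L" using D_bounded by blast
  have "emeasure MR D2 = (\<integral>\<^sup>+x. \<integral>\<^sup>+y. indicator D2 (x, y) * \<kappa> x y \<partial>lborel \<partial>lborel)"
    by (rule emeasure_MR[OF D2_sets])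
  also have "\<dots> \<le> (\<integral>\<^sup>+x. ennreal (2 / d) * indicator {- L..L} x \<partial>lborel)"
  proof (rule nn_integral_mono)
    fix x
    show "(\<integral>\<^sup>+y. indicator D2 (x, y) * \<kappa> x y \<partial>lborel) \<le> ennreal (2 / d) * indicator {- L..L} x"
    proof (cases "x \<in> D")
      case True
      have "(\<integral>\<^sup>+y. indicator D2 (x, y) * \<kappa> x y \<partial>lborel) \<le> (\<integral>\<^sup>+y. \<kappa> x y * indicator {y. d \<le> \<bar>x - y\<bar>} y \<partial>lborel)"
        using separated_by_vertex[OF _ d(2)[OF True]]
        by (intro nn_integral_mono) (auto simp: D2_def XR_def split: split_indicator)
      also have "\<dots> \<le> ennreal (2 / d)" by (rule nn_integral_\<kappa>_far[OF d(1)])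
      finally show ?thesis using L[OF True] by (auto simp: abs_le_iff)
    next
      case False
      then show ?thesis by (simp add: D2_def)
    qed
  qed
  also have "\<dots> = ennreal (2 / d) * emeasure lborel {- L..L}"
    by (rule nn_integral_cmult_indicator) simp
  also have "\<dots> < \<infinity>" by (cases "0 \<le> L") (auto simp: ennreal_mult_less_top)
  finally show ?thesis .
qed

section \<open>Recurrence to the sweeping set\<close>

lemma AE_MR_fst:
  assumes "AE x in lborel. P x"
  shows "AE z in MR. P (fst z)"
proof -
  from assms obtain Z where Z: "{x. \<not> P x} \<subseteq> Z" "emeasure lborel Z = 0" "Z \<in> sets lborel"
    by (auto elim!: AE_E)
  then have Zb[measurable]: "Z \<in> sets borel" by simp
  define B where "B = XR \<inter> (Z \<times> UNIV)"
  have "XR \<inter> (Z \<times> UNIV) \<in> sets (borel \<Otimes>\<^sub>M borel)" by (intro sets.Int pair_measureI) auto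
  then have B: "B \<in> sets MR" by (simp add: in_sets_MR B_def)
  have "AE x in lborel. x \<notin> Z" using Z by (intro AE_not_in) (auto simp: null_sets_def)
  then have "AE x in lborel. (\<integral>\<^sup>+y. indicator B (x, y) * \<kappa> x y \<partial>lborel) = 0"
    by eventually_elim (simp add: B_def)
  then have "emeasure MR B = 0"
    unfolding emeasure_MR[OF B] by (subst nn_integral_cong_AE[where v = "\<lambda>_. 0"]) auto
  then show ?thesis
    using Z(1) B by (intro AE_I[of _ _ B]) (auto simp: space_MR B_def)
qed

lemma fst_T: "fst (T z) = S (fst z)"
  by (simp add: T_def S_def case_prod_beta')

lemma fst_T_funpow: "fst ((T ^^ n) z) = (S ^^ n) (fst z)"
  by (induction n) (auto simp: fst_T)

lemma T_funpow_in: "z \<in> XR \<Longrightarrow> (T ^^ n) z \<in> XR"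
  by (induction n) (auto simp: T_in)

text \<open>From time \<open>k\<close> on the sides repeat with period 2, so the first
  \<open>k + 2\<close> sides determine the itinerary, and the itinerary determines the point. Finite
  words are countably many.\<close>

lemma countable_never_D: "countable {x \<in> N. \<forall>n\<ge>k. (S ^^ n) x \<notin> D}"
proof (rule countableI')
  let ?f = "\<lambda>x. map (\<lambda>i. idx ((S ^^ i) x)) [0..<Suc (Suc k)]"
  show "inj_on (to_nat \<circ> ?f) {x \<in> N. \<forall>n\<ge>k. (S ^^ n) x \<notin> D}"
  proof (rule comp_inj_on)
    show "inj_on ?f {x \<in> N. \<forall>n\<ge>k. (S ^^ n) x \<notin> D}"
    proof (rule inj_onI)
      fix x y assume x: "x \<in> {x \<in> N. \<forall>n\<ge>k. (S ^^ n) x \<notin> D}" and y: "y \<in> {x \<in> N. \<forall>n\<ge>k. (S ^^ n) x \<notin> D}"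
        and eq: "?f x = ?f y"
      have per: "idx ((S ^^ (n + 2)) z) = idx ((S ^^ n) z)"
        if "z \<in> {x \<in> N. \<forall>n\<ge>k. (S ^^ n) x \<notin> D}" "n \<ge> k" for z n
        using that S_in_funpow[of z n] by (auto simp: D_def)
      have start: "idx ((S ^^ i) x) = idx ((S ^^ i) y)" if "i < k + 2" for i
      proof -
        have "?f x ! i = ?f y ! i" using eq by (simp only:)
        then show ?thesis using that by (simp del: upt_Suc)
      qed
      have "idx ((S ^^ n) x) = idx ((S ^^ n) y)" for n
      proof (induction n rule: less_induct)
        case (less n)
        show ?case
        proof (cases "n < k + 2")
          case False
          then obtain n' where n': "n = n' + 2" "n' \<ge> k" by (metis add.commute le_Suc_ex nat_le_linear add_le_cancel_right not_less le_add_diff_inverse2 add_leD2)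
          then show ?thesis using per[OF x n'(2)] per[OF y n'(2)] less[of n'] by simp
        qed (rule start)
      qed
      then show "x = y" using x y by (intro itinerary_inject) auto
    qed
  qed (auto intro: inj_on_subset[OF inj_to_nat])
qed

lemma AE_sweeping: "AE z in MR. \<exists>\<^sub>\<infinity>n. (T ^^ n) z \<in> D2"
proof -
  define B where "B = (\<Union>k. {x \<in> N. \<forall>n\<ge>k. (S ^^ n) x \<notin> D})"
  have "countable B" unfolding B_def using countable_never_D by auto
  then have "AE x in lborel. x \<notin> B"
    by (intro AE_not_in) (rule countable_imp_null_set_lborel)
  then have "AE z in MR. fst z \<notin> B" by (rule AE_MR_fst)
  then show ?thesis using AE_space
  proof eventually_elim
    fix z assume z: "fst z \<notin> B" "z \<in> space MR"
    then have zX: "z \<in> XR" "fst z \<in> N" by (auto simp: space_MR XR_def)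
    then have "\<forall>k. \<exists>n\<ge>k. (S ^^ n) (fst z) \<in> D" using z by (auto simp: B_def)
    then have "\<exists>\<^sub>\<infinity>n. (S ^^ n) (fst z) \<in> D" by (simp add: INFM_nat_le)
    then show "\<exists>\<^sub>\<infinity>n. (T ^^ n) z \<in> D2"
      by (rule INFM_mono) (use zX T_funpow_in in \<open>auto simp: D2_def fst_T_funpow\<close>)
  qed
qed

lemma conservative_T: "conservative MR T"
  using measure_preserving_T D2_sets emeasure_D2 AE_sweeping by (rule conservative_if_sweeping)

section \<open>Cylinders and densities\<close>

lemma cyl_self: "x \<in> N \<Longrightarrow> x \<in> cyl n x"
  by (simp add: cyl_def)

lemma cyl_0: "cyl 0 x = N"
  by (simp add: cyl_def)

lemma cyl_Suc: "cyl (Suc n) x = {y \<in> N. idx y = idx x \<and> S y \<in> cyl n (S x)}"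
  unfolding cyl_def All_less_Suc2 by (auto simp: funpow_Suc_right S_in simp del: funpow.simps(2))

lemma cyl_eq:
  assumes "z \<in> cyl n x" "z \<in> cyl k y" "n \<le> k"
  shows "cyl n x = cyl n y"
  using assms by (auto simp: cyl_def)

lemma cyl_borel[measurable]: "cyl n x \<in> sets borel"
proof (induction n arbitrary: x)
  case 0
  then show ?case by (simp add: cyl_0)
next
  case (Suc n)
  note [measurable] = Suc
  have "{y \<in> space borel. y \<in> N \<and> idx y = idx x \<and> S y \<in> cyl n (S x)} \<in> sets borel" by measurable
  then show ?case by (simp add: cyl_Suc)
qed

lemma countable_cyl: "countable (range (\<lambda>(n, x). cyl n x))"
proof -
  have "range (\<lambda>(n, x). cyl n x) \<subseteq> range (\<lambda>w. {y \<in> N. \<forall>i<length w. idx ((S ^^ i) y) = w ! i})"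
  proof safe
    fix n x
    show "cyl n x \<in> range (\<lambda>w. {y \<in> N. \<forall>i<length w. idx ((S ^^ i) y) = w ! i})"
      by (rule range_eqI[of _ _ "map (\<lambda>i. idx ((S ^^ i) x)) [0..<n]"]) (simp add: cyl_def)
  qed
  then show ?thesis by (rule countable_subset) simp
qed

text \<open>
  A density argument in place of the Lebesgue density theorem: the maximal cylinders with deficient
  density inside an open set are disjoint, and they cover every point at which deficient cylinders
  recur.
\<close>

lemma recurrent_low_density_null:
  fixes \<nu> :: "real measure"
  assumes sets_\<nu>: "sets \<nu> = sets borel" and fin: "emeasure \<nu> (space \<nu>) \<noteq> \<infinity>"
    and Z: "Z \<in> sets borel" and F: "F \<in> sets borel" and ZF: "Z \<subseteq> F" "Z \<subseteq> N" and r: "r < (1 :: ennreal)"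
    and low: "\<And>x. x \<in> Z \<Longrightarrow> \<exists>\<^sub>\<infinity>n. emeasure \<nu> (F \<inter> cyl n x) \<le> r * emeasure \<nu> (cyl n x)"
  shows "emeasure \<nu> Z = 0"
proof -
  have le: "emeasure \<nu> Z \<le> r * emeasure \<nu> U" if U: "Z \<subseteq> U" "open U" for U
  proof -
    define P where "P n x \<longleftrightarrow> cyl n x \<subseteq> U \<and> emeasure \<nu> (F \<inter> cyl n x) \<le> r * emeasure \<nu> (cyl n x)" for n x
    have ex: "\<exists>n. P n x" if x: "x \<in> Z" for x
    proof -
      have "x \<in> U" "x \<in> N" using x U(1) ZF(2) by auto
      obtain \<delta> where \<delta>: "\<delta> > 0" "ball x \<delta> \<subseteq> U" using U(2) \<open>x \<in> U\<close> by (rule openE)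
      obtain n where n: "\<forall>k\<ge>n. cyl k x \<subseteq> ball x \<delta>"
        using cyl_subset_ball[OF \<open>x \<in> N\<close> \<delta>(1)] by blast
      obtain k where "k \<ge> n" "emeasure \<nu> (F \<inter> cyl k x) \<le> r * emeasure \<nu> (cyl k x)"
        using low[OF x] unfolding INFM_nat_le by blast
      then have "P k x" using n \<delta>(2) unfolding P_def by blast
      then show ?thesis ..
    qed
    define l where "l x = (LEAST n. P n x)" for x
    have Pl: "P (l x) x" if "x \<in> Z" for x unfolding l_def using ex[OF that] by (rule LeastI_ex)
    define \<C> where "\<C> = (\<lambda>x. cyl (l x) x) ` Z"
    have cnt: "countable \<C>" by (rule countable_subset[OF _ countable_cyl]) (auto simp: \<C>_def)
    have C_sets[measurable]: "C \<in> sets \<nu>" if "C \<in> \<C>" for C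
      using that by (auto simp: \<C>_def sets_\<nu>)
    \<comment> \<open>If two chosen cylinders meet, the one of smaller depth contains both points;
      it is then admissible for the other point as well, whose least depth cannot be larger.\<close>
    have disj': "cyl (l x) x = cyl (l y) y"
      if xy: "x \<in> Z" "y \<in> Z" "z \<in> cyl (l x) x" "z \<in> cyl (l y) y" "l x \<le> l y" for x y z
    proof -
      have eq: "cyl (l x) x = cyl (l x) y" using xy by (intro cyl_eq)
      then have "P (l x) y" using Pl[OF xy(1)] by (simp add: P_def)
      then have "l y \<le> l x" unfolding l_def[of y] by (rule Least_le)
      then show ?thesis using eq xy(5) by simp
    qed
    have disj: "disjoint_family_on (\<lambda>C. C) \<C>"
      unfolding disjoint_family_on_def
    proof (intro ballI impI, rule ccontr)
      fix A B assume "A \<in> \<C>" "B \<in> \<C>" "A \<noteq> B" "A \<inter> B \<noteq> {}"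
      then obtain x y z where "x \<in> Z" "y \<in> Z" "A = cyl (l x) x" "B = cyl (l y) y" "z \<in> A" "z \<in> B"
        by (auto simp: \<C>_def)
      then show False using disj'[of x y z] disj'[of y x z] \<open>A \<noteq> B\<close> by (cases "l x \<le> l y") auto
    qed
    have disjF: "disjoint_family_on (\<lambda>C. F \<inter> C) \<C>" using disj by (auto simp: disjoint_family_on_def)
    have FC_sets: "F \<inter> C \<in> sets \<nu>" if "C \<in> \<C>" for C using C_sets[OF that] F by (auto simp: sets_\<nu>)
    have "Z \<subseteq> (\<Union>C\<in>\<C>. F \<inter> C)" using ZF cyl_self unfolding \<C>_def by blast
    then have "emeasure \<nu> Z \<le> emeasure \<nu> (\<Union>C\<in>\<C>. F \<inter> C)"
      using cnt FC_sets by (intro emeasure_mono sets.countable_UN') auto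
    also have "\<dots> = (\<integral>\<^sup>+C. emeasure \<nu> (F \<inter> C) \<partial>count_space \<C>)"
      using cnt FC_sets disjF by (intro emeasure_UN_countable)
    also have "\<dots> \<le> (\<integral>\<^sup>+C. r * emeasure \<nu> C \<partial>count_space \<C>)"
    proof (rule nn_integral_mono)
      fix C assume "C \<in> space (count_space \<C>)"
      then obtain x where "x \<in> Z" "C = cyl (l x) x" by (auto simp: \<C>_def)
      then show "emeasure \<nu> (F \<inter> C) \<le> r * emeasure \<nu> C" using Pl by (auto simp: P_def)
    qed
    also have "\<dots> = r * (\<integral>\<^sup>+C. emeasure \<nu> C \<partial>count_space \<C>)"
      by (rule nn_integral_cmult) simp
    also have "(\<integral>\<^sup>+C. emeasure \<nu> C \<partial>count_space \<C>) = emeasure \<nu> (\<Union>C\<in>\<C>. C)"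
      using cnt C_sets disj by (intro emeasure_UN_countable[symmetric])
    also have "r * \<dots> \<le> r * emeasure \<nu> U"
    proof (rule mult_left_mono[OF emeasure_mono])
      show "(\<Union>C\<in>\<C>. C) \<subseteq> U" using Pl by (auto simp: \<C>_def P_def)
      show "U \<in> sets \<nu>" using U by (simp add: sets_\<nu>)
    qed simp
    finally show ?thesis .
  qed
  have Zfin: "emeasure \<nu> Z \<noteq> \<infinity>"
    using fin emeasure_space[of \<nu> Z] by (metis infinity_ennreal_def neq_top_trans)
  show ?thesis
  proof (rule ccontr)
    assume nz: "emeasure \<nu> Z \<noteq> 0"
    \<comment> \<open>Outer regularity turns the estimate for all open \<open>U\<close> into one for
      \<open>Z\<close> itself, which is absurd for \<open>r < 1\<close> and a measure that is
      positive and finite. The case \<open>r = 0\<close> is split off because of the division by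
      \<open>r\<close>.\<close>
    have "emeasure \<nu> Z \<le> r * emeasure \<nu> Z"
    proof (cases "r = 0")
      case True
      then show ?thesis using le[of UNIV] by simp
    next
      case False
      have rfin: "r \<noteq> \<infinity>" using r by auto
      have "emeasure \<nu> Z / r \<le> emeasure \<nu> Z"
        unfolding outer_regular[OF sets_\<nu> fin Z]
      proof (rule INF_greatest)
        fix U assume "U \<in> {U. Z \<subseteq> U \<and> open U}"
        then have "emeasure \<nu> Z \<le> r * emeasure \<nu> U" by (auto intro: le)
        then have "emeasure \<nu> Z / r \<le> r * emeasure \<nu> U / r" by (rule divide_right_mono_ennreal)
        also have "\<dots> = emeasure \<nu> U"
          using False rfin by (metis ennreal_mult_divide_eq mult.commute infinity_ennreal_def)
        finally show "(INF U\<in>{U. Z \<subseteq> U \<and> open U}. emeasure \<nu> U) / r \<le> emeasure \<nu> U"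
          unfolding outer_regular[OF sets_\<nu> fin Z] .
      qed
      then have "r * (emeasure \<nu> Z / r) \<le> r * emeasure \<nu> Z" by (rule mult_left_mono) simp
      moreover have "r * (emeasure \<nu> Z / r) = emeasure \<nu> Z"
        using False rfin by (metis ennreal_times_divide ennreal_mult_divide_eq mult.commute infinity_ennreal_def)
      ultimately show ?thesis by simp
    qed
    also have "\<dots> < 1 * emeasure \<nu> Z"
      using r nz Zfin by (intro ennreal_mult_strict_right_mono) (auto simp: zero_less_iff_neq_zero less_top)
    finally show False by simp
  qed
qed

text \<open>
  Measuring a fibre with \<open>dx / (x - y)\<^sup>2\<close> instead of \<open>dx\<close> makes distortion estimates superfluous:
  each branch of \<open>T\<close> maps such a measure to a constant multiple of another one.
\<close>

definition fibre :: "(real \<times> real) set \<Rightarrow> real \<Rightarrow> real set \<Rightarrow> ennreal" where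
  "fibre E y C = (\<integral>\<^sup>+x. \<kappa> x y * indicator E (x, y) * indicator C x \<partial>lborel)"

definition T_inv :: "(real \<times> real) set \<Rightarrow> bool" where
  "T_inv E \<longleftrightarrow> E \<in> sets MR \<and> (\<forall>z\<in>XR. T z \<in> E \<longleftrightarrow> z \<in> E)"

section \<open>Fibre measures and their transport\<close>

lemma sets_MR_Pair:
  assumes E: "E \<in> sets MR"
  shows "(\<lambda>x. indicator E (x, y) :: ennreal) \<in> borel_measurable borel"
    and "(\<lambda>y. indicator E (x, y) :: ennreal) \<in> borel_measurable borel"
proof -
  have [measurable]: "E \<in> sets (borel \<Otimes>\<^sub>M borel)" using E by (simp add: in_sets_MR)
  show "(\<lambda>x. indicator E (x, y) :: ennreal) \<in> borel_measurable borel"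
    and "(\<lambda>y. indicator E (x, y) :: ennreal) \<in> borel_measurable borel" by measurable
qed

text \<open>The reflection \<open>R a\<close> with \<open>a = idx x\<close> is substituted in the
  fibre over \<open>y\<close>. One Jacobian is that of the substitution; the other one, taken at the
  fixed second coordinate \<open>y\<close>, comes out as a constant.\<close>

lemma fibre_cyl_Suc:
  assumes E: "T_inv E" and z: "(x, y) \<in> XR"
  shows "fibre E y (cyl (Suc n) x) = ennreal (jac (idx x) y) * fibre E (R (idx x) y) (cyl n (S x))"
proof -
  define a where "a = idx x"
  have a: "a < m" by (simp add: a_def idx_less)
  have y: "y \<in> N" "idx y \<noteq> a" using z by (auto simp: XR_def a_def)
  have Ry: "R a y \<in> N" "idx (R a y) = a" using y a by (auto simp: reflection_in idx_reflection)
  have ES: "E \<in> sets MR" using E by (simp add: T_inv_def)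
  have EX: "E \<subseteq> XR" using ES by (simp add: in_sets_MR)
  define G where "G x' = \<kappa> x' (R a y) * indicator E (x', R a y) * indicator (cyl n (S x)) x'" for x'
  have G[measurable]: "G \<in> borel_measurable borel"
    unfolding G_def using sets_MR_Pair[OF ES] by measurable
  have "fibre E y (cyl (Suc n) x) = (\<integral>\<^sup>+x'. ennreal (jac a y) * (G (R a x') * ennreal (jac a x')) \<partial>lborel)"
    unfolding fibre_def using AE_N
  proof (intro nn_integral_cong_AE, eventually_elim)
    fix u assume u: "u \<in> N"
    show "\<kappa> u y * indicator E (u, y) * indicator (cyl (Suc n) x) u =
        ennreal (jac a y) * (G (R a u) * ennreal (jac a u))"
    proof (cases "idx u = a")
      case True
      then have Su: "S u = R a u" by (simp add: S_def)
      have uX: "(u, y) \<in> XR" using u y True by (simp add: XR_def)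
      have Tu: "T (u, y) = (R a u, R a y)" using True by (simp add: T_def)
      have "T (u, y) \<in> E \<longleftrightarrow> (u, y) \<in> E" using E uX unfolding T_inv_def by blast
      then have "(R a u, R a y) \<in> E \<longleftrightarrow> (u, y) \<in> E" unfolding Tu .
      moreover have "u \<in> cyl (Suc n) x \<longleftrightarrow> R a u \<in> cyl n (S x)"
        using u True by (simp add: cyl_Suc Su a_def[symmetric])
      ultimately show ?thesis
        unfolding \<kappa>_reflection[OF a u y(1)] G_def by (simp add: indicator_def mult_ac)
    next
      case False
      \<comment> \<open>Such a \<open>u\<close> is reflected into side \<open>a\<close>, where
        \<open>R a y\<close> lies already, so the pair is not in \<open>XR\<close>. That is why
        \<open>G\<close> carries no restriction to side \<open>a\<close>.\<close>
      then have "(R a u, R a y) \<notin> E"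
        using EX Ry idx_reflection[OF a u] by (auto simp: XR_def)
      then show ?thesis using False by (simp add: G_def cyl_Suc a_def[symmetric])
    qed
  qed
  also have "\<dots> = ennreal (jac a y) * (\<integral>\<^sup>+x'. G (R a x') * ennreal (jac a x') \<partial>lborel)"
    by (rule nn_integral_cmult) measurable
  also have "(\<integral>\<^sup>+x'. G (R a x') * ennreal (jac a x') \<partial>lborel) = (\<integral>\<^sup>+x'. G x' \<partial>lborel)"
    by (rule nn_integral_reflection[OF a]) simp
  finally show ?thesis by (simp add: G_def fibre_def a_def)
qed

lemma T_inv_XR: "T_inv XR"
  by (simp add: T_inv_def in_sets_MR T_in)

text \<open>
  The factor \<open>c\<close> does not depend on \<open>E\<close>: densities relative to \<open>XR\<close> are transported exactly.
\<close>

lemma fibre_cyl: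
  assumes z: "(x, y) \<in> XR"
  shows "\<exists>c. \<forall>E. T_inv E \<longrightarrow>
    fibre E y (cyl n x) = c * fibre E (snd ((T ^^ n) (x, y))) N"
  using z
proof (induction n arbitrary: x y)
  case 0
  then show ?case by (intro exI[of _ 1]) (simp add: cyl_0)
next
  case (Suc n)
  define a where "a = idx x"
  have T: "T (x, y) = (S x, R a y)" by (simp add: T_def S_def a_def)
  then have "(S x, R a y) \<in> XR" using T_in[OF Suc.prems] by simp
  from Suc.IH[OF this] obtain c where c: "\<And>E. T_inv E \<Longrightarrow>
      fibre E (R a y) (cyl n (S x)) = c * fibre E (snd ((T ^^ n) (S x, R a y))) N" by blast
  have "(T ^^ Suc n) (x, y) = (T ^^ n) (S x, R a y)" by (simp only: funpow_Suc_right o_apply T)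
  then have "fibre E y (cyl (Suc n) x) = (ennreal (jac a y) * c) * fibre E (snd ((T ^^ Suc n) (x, y))) N"
    if "T_inv E" for E
    using fibre_cyl_Suc[OF that Suc.prems, of n] c[OF that] by (simp only: a_def[symmetric] mult.assoc)
  then show ?case by blast
qed

lemma fibre_XR_finite:
  assumes y: "y \<in> N"
  shows "fibre XR y N < \<infinity>"
proof -
  have "0 < Min ((\<lambda>b. \<bar>y - v b\<bar>) ` {1..<m})"
    using m_ge_3 not_v[OF y] by (subst Min_gr_iff) auto
  then obtain d where d: "d > 0" "\<forall>b\<in>{1..<m}. d \<le> \<bar>y - v b\<bar>"
    by (metis (no_types, lifting) Min_le finite_atLeastLessThan finite_imageI image_eqI)
  have "fibre XR y N \<le> (\<integral>\<^sup>+x. \<kappa> y x * indicator {x. d \<le> \<bar>y - x\<bar>} x \<partial>lborel)"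
    unfolding fibre_def using separated_by_vertex[OF _ d(2)]
    by (intro nn_integral_mono) (auto simp: XR_def \<kappa>_def power2_commute split: split_indicator)
  also have "\<dots> \<le> ennreal (2 / d)" by (rule nn_integral_\<kappa>_far[OF d(1)])
  finally show ?thesis by (auto simp: less_top intro: le_less_trans)
qed

lemma fibre_measurable[measurable]:
  assumes E: "E \<in> sets MR"
  shows "(\<lambda>y. fibre E y N) \<in> borel_measurable borel"
proof -
  have [measurable]: "E \<in> sets (borel \<Otimes>\<^sub>M borel)" using E by (simp add: in_sets_MR)
  have "(\<lambda>y. \<integral>\<^sup>+x. (\<lambda>(y, x). \<kappa> x y * indicator E (x, y) * indicator N x) (y, x) \<partial>lborel) \<in> borel_measurable borel"
    by (rule lborel.borel_measurable_nn_integral_fst) measurable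
  then show ?thesis by (simp add: fibre_def)
qed

section \<open>Ergodicity\<close>

lemma emeasure_MR_snd:
  assumes A: "A \<in> sets MR"
  shows "emeasure MR A = (\<integral>\<^sup>+y. fibre A y N \<partial>lborel)"
proof -
  have [measurable]: "A \<in> sets (borel \<Otimes>\<^sub>M borel)" and AX: "A \<subseteq> XR" using A by (auto simp: in_sets_MR)
  have "emeasure MR A = (\<integral>\<^sup>+x. \<integral>\<^sup>+y. indicator A (x, y) * \<kappa> x y \<partial>lborel \<partial>lborel)"
    by (rule emeasure_MR[OF A])
  also have "\<dots> = (\<integral>\<^sup>+y. \<integral>\<^sup>+x. indicator A (x, y) * \<kappa> x y \<partial>lborel \<partial>lborel)"
    by (rule lborel_pair.Fubini'[symmetric]) (simp add: case_prod_beta')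
  also have "\<dots> = (\<integral>\<^sup>+y. fibre A y N \<partial>lborel)"
    unfolding fibre_def using AX
    by (intro nn_integral_cong) (auto simp: XR_def split: split_indicator)
  finally show ?thesis .
qed

text \<open>This serves to pick from a given side a point with a property that holds almost
  everywhere.\<close>

lemma side_not_null:
  assumes a: "a < m" and P: "AE x in lborel. P x"
  shows "\<exists>x\<in>N. idx x = a \<and> P x"
proof -
  define l u where "l = (if a = 0 then v 1 - 1 else v a)" and "u = (if Suc a < m then v (Suc a) else v a + 1)"
  have lu: "l < u" using v_less[of a "Suc a"] m_ge_3 a by (auto simp: l_def u_def)
  have i: "idx x = a" if "x \<in> {l<..<u}" for x
    by (rule idx_eqI[OF a]) (use that in \<open>auto simp: l_def u_def split: if_splits\<close>)
  show ?thesis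
  proof (rule ccontr)
    assume no: "\<not> ?thesis"
    from P AE_N have "AE x in lborel. x \<notin> {l<..<u}"
      by eventually_elim (use no i in blast)
    then have "emeasure lborel {l<..<u} = 0" by (subst (asm) AE_iff_measurable[of "{l<..<u}"]) auto
    then show False using lu by simp
  qed
qed

lemma fibre_pos:
  assumes y: "y \<in> N"
  shows "fibre XR y N \<noteq> 0"
proof
  assume "fibre XR y N = 0"
  then have "AE x in lborel. \<kappa> x y * indicator XR (x, y) * indicator N x = 0"
    unfolding fibre_def using sets_MR_Pair[of XR y] T_inv_XR
    by (subst (asm) nn_integral_0_iff_AE) (auto simp: T_inv_def)
  then have ae: "AE x in lborel. x \<in> N \<longrightarrow> idx x = idx y"
  proof eventually_elim
    fix x assume "\<kappa> x y * indicator XR (x, y) * indicator N x = 0"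
    then have "x \<in> N \<Longrightarrow> x = y \<or> (x, y) \<notin> XR" by (auto simp: \<kappa>_def indicator_def split: if_splits)
    then show "x \<in> N \<longrightarrow> idx x = idx y" using y by (auto simp: XR_def)
  qed
  have "(if idx y = 0 then 1 else 0) < m" using m_ge_3 by simp
  from side_not_null[OF this ae] show False by (auto split: if_splits)
qed

lemma fibre_mono: "E \<subseteq> E' \<Longrightarrow> fibre E y C \<le> fibre E' y C"
  unfolding fibre_def by (intro nn_integral_mono) (auto split: split_indicator)

lemma fibre_Diff:
  assumes E: "E \<in> sets MR"
  shows "fibre XR y N = fibre E y N + fibre (XR - E) y N"
proof -
  have XE: "XR - E \<in> sets MR" using E T_inv_XR by (auto simp: T_inv_def)
  have EX: "E \<subseteq> XR" using E by (simp add: in_sets_MR)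
  note [measurable] = sets_MR_Pair[OF E] sets_MR_Pair[OF XE]
  show ?thesis
    unfolding fibre_def using EX
    by (subst nn_integral_add[symmetric])
      (auto intro!: nn_integral_cong split: split_indicator)
qed

text \<open>The density of \<open>E\<close> in the cylinder of depth \<open>n\<close> around
  \<open>x\<close> is its density in the whole fibre reached at time \<open>n\<close>, since the
  constant of \<open>fibre_cyl\<close> cancels. So deficient fibres along the orbit become deficient
  cylinders around \<open>x\<close>, and the density argument applies to the measure of the fibre
  over \<open>y\<close>.\<close>

lemma fibre_density:
  assumes E: "T_inv E" and y: "y \<in> N" and r: "r < 1"
    and Z: "Z \<in> sets borel" "\<And>x. x \<in> Z \<Longrightarrow> (x, y) \<in> E"
    and low: "\<And>x. x \<in> Z \<Longrightarrow>
      \<exists>\<^sub>\<infinity>n. fibre E (snd ((T ^^ n) (x, y))) N \<le> r * fibre XR (snd ((T ^^ n) (x, y))) N"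
  shows "(\<integral>\<^sup>+x. \<kappa> x y * indicator XR (x, y) * indicator Z x \<partial>lborel) = 0"
proof -
  have ES: "E \<in> sets MR" and EX: "E \<subseteq> XR" using E by (auto simp: T_inv_def in_sets_MR)
  have XRS: "XR \<in> sets MR" using T_inv_XR by (simp add: T_inv_def)
  note [measurable] = sets_MR_Pair[OF ES] sets_MR_Pair[OF XRS] Z(1)
  define \<nu> where "\<nu> = density lborel (\<lambda>x. \<kappa> x y * indicator XR (x, y))"
  have sets_\<nu>: "sets \<nu> = sets borel" by (simp add: \<nu>_def)
  have em: "emeasure \<nu> C = (\<integral>\<^sup>+x. \<kappa> x y * indicator XR (x, y) * indicator C x \<partial>lborel)"
    if "C \<in> sets borel" for C
    using that unfolding \<nu>_def by (subst emeasure_density) auto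
  define F where "F = {x. (x, y) \<in> E}"
  have F: "F \<in> sets borel"
  proof -
    have "F = (\<lambda>x. (x, y)) -` E \<inter> space borel" by (auto simp: F_def)
    also have "\<dots> \<in> sets borel"
      using ES by (intro measurable_sets[of _ _ "borel \<Otimes>\<^sub>M borel"]) (auto simp: in_sets_MR)
    finally show ?thesis .
  qed
  have FN: "F \<subseteq> N" using EX by (auto simp: F_def XR_def)
  have "emeasure \<nu> Z = 0"
  proof (rule recurrent_low_density_null[OF sets_\<nu> _ Z(1) F _ _ r])
    have "space \<nu> = UNIV" by (simp add: \<nu>_def)
    then have "emeasure \<nu> (space \<nu>) = fibre XR y N"
      using em[of UNIV] unfolding fibre_def
      by (auto intro!: nn_integral_cong simp: XR_def split: split_indicator)
    then show "emeasure \<nu> (space \<nu>) \<noteq> \<infinity>" using fibre_XR_finite[OF y] by simp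
    show "Z \<subseteq> F" "Z \<subseteq> N" using Z(2) FN by (auto simp: F_def)
    fix x assume x: "x \<in> Z"
    then have xy: "(x, y) \<in> XR" using Z(2) EX by auto
    have "emeasure \<nu> (F \<inter> cyl n x) \<le> r * emeasure \<nu> (cyl n x)"
      if *: "fibre E (snd ((T ^^ n) (x, y))) N \<le> r * fibre XR (snd ((T ^^ n) (x, y))) N" for n
    proof -
      obtain c where c: "\<And>E. T_inv E \<Longrightarrow> fibre E y (cyl n x) = c * fibre E (snd ((T ^^ n) (x, y))) N"
        using fibre_cyl[OF xy] by blast
      have "emeasure \<nu> (F \<inter> cyl n x) = fibre E y (cyl n x)"
        using F EX by (subst em) (auto simp: fibre_def F_def intro!: nn_integral_cong split: split_indicator)
      also have "\<dots> = c * fibre E (snd ((T ^^ n) (x, y))) N" by (rule c[OF E])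
      also have "\<dots> \<le> c * (r * fibre XR (snd ((T ^^ n) (x, y))) N)" using * by (rule mult_left_mono) simp
      also have "\<dots> = r * fibre XR y (cyl n x)" using c[OF T_inv_XR] by (simp add: mult_ac)
      also have "\<dots> = r * emeasure \<nu> (cyl n x)" by (subst em) (auto simp: fibre_def)
      finally show ?thesis .
    qed
    then show "\<exists>\<^sub>\<infinity>n. emeasure \<nu> (F \<inter> cyl n x) \<le> r * emeasure \<nu> (cyl n x)"
      using low[OF x] by (rule INFM_mono[rotated])
  qed
  then show ?thesis using em[OF Z(1)] by simp
qed

text \<open>The points of \<open>E\<close> whose orbits meet deficient fibres in \<open>E\<close>
  infinitely often are null, fibre by fibre. By recurrence almost every point of \<open>E\<close> in
  a deficient fibre is of that kind, so almost no point is in one.\<close>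

lemma fibre_low_null:
  assumes E: "T_inv E" and r: "r < 1"
  shows "AE z in MR. z \<in> E \<longrightarrow> \<not> fibre E (snd z) N \<le> r * fibre XR (snd z) N"
proof -
  have ES: "E \<in> sets MR" and EX: "E \<subseteq> XR" using E by (auto simp: T_inv_def in_sets_MR)
  have XRS: "XR \<in> sets MR" using T_inv_XR by (simp add: T_inv_def)
  note T_measurable_MR[measurable] measurable_funpow[OF T_measurable_MR, measurable] ES[measurable]
  have fm: "(\<lambda>z. fibre A (snd z) N) \<in> borel_measurable MR" if "A \<in> sets MR" for A
  proof -
    have "snd \<in> borel_measurable MR"
      unfolding MR_def by (auto intro!: measurable_restrict_space1 simp: borel_prod[symmetric])
    then show ?thesis using fibre_measurable[OF that] by (rule measurable_compose)
  qed
  note [measurable] = fm[OF ES] fm[OF XRS]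
  define L where "L = {z \<in> space MR. z \<in> E \<and> fibre E (snd z) N \<le> r * fibre XR (snd z) N}"
  have L[measurable]: "L \<in> sets MR" unfolding L_def by measurable
  define Z where "Z = {z \<in> space MR. z \<in> E \<and> (\<forall>k. \<exists>n\<ge>k. (T ^^ n) z \<in> L)}"
  have Z[measurable]: "Z \<in> sets MR" unfolding Z_def by measurable
  have "fibre Z y N = 0" if y: "y \<in> N" for y
  proof -
    define Zy where "Zy = {x. (x, y) \<in> Z}"
    have "Zy = (\<lambda>x. (x, y)) -` Z \<inter> space borel" by (auto simp: Zy_def)
    also have "\<dots> \<in> sets borel"
      using Z by (intro measurable_sets[of _ _ "borel \<Otimes>\<^sub>M borel"]) (auto simp: in_sets_MR)
    finally have Zy: "Zy \<in> sets borel" .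
    have "(\<integral>\<^sup>+x. \<kappa> x y * indicator XR (x, y) * indicator Zy x \<partial>lborel) = 0"
    proof (rule fibre_density[OF E y r Zy])
      fix x assume x: "x \<in> Zy"
      then show "(x, y) \<in> E" by (simp add: Zy_def Z_def)
      have "\<exists>\<^sub>\<infinity>n. (T ^^ n) (x, y) \<in> L" using x by (simp add: Zy_def Z_def INFM_nat_le)
      then show "\<exists>\<^sub>\<infinity>n. fibre E (snd ((T ^^ n) (x, y))) N \<le> r * fibre XR (snd ((T ^^ n) (x, y))) N"
        by (rule INFM_mono) (simp add: L_def)
    qed
    moreover have "fibre Z y N = (\<integral>\<^sup>+x. \<kappa> x y * indicator XR (x, y) * indicator Zy x \<partial>lborel)"
      unfolding fibre_def
      by (intro nn_integral_cong) (auto simp: Zy_def Z_def space_MR XR_def split: split_indicator)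
    ultimately show ?thesis by simp
  qed
  then have "AE y in lborel. fibre Z y N = 0" using AE_N by auto
  then have "emeasure MR Z = 0"
    unfolding emeasure_MR_snd[OF Z] by (subst nn_integral_cong_AE[where v = "\<lambda>_. 0"]) auto
  then have "AE z in MR. z \<notin> Z" by (intro AE_not_in) (auto simp: null_sets_def)
  with AE_recurrent[OF measure_preserving_T conservative_T L] AE_space show ?thesis
  proof eventually_elim
    fix z assume *: "z \<in> L \<longrightarrow> (\<exists>\<^sub>\<infinity>n. (T ^^ n) z \<in> L)" "z \<in> space MR" "z \<notin> Z"
    show "z \<in> E \<longrightarrow> \<not> fibre E (snd z) N \<le> r * fibre XR (snd z) N"
    proof (intro impI notI)
      assume "z \<in> E" "fibre E (snd z) N \<le> r * fibre XR (snd z) N"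
      then have "z \<in> L" using * by (simp add: L_def)
      then show False using * \<open>z \<in> E\<close> by (auto simp: Z_def INFM_nat_le)
    qed
  qed
qed

definition full :: "(real \<times> real) set \<Rightarrow> real set" where
  "full E = {y. fibre (XR - E) y N = 0}"

lemma AE_fibre_full:
  assumes E: "T_inv E"
  shows "AE z in MR. z \<in> E \<longrightarrow> snd z \<in> full E"
proof -
  have ES: "E \<in> sets MR" and EX: "E \<subseteq> XR" using E by (auto simp: T_inv_def in_sets_MR)
  \<comment> \<open>These numbers increase to 1; in a fibre of finite measure, a density above every
    \<open>r n\<close> is full density.\<close>
  define r where "r n = 1 - ennreal (1 / real (Suc n))" for n
  have r1: "r n < 1" for n
    unfolding r_def by (subst ennreal_1[symmetric], subst ennreal_minus) (auto simp: ennreal_lessI)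
  have "AE z in MR. \<forall>n. z \<in> E \<longrightarrow> \<not> fibre E (snd z) N \<le> r n * fibre XR (snd z) N"
    unfolding AE_all_countable using fibre_low_null[OF E r1] by blast
  then show ?thesis using AE_space
  proof eventually_elim
    fix z assume *: "\<forall>n. z \<in> E \<longrightarrow> \<not> fibre E (snd z) N \<le> r n * fibre XR (snd z) N" and z: "z \<in> space MR"
    show "z \<in> E \<longrightarrow> snd z \<in> full E"
    proof
      assume zE: "z \<in> E"
      define y where "y = snd z"
      have y: "y \<in> N" using z by (auto simp: space_MR XR_def y_def)
      have fin: "fibre XR y N < \<infinity>" by (rule fibre_XR_finite[OF y])
      then obtain W where W: "fibre XR y N = ennreal W" "W \<ge> 0"
        by (metis ennreal_cases less_irrefl infinity_ennreal_def)
      have "fibre E y N \<le> fibre XR y N" by (rule fibre_mono[OF EX])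
      then obtain e where e: "fibre E y N = ennreal e" "e \<ge> 0"
        using fin by (metis ennreal_cases infinity_ennreal_def leD)
      have lt: "(1 - 1 / real (Suc n)) * W < e" for n
      proof -
        have "r n * fibre XR y N < fibre E y N" using * zE by (auto simp: y_def not_le)
        moreover have "r n = ennreal (1 - 1 / real (Suc n))"
          unfolding r_def by (subst ennreal_1[symmetric], subst ennreal_minus) auto
        ultimately have "ennreal ((1 - 1 / real (Suc n)) * W) < ennreal e"
          using W e by (simp add: ennreal_mult)
        then show ?thesis using e by (simp add: ennreal_less_iff W)
      qed
      have "W \<le> e"
      proof (rule field_le_epsilon)
        fix \<epsilon> :: real assume "\<epsilon> > 0"
        then obtain n where "1 / real (Suc n) < \<epsilon> / (W + 1)"
          using nat_approx_posE[of "\<epsilon> / (W + 1)"] W by auto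
        define t where "t = 1 / real (Suc n)"
        have "t < \<epsilon> / (W + 1)" unfolding t_def by fact
        then have "t * W + t < \<epsilon>" using W by (simp add: field_simps)
        moreover have "t \<ge> 0" by (simp add: t_def)
        moreover have "W - t * W < e" using lt[of n] unfolding t_def[symmetric] by (simp add: algebra_simps)
        ultimately show "W \<le> e + \<epsilon>" by linarith
      qed
      then have "fibre XR y N \<le> fibre E y N" using W e by simp
      moreover have "fibre XR y N = fibre E y N + fibre (XR - E) y N" by (rule fibre_Diff[OF ES])
      ultimately have "fibre (XR - E) y N = 0"
        using e by (metis add.right_neutral antisym ennreal_add_left_cancel ennreal_neq_top fibre_mono[OF EX] infinity_ennreal_def)
      then show "snd z \<in> full E" by (simp add: full_def y_def)
    qed
  qed
qed

lemma full_borel: "E \<in> sets MR \<Longrightarrow> full E \<in> sets borel"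
proof -
  assume E: "E \<in> sets MR"
  then have "XR - E \<in> sets MR" using T_inv_XR by (auto simp: T_inv_def)
  note [measurable] = fibre_measurable[OF this]
  have "{y \<in> space borel. fibre (XR - E) y N = 0} \<in> sets borel" by measurable
  then show ?thesis by (simp add: full_def)
qed

text \<open>Over \<open>full E\<close> the complement of \<open>E\<close> is null in each fibre by
  definition, which adds the converse of the preceding inclusion. So up to null sets
  \<open>E\<close> depends on the second coordinate only.\<close>

lemma AE_full_iff:
  assumes E: "T_inv E"
  shows "AE z in MR. z \<in> E \<longleftrightarrow> snd z \<in> full E"
proof -
  have ES: "E \<in> sets MR" and EX: "E \<subseteq> XR" using E by (auto simp: T_inv_def in_sets_MR)
  have XES: "XR - E \<in> sets MR" using ES T_inv_XR by (auto simp: T_inv_def)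
  define B where "B = (XR - E) \<inter> (UNIV \<times> full E)"
  have "B \<in> sets (borel \<Otimes>\<^sub>M borel)"
    unfolding B_def using XES full_borel[OF ES] by (intro sets.Int pair_measureI) (auto simp: in_sets_MR)
  then have B: "B \<in> sets MR" by (auto simp: in_sets_MR B_def)
  have "fibre B y N = 0" for y
  proof (cases "y \<in> full E")
    case True
    have "fibre B y N \<le> fibre (XR - E) y N" by (rule fibre_mono) (auto simp: B_def)
    then show ?thesis using True by (simp add: full_def)
  next
    case False
    then show ?thesis by (simp add: fibre_def B_def)
  qed
  then have "emeasure MR B = 0" by (simp add: emeasure_MR_snd[OF B])
  then have "AE z in MR. z \<notin> B" using B by (intro AE_not_in) (auto simp: null_sets_def)
  with AE_fibre_full[OF E] AE_space show ?thesis
    by eventually_elim (auto simp: B_def space_MR)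
qed

section \<open>Exchange of the two coordinates\<close>

lemma swap_measurable_MR: "prod.swap \<in> measurable MR MR"
proof -
  have "(\<lambda>z. (snd z, fst z)) \<in> measurable (restrict_space (borel \<Otimes>\<^sub>M borel) XR) (restrict_space (borel \<Otimes>\<^sub>M borel) XR)"
    by (intro measurable_restrict_space2 measurable_restrict_space1)
      (auto simp: space_restrict_space XR_def)
  then show ?thesis by (simp add: measurable_cong_sets[OF sets_MR sets_MR] prod.swap_def[abs_def])
qed

lemma measure_preserving_swap: "measure_preserving MR prod.swap"
  unfolding measure_preserving_def
proof (intro conjI ballI swap_measurable_MR)
  fix A assume A: "A \<in> sets MR"
  have sA: "prod.swap -` A \<inter> space MR \<in> sets MR" using swap_measurable_MR A by (rule measurable_sets)
  have AX: "A \<subseteq> XR" using A by (simp add: in_sets_MR)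
  show "emeasure MR (prod.swap -` A \<inter> space MR) = emeasure MR A"
    unfolding emeasure_MR[OF A] emeasure_MR_snd[OF sA] fibre_def using AX
    by (intro nn_integral_cong) (auto simp: space_MR XR_def \<kappa>_def power2_commute split: split_indicator)
qed

lemma AE_swap: "AE z in MR. P z \<Longrightarrow> AE z in MR. P (prod.swap z)"
proof -
  assume "AE z in MR. P z"
  then obtain B where B: "{z \<in> space MR. \<not> P z} \<subseteq> B" "emeasure MR B = 0" "B \<in> sets MR"
    by (rule AE_E)
  show ?thesis
  proof (rule AE_I)
    show "{z \<in> space MR. \<not> P (prod.swap z)} \<subseteq> prod.swap -` B \<inter> space MR"
    proof
      fix z assume "z \<in> {z \<in> space MR. \<not> P (prod.swap z)}"
      then have z: "z \<in> space MR" "\<not> P (prod.swap z)" by auto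
      then have "prod.swap z \<in> {z \<in> space MR. \<not> P z}" by (simp only: space_MR swap_in_XR mem_Collect_eq) auto
      then show "z \<in> prod.swap -` B \<inter> space MR" using B(1) z(1) by blast
    qed
    show "emeasure MR (prod.swap -` B \<inter> space MR) = 0"
      using measure_preserving_emeasure[OF measure_preserving_swap B(3)] B(2) by simp
    show "prod.swap -` B \<inter> space MR \<in> sets MR" using swap_measurable_MR B(3) by (rule measurable_sets)
  qed
qed

lemma T_inv_swap:
  assumes E: "T_inv E"
  shows "T_inv (prod.swap -` E \<inter> XR)"
  unfolding T_inv_def
proof (intro conjI ballI)
  show "prod.swap -` E \<inter> XR \<in> sets MR"
    using measurable_sets[OF swap_measurable_MR, of E] E by (simp add: T_inv_def space_MR)
  fix z assume z: "z \<in> XR"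
  have "prod.swap (T z) \<in> XR" using T_in[OF z] by (simp add: swap_in_XR)
  then have "prod.swap (T z) \<in> E \<longleftrightarrow> T (prod.swap (T z)) \<in> E" using E by (simp add: T_inv_def)
  also have "T (prod.swap (T z)) = prod.swap z"
    using swap_T_swap_T[OF z] by (metis swap_swap)
  finally show "T z \<in> prod.swap -` E \<inter> XR \<longleftrightarrow> z \<in> prod.swap -` E \<inter> XR"
    using z T_in[OF z] by simp
qed

text \<open>The density \<open>\<kappa>\<close> is positive off the diagonal, so null sets of
  \<open>MR\<close> are Lebesgue null. In this form a single good row can be selected from each
  side.\<close>

lemma AE_MR_imp_AE_lborel:
  assumes "AE z in MR. P z"
  shows "AE x in lborel. AE y in lborel. (x, y) \<in> XR \<longrightarrow> P (x, y)"
proof -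
  from assms obtain B where B: "{z \<in> space MR. \<not> P z} \<subseteq> B" "emeasure MR B = 0" "B \<in> sets MR"
    by (rule AE_E)
  have [measurable]: "B \<in> sets (borel \<Otimes>\<^sub>M borel)" using B(3) by (simp add: in_sets_MR)
  have m: "(\<lambda>x. \<integral>\<^sup>+y. indicator B (x, y) * \<kappa> x y \<partial>lborel) \<in> borel_measurable borel"
    using lborel.borel_measurable_nn_integral_fst[of "\<lambda>(x, y). indicator B (x, y) * \<kappa> x y" borel]
    by (simp add: case_prod_beta')
  have "AE x in lborel. (\<integral>\<^sup>+y. indicator B (x, y) * \<kappa> x y \<partial>lborel) = 0"
    using B(2) m unfolding emeasure_MR[OF B(3)] by (subst (asm) nn_integral_0_iff_AE) auto
  then show ?thesis
  proof eventually_elim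
    fix x assume "(\<integral>\<^sup>+y. indicator B (x, y) * \<kappa> x y \<partial>lborel) = 0"
    then have "AE y in lborel. indicator B (x, y) * \<kappa> x y = 0"
      by (subst (asm) nn_integral_0_iff_AE) auto
    then show "AE y in lborel. (x, y) \<in> XR \<longrightarrow> P (x, y)"
    proof eventually_elim
      fix y assume *: "indicator B (x, y) * \<kappa> x y = 0"
      show "(x, y) \<in> XR \<longrightarrow> P (x, y)"
      proof
        assume xy: "(x, y) \<in> XR"
        then have "x \<noteq> y" by (auto simp: XR_def)
        then have "\<kappa> x y \<noteq> 0" by (simp add: \<kappa>_def)
        then have "(x, y) \<notin> B" using * by (auto simp: indicator_def split: if_splits)
        then show "P (x, y)" using B(1) xy by (auto simp: space_MR)
      qed
    qed
  qed
qed

text \<open>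
  An invariant set is determined, up to null sets, by the second coordinate and also by the first one,
  hence it is null or full in each product of two different sides. As there are at least three sides,
  all the products are linked.
\<close>

lemma ergodic_T: "ergodic MR T"
  unfolding ergodic_def
proof (intro ballI impI)
  fix E assume ES: "E \<in> sets MR" and inv: "T -` E \<inter> space MR = E"
  then have E: "T_inv E" unfolding T_inv_def by (auto simp: space_MR)
  have EX: "E \<subseteq> XR" using ES by (simp add: in_sets_MR)
  define E' where "E' = prod.swap -` E \<inter> XR"
  have E': "T_inv E'" unfolding E'_def by (rule T_inv_swap[OF E])
  have 1: "AE z in MR. z \<in> E \<longleftrightarrow> snd z \<in> full E" by (rule AE_full_iff[OF E])
  have "AE z in MR. prod.swap z \<in> E' \<longleftrightarrow> snd (prod.swap z) \<in> full E'"
    by (rule AE_swap[OF AE_full_iff[OF E']])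
  with 1 AE_space have "AE z in MR. fst z \<in> full E' \<longleftrightarrow> snd z \<in> full E"
    by eventually_elim (auto simp: E'_def space_MR swap_in_XR)
  from AE_MR_imp_AE_lborel[OF this]
  have good: "AE x in lborel. AE y in lborel. (x, y) \<in> XR \<longrightarrow> (x \<in> full E' \<longleftrightarrow> y \<in> full E)" by simp
  \<comment> \<open>A good \<open>x\<close> in side \<open>a\<close> is paired with all
    \<open>y\<close> of \<open>N\<close> outside that side, and whether \<open>x\<close> lies in
    \<open>full E'\<close> decides for almost all of them whether they lie in
    \<open>full E\<close>.\<close>
  have "\<exists>\<beta>. AE y in lborel. idx y \<noteq> a \<longrightarrow> (y \<in> full E \<longleftrightarrow> \<beta>)" if a: "a < m" for a
  proof -
    obtain x where x: "x \<in> N" "idx x = a" "AE y in lborel. (x, y) \<in> XR \<longrightarrow> (x \<in> full E' \<longleftrightarrow> y \<in> full E)"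
      using side_not_null[OF a good] by blast
    from x(3) AE_N have "AE y in lborel. idx y \<noteq> a \<longrightarrow> (y \<in> full E \<longleftrightarrow> x \<in> full E')"
      by eventually_elim (use x in \<open>auto simp: XR_def\<close>)
    then show ?thesis by blast
  qed
  then have "\<forall>a. \<exists>\<beta>. a < m \<longrightarrow> (AE y in lborel. idx y \<noteq> a \<longrightarrow> (y \<in> full E \<longleftrightarrow> \<beta>))" by blast
  from choice[OF this] obtain \<beta> where
    \<beta>: "\<And>a. a < m \<Longrightarrow> AE y in lborel. idx y \<noteq> a \<longrightarrow> (y \<in> full E \<longleftrightarrow> \<beta> a)"
    by blast
  have \<beta>0: "AE y in lborel. idx y \<noteq> 0 \<longrightarrow> (y \<in> full E \<longleftrightarrow> \<beta> 0)"
    and \<beta>1: "AE y in lborel. idx y \<noteq> 1 \<longrightarrow> (y \<in> full E \<longleftrightarrow> \<beta> 1)"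
    using \<beta>[of 0] \<beta>[of 1] m_ge_3 by simp_all
  have \<beta>_eq: "\<beta> a = \<beta> 0" if "a < m" for a
  proof -
    \<comment> \<open>A side different from 0 and \<open>a\<close>. Both \<open>\<beta> a\<close>
      and \<open>\<beta> 0\<close> describe \<open>full E\<close> on it, so they agree.\<close>
    define c :: nat where "c = (if a = 1 then 2 else 1)"
    have c: "c < m" "c \<noteq> a" "c \<noteq> 0" using m_ge_3 by (auto simp: c_def)
    from \<beta>[OF that] \<beta>0 have "AE y in lborel. idx y = c \<longrightarrow> \<beta> a = \<beta> 0"
      by eventually_elim (use c in auto)
    from side_not_null[OF c(1) this] show ?thesis by blast
  qed
  have "\<beta> 1 = \<beta> 0" using \<beta>_eq[of 1] m_ge_3 by simp
  from \<beta>0 \<beta>1 have "AE y in lborel. y \<in> full E \<longleftrightarrow> \<beta> 0"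
    by eventually_elim (use \<open>\<beta> 1 = \<beta> 0\<close> in auto)
  then have "AE z in MR. fst z \<in> full E \<longleftrightarrow> \<beta> 0" by (rule AE_MR_fst)
  from AE_swap[OF this] have "AE z in MR. snd z \<in> full E \<longleftrightarrow> \<beta> 0" by simp
  with 1 have *: "AE z in MR. z \<in> E \<longleftrightarrow> \<beta> 0" by eventually_elim auto
  show "emeasure MR E = 0 \<or> emeasure MR (space MR - E) = 0"
  proof (cases "\<beta> 0")
    case True
    from * have "AE z in MR. z \<notin> space MR - E" by eventually_elim (use True in auto)
    then have "space MR - E \<in> null_sets MR" using ES by (subst AE_iff_null_sets) auto
    then show ?thesis by (simp add: null_sets_def)
  next
    case False
    from * have "AE z in MR. z \<notin> E" by eventually_elim (use False in auto)
    then have "E \<in> null_sets MR" using ES by (subst AE_iff_null_sets) auto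
    then show ?thesis by (simp add: null_sets_def)
  qed
qed

end

section \<open>The Cayley transform\<close>

text \<open>This choice of signs sends infinity to 1 and increasing \<open>u\<close> to the
  counterclockwise direction, so the vertices keep their order.\<close>

definition cayley :: "real \<Rightarrow> complex" where
  "cayley u = (of_real u - \<i>) / (of_real u + \<i>)"

text \<open>The normalized argument of \<open>cayley u\<close>, because
  \<open>(u - \<i>) / (u + \<i>) = - exp (2 * \<i> * arctan u)\<close>.\<close>

definition cayley_arg :: "real \<Rightarrow> real" where
  "cayley_arg u = 1 / 2 + arctan u / pi"

lemma of_real_plus_i_nonzero: "complex_of_real u + \<i> \<noteq> 0"
  by (simp add: complex_eq_iff)

lemma cayley_arg_bounds: "0 < cayley_arg u" "cayley_arg u < 1"
  using arctan_lbound[of u] arctan_ubound[of u] by (auto simp: cayley_arg_def field_simps)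

lemma cayley_arg_less_iff: "cayley_arg u < cayley_arg w \<longleftrightarrow> u < w"
  by (simp add: cayley_arg_def arctan_less_iff divide_less_cancel)

lemma cayley_arg_le_iff: "cayley_arg u \<le> cayley_arg w \<longleftrightarrow> u \<le> w"
  using cayley_arg_less_iff[of w u] by (simp add: not_less[symmetric])

lemma cayley_arg_eq_iff: "cayley_arg u = cayley_arg w \<longleftrightarrow> u = w"
  by (simp add: cayley_arg_def arctan_eq_iff)

lemma cayley_arg_tan:
  assumes "0 < x" "x < 1"
  shows "cayley_arg (tan (pi * (x - 1 / 2))) = x"
proof -
  have "pi * x < pi * 1" using assms by (intro mult_strict_left_mono) auto
  then have "- (pi / 2) < pi * (x - 1 / 2)" "pi * (x - 1 / 2) < pi / 2"
    using assms by (auto simp: algebra_simps)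
  then show ?thesis by (simp add: cayley_arg_def arctan_tan)
qed

lemma unarg_cayley_arg: "unarg (cayley_arg u) = cayley u"
proof -
  define c s where "c = cos (arctan u)" and "s = sin (arctan u)"
  have s: "s = u * c" using tan_arctan[of u] by (simp add: tan_def c_def s_def field_simps)
  have c: "c\<^sup>2 * (1 + u\<^sup>2) = 1" using sin_cos_squared_add[of "arctan u"]
    by (simp add: s power_mult_distrib algebra_simps flip: c_def s_def)
  have "2 * pi * cayley_arg u = pi + 2 * arctan u" by (simp add: cayley_arg_def field_simps)
  then have "unarg (cayley_arg u) = - cis (2 * arctan u)"
    by (simp add: unarg_def complex_eq_iff)
  also have "cis (2 * arctan u) = Complex (c\<^sup>2 - s\<^sup>2) (2 * s * c)"
    by (simp add: complex_eq_iff cos_double sin_double c_def s_def)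
  also have "- \<dots> * (of_real u + \<i>) = of_real u - \<i>"
  proof -
    have "Re (- Complex (c\<^sup>2 - s\<^sup>2) (2 * s * c) * (of_real u + \<i>)) = u * (c\<^sup>2 * (1 + u\<^sup>2))"
      by (simp add: s power2_eq_square algebra_simps)
    moreover have "Im (- Complex (c\<^sup>2 - s\<^sup>2) (2 * s * c) * (of_real u + \<i>)) = - (c\<^sup>2 * (1 + u\<^sup>2))"
      by (simp add: s power2_eq_square algebra_simps)
    ultimately show ?thesis unfolding c by (simp add: complex_eq_iff)
  qed
  finally show ?thesis using of_real_plus_i_nonzero[of u] by (simp add: cayley_def field_simps)
qed

lemma narg_bounds: "0 \<le> narg z" "narg z < 1"
  using Arg2pi_ge_0[of z] Arg2pi_lt_2pi[of z] by (auto simp: narg_def)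

lemma narg_unarg:
  assumes "0 \<le> x" "x < 1"
  shows "narg (unarg x) = x"
proof -
  have "Arg2pi (unarg x) = 2 * pi * x"
    by (rule Arg2pi_unique[of 1]) (use assms in \<open>auto simp: unarg_def cis_conv_exp\<close>)
  then show ?thesis by (simp add: narg_def)
qed

lemma unarg_narg: "norm z = 1 \<Longrightarrow> unarg (narg z) = z"
  using complex_norm_eq_1_exp[of z] by (simp add: unarg_def narg_def cis_conv_exp)

lemma norm_unarg: "norm (unarg x) = 1"
  by (simp add: unarg_def)

lemma narg_one: "narg 1 = 0"
  using narg_unarg[of 0] by (simp add: unarg_def)

lemma narg_cayley: "narg (cayley u) = cayley_arg u"
  using cayley_arg_bounds[of u] by (simp add: unarg_cayley_arg[symmetric] narg_unarg)

lemma norm_cayley: "norm (cayley u) = 1"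
  using norm_unarg unarg_cayley_arg by metis

lemma cayley_eq_iff: "cayley u = cayley w \<longleftrightarrow> u = w"
  using narg_cayley cayley_arg_eq_iff by metis

lemma cayley_neq_1: "cayley u \<noteq> 1"
  using narg_cayley[of u] narg_one cayley_arg_bounds[of u] by auto

lemma ex_cayley:
  assumes "norm z = 1" "z \<noteq> 1"
  shows "\<exists>u. z = cayley u"
proof -
  have "narg z \<noteq> 0" using unarg_narg[OF assms(1)] assms(2) by (auto simp: unarg_def)
  then have "0 < narg z" "narg z < 1" using narg_bounds[of z] by auto
  then have "cayley_arg (tan (pi * (narg z - 1 / 2))) = narg z" by (rule cayley_arg_tan)
  then show ?thesis using unarg_narg[OF assms(1)] unarg_cayley_arg by metis
qed

lemma narg_unarg_divide:
  assumes "0 \<le> x" "x < 1" "0 \<le> y" "y < 1"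
  shows "narg (unarg x / unarg y) = (if y \<le> x then x - y else x - y + 1)"
proof -
  have e: "unarg x / unarg y = unarg (x - y)"
    by (simp add: unarg_def cis_divide algebra_simps)
  have "unarg (z + 1) = unarg z" for z
    by (simp add: unarg_def distrib_left flip: cis_mult)
  then show ?thesis using e narg_unarg[of "x - y"] narg_unarg[of "x - y + 1"] assms by auto
qed

text \<open>\<open>n\<close> and \<open>d\<close> are the numerator and the denominator of the same
  reflection formula with real endpoints. On the circle they become \<open>n - \<i> * d\<close> and
  \<open>n + \<i> * d\<close> up to a common factor, so the quotient is the Cayley transform of
  \<open>n / d\<close>, and 1 when \<open>d = 0\<close> and \<open>n\<close> is nonzero.\<close>

lemma cayley_mobius:
  fixes P Q u :: real
  defines "n \<equiv> (P + Q) * u - 2 * P * Q" and "d \<equiv> 2 * u - (P + Q)"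
  shows "(cayley P + cayley Q) * cayley u - 2 * cayley P * cayley Q =
      2 * \<i> / ((u + \<i>) * (P + \<i>) * (Q + \<i>)) * (of_real n - \<i> * of_real d)"
    and "2 * cayley u - (cayley P + cayley Q) =
      2 * \<i> / ((u + \<i>) * (P + \<i>) * (Q + \<i>)) * (of_real n + \<i> * of_real d)"
proof -
  define U p q where "U = complex_of_real u + \<i>" and "p = complex_of_real P + \<i>" and "q = complex_of_real Q + \<i>"
  have nz: "U \<noteq> 0" "p \<noteq> 0" "q \<noteq> 0" by (auto simp: U_def p_def q_def of_real_plus_i_nonzero)
  have c: "cayley u = (U - 2 * \<i>) / U" "cayley P = (p - 2 * \<i>) / p" "cayley Q = (q - 2 * \<i>) / q"
    by (auto simp: cayley_def U_def p_def q_def)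
  have ii: "\<i> * (\<i> * x) = - x" for x by (simp add: mult.assoc[symmetric])
  have n: "of_real n = (p + q - 2 * \<i>) * (U - \<i>) - 2 * (p - \<i>) * (q - \<i>)"
    and d: "of_real d = 2 * (U - \<i>) - (p + q - 2 * \<i>)"
    by (auto simp: n_def d_def U_def p_def q_def)
  show "(cayley P + cayley Q) * cayley u - 2 * cayley P * cayley Q =
      2 * \<i> / ((u + \<i>) * (P + \<i>) * (Q + \<i>)) * (of_real n - \<i> * of_real d)"
    unfolding c U_def[symmetric] p_def[symmetric] q_def[symmetric] n d
    using nz by (simp add: divide_simps) (simp add: algebra_simps ii)
  show "2 * cayley u - (cayley P + cayley Q) =
      2 * \<i> / ((u + \<i>) * (P + \<i>) * (Q + \<i>)) * (of_real n + \<i> * of_real d)"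
    unfolding c U_def[symmetric] p_def[symmetric] q_def[symmetric] n d
    using nz by (simp add: divide_simps) (simp add: algebra_simps ii)
qed

lemma cayley_reflection:
  fixes P Q u :: real
  assumes "P \<noteq> Q"
  shows "((cayley P + cayley Q) * cayley u - 2 * cayley P * cayley Q) / (2 * cayley u - (cayley P + cayley Q)) =
    (if 2 * u - (P + Q) = 0 then 1 else cayley (((P + Q) * u - 2 * P * Q) / (2 * u - (P + Q))))"
proof -
  define n d where "n = (P + Q) * u - 2 * P * Q" and "d = 2 * u - (P + Q)"
  have nz: "2 * \<i> / ((u + \<i>) * (P + \<i>) * (Q + \<i>)) \<noteq> 0"
    by (simp add: of_real_plus_i_nonzero)
  have lhs: "((cayley P + cayley Q) * cayley u - 2 * cayley P * cayley Q) / (2 * cayley u - (cayley P + cayley Q)) =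
      (of_real n - \<i> * of_real d) / (of_real n + \<i> * of_real d)"
    unfolding cayley_mobius n_def[symmetric] d_def[symmetric] using nz by (rule mult_divide_mult_cancel_left)
  show ?thesis
  proof (cases "d = 0")
    case True
    then have "u = (P + Q) / 2" by (simp add: d_def)
    then have "n = (P - Q)\<^sup>2 / 2" by (simp add: n_def power2_eq_square field_simps)
    then have "n \<noteq> 0" using assms by auto
    then show ?thesis unfolding lhs using True by (simp add: d_def)
  next
    case False
    have "cayley (n / d) = (of_real n - \<i> * of_real d) / (of_real n + \<i> * of_real d)"
      using False of_real_plus_i_nonzero[of "n / d"] unfolding cayley_def
      by (subst mult_divide_mult_cancel_left[of "of_real d", symmetric]) (auto simp: algebra_simps)
    then show ?thesis unfolding lhs using False by (simp add: d_def n_def)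
  qed
qed

text \<open>With one endpoint at infinity, the reflection becomes the Euclidean one about
  \<open>P\<close>.\<close>

lemma cayley_reflection_one:
  fixes P u :: real
  shows "((cayley P + 1) * cayley u - 2 * cayley P) / (2 * cayley u - (cayley P + 1)) = cayley (2 * P - u)"
proof -
  define U p where "U = complex_of_real u + \<i>" and "p = complex_of_real P + \<i>"
  have nz: "U \<noteq> 0" "p \<noteq> 0" by (auto simp: U_def p_def of_real_plus_i_nonzero)
  have c: "cayley u = (U - 2 * \<i>) / U" "cayley P = (p - 2 * \<i>) / p"
    by (auto simp: cayley_def U_def p_def)
  have ii: "\<i> * (\<i> * x) = - x" for x by (simp add: mult.assoc[symmetric])
  have n: "(cayley P + 1) * cayley u - 2 * cayley P = - 2 * \<i> / (U * p) * (of_real (2 * P - u) - \<i>)"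
    unfolding c using nz by (simp add: divide_simps) (simp add: U_def p_def algebra_simps ii)
  have d: "2 * cayley u - (cayley P + 1) = - 2 * \<i> / (U * p) * (of_real (2 * P - u) + \<i>)"
    unfolding c using nz by (simp add: divide_simps) (simp add: U_def p_def algebra_simps ii)
  have "- 2 * \<i> / (U * p) \<noteq> 0" using nz by simp
  then show ?thesis unfolding n d cayley_def[of "2 * P - u"] by (rule mult_divide_mult_cancel_left)
qed

locale circle_partition =
  fixes m :: nat and \<theta> :: "nat \<Rightarrow> complex"
  assumes m3: "3 \<le> m" and norm_\<theta>: "a < m \<Longrightarrow> norm (\<theta> a) = 1"
    and narg_\<theta>_mono: "strict_mono_on {..<m} (\<lambda>a. narg (\<theta> a))" and \<theta>_0: "\<theta> 0 = 1"
begin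

definition v :: "nat \<Rightarrow> real" where
  "v a = tan (pi * (narg (\<theta> a) - 1 / 2))"

lemma narg_\<theta>_less: "a < b \<Longrightarrow> b < m \<Longrightarrow> narg (\<theta> a) < narg (\<theta> b)"
  using strict_mono_onD[OF narg_\<theta>_mono, of a b] by auto

lemma cayley_arg_v:
  assumes "0 < a" "a < m"
  shows "cayley_arg (v a) = narg (\<theta> a)"
proof -
  have "0 < narg (\<theta> a)" using narg_\<theta>_less[OF assms] by (simp add: \<theta>_0 narg_one)
  then show ?thesis unfolding v_def by (intro cayley_arg_tan narg_bounds)
qed

lemma cayley_v:
  assumes "0 < a" "a < m"
  shows "cayley (v a) = \<theta> a"
  using unarg_cayley_arg[of "v a"] unarg_narg[OF norm_\<theta>[OF assms(2)]] by (simp add: cayley_arg_v[OF assms])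

sublocale polygon_vertices m v
proof
  show "3 \<le> m" by (rule m3)
  fix a b :: nat assume "1 \<le> a" "a < b" "b < m"
  then have "cayley_arg (v a) < cayley_arg (v b)" using narg_\<theta>_less by (simp add: cayley_arg_v)
  then show "v a < v b" by (simp add: cayley_arg_less_iff)
qed

lemma part_arg_less: "a < b \<Longrightarrow> b \<le> m \<Longrightarrow> part_arg m \<theta> a < part_arg m \<theta> b"
  using narg_\<theta>_less[of a b] narg_bounds(2) by (auto simp: part_arg_def)

lemma part_arg_le: "a \<le> b \<Longrightarrow> b \<le> m \<Longrightarrow> part_arg m \<theta> a \<le> part_arg m \<theta> b"
  using part_arg_less[of a b] by (cases "a = b") auto

lemma part_arg_cayley: "0 < a \<Longrightarrow> a < m \<Longrightarrow> part_arg m \<theta> a = cayley_arg (v a)"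
  by (simp add: part_arg_def cayley_arg_v)

lemma part_arg_0: "part_arg m \<theta> 0 = 0"
  using m3 by (simp add: part_arg_def \<theta>_0 narg_one)

lemma arc_iff:
  assumes a: "a < m" and x: "0 \<le> x" "x < 1"
  shows "unarg x \<in> half_open_arc m \<theta> a \<longleftrightarrow> part_arg m \<theta> a \<le> x \<and> x < part_arg m \<theta> (Suc a)"
proof -
  define y where "y = narg (\<theta> a)"
  have y: "0 \<le> y" "y < 1" "\<theta> a = unarg y" using narg_bounds unarg_narg[OF norm_\<theta>[OF a]] by (auto simp: y_def)
  have 1: "narg (unarg x / \<theta> a) = (if y \<le> x then x - y else x - y + 1)"
    unfolding y(3) by (rule narg_unarg_divide) (use x y in auto)
  \<comment> \<open>The last arc ends at \<open>\<theta> 0 = 1\<close>, whose argument has to count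
    as 1 instead of 0; this is the value of \<open>part_arg\<close> at \<open>m\<close>.\<close>
  have 2: "narg (\<theta> (Suc a mod m) / \<theta> a) = part_arg m \<theta> (Suc a) - y"
  proof (cases "Suc a = m")
    case True
    have "0 < y" using narg_\<theta>_less[of 0 a] True m3 by (simp add: y_def \<theta>_0 narg_one)
    then show ?thesis
      using narg_unarg_divide[of 0 y] y True by (simp add: part_arg_def \<theta>_0) (simp add: unarg_def)
  next
    case False
    then have sa: "Suc a < m" using a by simp
    define z where "z = narg (\<theta> (Suc a))"
    have z: "z < 1" "\<theta> (Suc a) = unarg z" using narg_bounds unarg_narg[OF norm_\<theta>[OF sa]] by (auto simp: z_def)
    have "y < z" using narg_\<theta>_less[of a "Suc a"] sa by (simp add: y_def z_def)
    then have "narg (unarg z / unarg y) = z - y" using narg_unarg_divide[of z y] y(1,2) z(1) narg_bounds(1)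
      by (simp add: z_def)
    moreover have "Suc a mod m = Suc a" "part_arg m \<theta> (Suc a) = z" using sa by (auto simp: part_arg_def z_def)
    ultimately show ?thesis by (simp only: z(2) y(3))
  qed
  have "part_arg m \<theta> (Suc a) \<le> 1" using narg_bounds(2) by (simp add: part_arg_def less_imp_le)
  moreover have "part_arg m \<theta> a = y" using a by (simp add: part_arg_def y_def)
  moreover have "unarg x \<in> half_open_arc m \<theta> a \<longleftrightarrow>
      (if y \<le> x then x - y else x - y + 1) < part_arg m \<theta> (Suc a) - y"
    by (simp add: half_open_arc_def 1 2 norm_unarg)
  ultimately show ?thesis using x by auto
qed

lemma arc_cayley:
  assumes a: "a < m"
  shows "cayley u \<in> half_open_arc m \<theta> a \<longleftrightarrow> (0 < a \<longrightarrow> v a \<le> u) \<and> (Suc a < m \<longrightarrow> u < v (Suc a))"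
proof -
  have b: "0 \<le> cayley_arg u" "cayley_arg u < 1" using cayley_arg_bounds[of u] by auto
  have l: "part_arg m \<theta> a \<le> cayley_arg u \<longleftrightarrow> (0 < a \<longrightarrow> v a \<le> u)"
    using a b part_arg_0 by (cases "a = 0") (auto simp: part_arg_cayley cayley_arg_le_iff)
  have r: "cayley_arg u < part_arg m \<theta> (Suc a) \<longleftrightarrow> (Suc a < m \<longrightarrow> u < v (Suc a))"
  proof (cases "Suc a = m")
    case True
    then show ?thesis using b by (simp add: part_arg_def)
  next
    case False
    then show ?thesis using a by (simp add: part_arg_cayley cayley_arg_less_iff)
  qed
  show ?thesis
    using arc_iff[OF a b] by (simp add: unarg_cayley_arg l r)
qed

lemma arc_unique:
  assumes "a < m" "b < m" and z: "z \<in> half_open_arc m \<theta> a" "z \<in> half_open_arc m \<theta> b"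
  shows "a = b"
proof -
  have n: "norm z = 1" using z(1) by (simp add: half_open_arc_def)
  have "False" if "a < b" "b < m" "z \<in> half_open_arc m \<theta> a" "z \<in> half_open_arc m \<theta> b" for a b
  proof -
    have "narg z < part_arg m \<theta> (Suc a)" "part_arg m \<theta> b \<le> narg z"
      using arc_iff[of a "narg z"] arc_iff[of b "narg z"] that narg_bounds unarg_narg[OF n] by auto
    then show False using part_arg_le[of "Suc a" b] that by simp
  qed
  then show ?thesis using assms by (metis linorder_neqE_nat)
qed

lemma arc_indexI: "a < m \<Longrightarrow> z \<in> half_open_arc m \<theta> a \<Longrightarrow> arc_index m \<theta> z = a"
  unfolding arc_index_def by (rule the_equality) (auto intro: arc_unique)

lemma \<theta>_in_arc: "a < m \<Longrightarrow> \<theta> a \<in> half_open_arc m \<theta> a"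
  using arc_iff[of a "narg (\<theta> a)"] part_arg_less[of a "Suc a"] narg_bounds unarg_narg[OF norm_\<theta>[of a]]
  by (auto simp: part_arg_def[of m \<theta> a])

lemma ex_arc:
  assumes "norm z = 1"
  shows "\<exists>a<m. z \<in> half_open_arc m \<theta> a"
proof (cases "\<exists>b<m. z = \<theta> b")
  case True
  then show ?thesis using \<theta>_in_arc by blast
next
  case False
  then have "z \<noteq> 1" using \<theta>_0 m3 by force
  then obtain u where u: "z = cayley u" using ex_cayley[OF assms] by blast
  have "u \<noteq> v b" if "0 < b" "b < m" for b using False u cayley_v[OF that] that by auto
  then have "u \<noteq> v (Suc (idx u))" if "Suc (idx u) < m" using that by simp
  then have "z \<in> half_open_arc m \<theta> (idx u)"
    unfolding u arc_cayley[OF idx_less] using idx_gt[of u] idx_le[of u] by fastforce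
  then show ?thesis using idx_less by blast
qed

lemma \<theta>_neq:
  assumes "a < m"
  shows "\<theta> a \<noteq> \<theta> (Suc a mod m)"
proof
  assume "\<theta> a = \<theta> (Suc a mod m)"
  then have "a = Suc a mod m"
    using \<theta>_in_arc[OF assms] \<theta>_in_arc[of "Suc a mod m"] m3 assms by (intro arc_unique) auto
  then show False using assms m3 by (cases "Suc a = m") auto
qed

lemma reflection_cayley:
  assumes a: "a < m"
  shows "reflection m \<theta> a (cayley u) =
    (if 0 < a \<and> Suc a < m \<and> 2 * u - (v a + v (Suc a)) = 0 then 1 else cayley (R a u))"
proof -
  consider "a = 0" | "Suc a = m" "a \<noteq> 0" | "0 < a" "Suc a < m" using a by linarith
  then show ?thesis
  proof cases
    case 1
    then have "\<theta> (Suc a mod m) = cayley (v 1)" using cayley_v[of 1] m3 by simp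
    then show ?thesis using cayley_reflection_one[of "v 1" u] 1
      by (simp add: reflection_def Let_def \<theta>_0 side_reflection_def add.commute)
  next
    case 2
    then have "\<theta> (Suc a mod m) = 1" "\<theta> a = cayley (v a)" using cayley_v[of a] \<theta>_0 by auto
    then show ?thesis using cayley_reflection_one[of "v a" u] 2
      by (simp add: reflection_def Let_def side_reflection_def)
  next
    case 3
    then have "\<theta> (Suc a mod m) = cayley (v (Suc a))" "\<theta> a = cayley (v a)" "v a \<noteq> v (Suc a)"
      using cayley_v[of a] cayley_v[of "Suc a"] v_less[of a "Suc a"] by auto
    then show ?thesis using cayley_reflection[of "v a" "v (Suc a)" u] 3
      by (simp add: reflection_def Let_def side_reflection_def)
  qed
qed

text \<open>If \<open>2 * z = p + q\<close>, the triangle inequality for \<open>p\<close> and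
  \<open>q\<close> is an equality, which forces \<open>p = q\<close>. So the denominator of a
  reflection never vanishes on the circle.\<close>

lemma circle_midpoint:
  assumes "norm z = 1" "norm p = 1" "norm q = 1" "p \<noteq> q"
  shows "2 * z - (p + q) \<noteq> (0 :: complex)"
proof
  assume "2 * z - (p + q) = 0"
  then have "p + q = 2 * z" by simp
  then have "norm (p + q) = 2" using assms(1) by (simp add: norm_mult)
  then have "norm (p + q) = norm p + norm q" using assms by simp
  then have "p = q" using norm_triangle_eq[of p q] assms by simp
  with assms(4) show False ..
qed

lemma reflection_on_circle:
  assumes a: "a < m" and z: "norm z = 1"
  shows "norm (reflection m \<theta> a z) = 1" "reflection m \<theta> a (reflection m \<theta> a z) = z"
proof -
  define p q where "p = \<theta> a" and "q = \<theta> (Suc a mod m)"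
  have n: "norm p = 1" "norm q = 1" using norm_\<theta> a m3 by (auto simp: p_def q_def)
  have pq: "p \<noteq> q" using \<theta>_neq[OF a] by (simp add: p_def q_def)
  have nz: "2 * z - (p + q) \<noteq> 0" by (rule circle_midpoint[OF z n pq])
  have r: "reflection m \<theta> a w = ((p + q) * w - 2 * p * q) / (2 * w - (p + q))" for w
    by (simp add: reflection_def Let_def p_def q_def)
  have "cnj x * x = 1" if "norm x = 1" for x
    using that by (metis complex_norm_square mult.commute of_real_1 power_one)
  then have c: "cnj z * z = 1" "cnj p * p = 1" "cnj q * q = 1" using z n by auto
  \<comment> \<open>On the circle conjugation is inversion; it turns the denominator into the
    numerator, up to the sign and a factor of modulus 1.\<close>
  have "cnj (2 * z - (p + q)) * (z * p * q) = 2 * (cnj z * z) * p * q - (cnj p * p) * z * q - (cnj q * q) * z * p"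
    by (simp add: algebra_simps)
  also have "\<dots> = - ((p + q) * z - 2 * p * q)" unfolding c by (simp add: algebra_simps)
  finally have "norm (cnj (2 * z - (p + q)) * (z * p * q)) = norm ((p + q) * z - 2 * p * q)" by (simp add: norm_minus_commute)
  then have eq: "norm (2 * z - (p + q)) = norm ((p + q) * z - 2 * p * q)"
    using z n by (simp only: norm_mult complex_mod_cnj)
  have "norm (reflection m \<theta> a z) = norm ((p + q) * z - 2 * p * q) / norm (2 * z - (p + q))"
    by (simp only: r norm_divide)
  then show "norm (reflection m \<theta> a z) = 1" unfolding eq[symmetric] using nz by simp
  define D where "D = 2 * z - (p + q)"
  have 1: "(p + q) * reflection m \<theta> a z - 2 * p * q = (p - q)\<^sup>2 * z / D"
    unfolding r D_def[symmetric] using nz unfolding D_def[symmetric]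
    by (simp add: field_simps) (simp add: D_def power2_eq_square algebra_simps)
  have 2: "2 * reflection m \<theta> a z - (p + q) = (p - q)\<^sup>2 / D"
    unfolding r D_def[symmetric] using nz unfolding D_def[symmetric]
    by (simp add: field_simps) (simp add: D_def power2_eq_square algebra_simps)
  have "reflection m \<theta> a (reflection m \<theta> a z) = ((p - q)\<^sup>2 * z / D) / ((p - q)\<^sup>2 / D)"
    unfolding r[of "reflection m \<theta> a z"] 1 2 ..
  then show "reflection m \<theta> a (reflection m \<theta> a z) = z" using nz pq by (simp add: D_def)
qed

lemma reflection_\<theta>: "a < m \<Longrightarrow> reflection m \<theta> a (\<theta> a) = \<theta> a"
proof -
  assume a: "a < m"
  define p q where "p = \<theta> a" and "q = \<theta> (Suc a mod m)"
  have pq: "p - q \<noteq> 0" using \<theta>_neq[OF a] by (simp add: p_def q_def)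
  have "reflection m \<theta> a p = (p * (p - q)) / (p - q)"
    by (simp add: reflection_def Let_def p_def[symmetric] q_def[symmetric] algebra_simps)
  then show ?thesis using pq by (simp add: p_def)
qed

lemma reflection_\<theta>': "a < m \<Longrightarrow> reflection m \<theta> a (\<theta> (Suc a mod m)) = \<theta> (Suc a mod m)"
proof -
  assume a: "a < m"
  define p q where "p = \<theta> a" and "q = \<theta> (Suc a mod m)"
  have pq: "q - p \<noteq> 0" using \<theta>_neq[OF a] by (simp add: p_def q_def)
  have "reflection m \<theta> a q = (q * (q - p)) / (q - p)"
    by (simp add: reflection_def Let_def p_def[symmetric] q_def[symmetric] algebra_simps)
  then show ?thesis using pq by (simp add: q_def)
qed

lemma factor_mapI: "a < m \<Longrightarrow> z \<in> half_open_arc m \<theta> a \<Longrightarrow> factor_map m \<theta> z = reflection m \<theta> a z"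
  by (simp add: factor_map_def arc_indexI)

lemma terminating_factor_map: "terminating m \<theta> (factor_map m \<theta> z) \<Longrightarrow> terminating m \<theta> z"
  unfolding terminating_def by (metis funpow_Suc_right o_apply)

lemma terminating_cases: "terminating m \<theta> z \<Longrightarrow> (\<exists>a<m. z = \<theta> a) \<or> terminating m \<theta> (factor_map m \<theta> z)"
  unfolding terminating_def
proof (elim exE conjE)
  fix h a assume "a < m" "(factor_map m \<theta> ^^ h) z = \<theta> a"
  then show "(\<exists>a<m. z = \<theta> a) \<or> (\<exists>h. \<exists>a<m. (factor_map m \<theta> ^^ h) (factor_map m \<theta> z) = \<theta> a)"
    by (cases h) (auto simp: funpow_Suc_right simp del: funpow.simps(2))
qed

lemma terminating_\<theta>: "a < m \<Longrightarrow> terminating m \<theta> (\<theta> a)"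
  unfolding terminating_def by (rule exI[of _ 0], rule exI[of _ a]) simp

text \<open>Reflections are involutions of the circle, so a point has at most \<open>m\<close>
  preimages under the factor map, and the points that are at a vertex at time \<open>h\<close> are
  countably many.\<close>

lemma countable_terminating: "countable {z. norm z = 1 \<and> terminating m \<theta> z}"
proof -
  have K: "countable {z. norm z = 1 \<and> (\<exists>a<m. (factor_map m \<theta> ^^ h) z = \<theta> a)}" for h
  proof (induction h)
    case 0
    have "{z. norm z = 1 \<and> (\<exists>a<m. (factor_map m \<theta> ^^ 0) z = \<theta> a)} \<subseteq> \<theta> ` {..<m}" by auto
    then show ?case by (rule countable_subset) auto
  next
    case (Suc h)
    let ?K = "{z. norm z = 1 \<and> (\<exists>a<m. (factor_map m \<theta> ^^ h) z = \<theta> a)}"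
    have "{z. norm z = 1 \<and> (\<exists>a<m. (factor_map m \<theta> ^^ Suc h) z = \<theta> a)} \<subseteq> (\<Union>b<m. reflection m \<theta> b ` ?K)"
    proof
      fix z assume "z \<in> {z. norm z = 1 \<and> (\<exists>a<m. (factor_map m \<theta> ^^ Suc h) z = \<theta> a)}"
      then have z: "norm z = 1" "\<exists>a<m. (factor_map m \<theta> ^^ h) (factor_map m \<theta> z) = \<theta> a"
        by (auto simp: funpow_Suc_right simp del: funpow.simps(2))
      obtain b where b: "b < m" "z \<in> half_open_arc m \<theta> b" using ex_arc[OF z(1)] by blast
      have "reflection m \<theta> b z \<in> ?K"
        using z reflection_on_circle[OF b(1) z(1)] factor_mapI[OF b] by simp
      then have "reflection m \<theta> b (reflection m \<theta> b z) \<in> reflection m \<theta> b ` ?K" by (rule imageI)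
      then show "z \<in> (\<Union>b<m. reflection m \<theta> b ` ?K)"
        using reflection_on_circle[OF b(1) z(1)] b(1) by auto
    qed
    then show ?case by (rule countable_subset) (use Suc in auto)
  qed
  have "{z. norm z = 1 \<and> terminating m \<theta> z} =
      (\<Union>h. {z. norm z = 1 \<and> (\<exists>a<m. (factor_map m \<theta> ^^ h) z = \<theta> a)})"
    by (auto simp: terminating_def)
  then show ?thesis using K by auto
qed

definition N :: "real set" where
  "N = {u. \<not> terminating m \<theta> (cayley u)}"

lemma v_notin_N: "1 \<le> a \<Longrightarrow> a < m \<Longrightarrow> v a \<notin> N"
  using terminating_\<theta>[of a] cayley_v[of a] by (simp add: N_def)

lemma in_arc_iff_idx:
  assumes "\<And>b. 0 < b \<Longrightarrow> b < m \<Longrightarrow> u \<noteq> v b" "a < m"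
  shows "cayley u \<in> half_open_arc m \<theta> a \<longleftrightarrow> idx u = a"
  unfolding arc_cayley[OF assms(2)] idx_iff[OF assms(2)]
  using assms(1)[of a] assms(1)[of "Suc a"] assms(2) by fastforce

lemma N_arc_iff:
  assumes "u \<in> N" "a < m"
  shows "cayley u \<in> half_open_arc m \<theta> a \<longleftrightarrow> idx u = a"
  using assms v_notin_N by (intro in_arc_iff_idx) auto

text \<open>The centre of a bounded side is sent to infinity, that is to the vertex
  \<open>\<theta> 0\<close>, and so it terminates after one step.\<close>

lemma center_notin_N:
  assumes "1 \<le> a" "Suc a < m"
  shows "(v a + v (Suc a)) / 2 \<notin> N"
proof -
  define c where "c = (v a + v (Suc a)) / 2"
  have "cayley c \<in> half_open_arc m \<theta> a"
    using assms v_less[of a "Suc a"] by (simp add: arc_cayley c_def)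
  then have "factor_map m \<theta> (cayley c) = reflection m \<theta> a (cayley c)" using assms by (intro factor_mapI) auto
  also have "\<dots> = \<theta> 0" using assms by (simp add: reflection_cayley c_def \<theta>_0)
  finally have "terminating m \<theta> (factor_map m \<theta> (cayley c))" using terminating_\<theta>[of 0] m3 by simp
  then show ?thesis using terminating_factor_map by (auto simp: N_def c_def[symmetric])
qed

lemma N_center: "u \<in> N \<Longrightarrow> 0 < a \<Longrightarrow> Suc a < m \<Longrightarrow> 2 * u - (v a + v (Suc a)) \<noteq> 0"
proof
  assume u: "u \<in> N" and a: "0 < a" "Suc a < m" and "2 * u - (v a + v (Suc a)) = 0"
  then have "(v a + v (Suc a)) / 2 = u" by simp
  then show False using center_notin_N[of a] a u by auto
qed

lemma reflection_cayley_N: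
  assumes "u \<in> N" "a < m"
  shows "reflection m \<theta> a (cayley u) = cayley (R a u)"
  using reflection_cayley[OF assms(2), of u] N_center[OF assms(1)] by auto

text \<open>For a point of side \<open>a\<close> this is one step of its orbit. Any other point is
  reflected into side \<open>a\<close>, from where the factor map brings it back; if the image
  terminated, so would the point, unless the image is a vertex, and the only vertices that can occur
  are fixed by the reflection.\<close>

lemma reflection_in_N:
  assumes a: "a < m" and u: "u \<in> N"
  shows "R a u \<in> N"
proof (cases "idx u = a")
  case True
  then have "factor_map m \<theta> (cayley u) = cayley (R a u)"
    using a u by (simp add: factor_mapI N_arc_iff reflection_cayley_N)
  then show ?thesis using u terminating_factor_map[of "cayley u"] by (auto simp: N_def)
next
  case False
  have nv: "u \<noteq> v b" if "1 \<le> b" "b < m" for b using u v_notin_N[OF that] by auto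
  define w where "w = cayley (R a u)"
  have rw: "reflection m \<theta> a w = cayley u"
    using reflection_on_circle(2)[OF a norm_cayley, of u] by (simp add: w_def reflection_cayley_N[OF u a])
  have i: "idx (R a u) = a"
    using False idx_reflection_regular[OF a nv] N_center[OF u] by auto
  show ?thesis
  proof (rule ccontr)
    assume "R a u \<notin> N"
    then have t: "terminating m \<theta> w" by (simp add: N_def w_def)
    show False
    proof (cases "\<exists>b<m. w = \<theta> b")
      case True
      then obtain b where b: "b < m" "w = \<theta> b" by blast
      show False
      proof (cases "b = a")
        case True
        then have "cayley u = \<theta> a" using rw b reflection_\<theta>[OF a] by simp
        then show False using u terminating_\<theta>[OF a] by (simp add: N_def)
      next
        case False
        have b0: "b \<noteq> 0" using b(2) cayley_neq_1 \<theta>_0 by (metis w_def)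
        then have "R a u = v b" using b cayley_v[of b] by (metis cayley_eq_iff neq0_conv w_def)
        \<comment> \<open>With right-closed sides, \<open>v b\<close> counts as a point of side
          \<open>b - 1\<close>; as \<open>idx (R a u) = a\<close>, only the right end of side
          \<open>a\<close> remains.\<close>
        moreover have "idx (v b) = b - 1"
          using b b0 v_less[of "b - 1" b] by (intro idx_eqI) auto
        ultimately have "b = Suc a" using i b0 by simp
        then have "cayley u = \<theta> b" using rw b reflection_\<theta>'[OF a] by (simp add: mod_less)
        then show False using u terminating_\<theta>[OF b(1)] by (simp add: N_def)
      qed
    next
      case False
      have "R a u \<noteq> v b" if "0 < b" "b < m" for b
        using False cayley_v[OF that] that by (auto simp: w_def)
      then have "w \<in> half_open_arc m \<theta> a" unfolding w_def using in_arc_iff_idx[of "R a u", OF _ a] i by blast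
      then have "factor_map m \<theta> w = cayley u" using factor_mapI[OF a] rw by simp
      then have "terminating m \<theta> (cayley u)" using terminating_cases[OF t] False by auto
      then show False using u by (simp add: N_def)
    qed
  qed
qed

sublocale ideal_polygon m v N
proof
  have "cayley ` (- N) \<subseteq> {z. norm z = 1 \<and> terminating m \<theta> z}" by (auto simp: N_def norm_cayley)
  then have "countable (cayley ` (- N))" using countable_terminating by (rule countable_subset)
  moreover have "inj_on cayley (- N)" by (auto simp: inj_on_def cayley_eq_iff)
  ultimately show "countable (- N)" by (rule countable_image_inj_on)
qed (use v_notin_N center_notin_N reflection_in_N in auto)

lemma S_factor:
  assumes "u \<in> N"
  shows "factor_map_arg m \<theta> (cayley_arg u) = cayley_arg (S u)"
proof -
  have "factor_map m \<theta> (cayley u) = reflection m \<theta> (idx u) (cayley u)"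
    using N_arc_iff[OF assms idx_less, of u] by (intro factor_mapI idx_less) simp
  then show ?thesis
    by (simp add: factor_map_arg_def unarg_cayley_arg reflection_cayley_N[OF assms idx_less] narg_cayley S_def)
qed

lemma T_billiard:
  assumes "z \<in> XR"
  shows "billiard_map_arg m \<theta> (map_prod cayley_arg cayley_arg z) = map_prod cayley_arg cayley_arg (T z)"
proof -
  obtain u w where z: "z = (u, w)" "u \<in> N" "w \<in> N" using assms by (auto simp: XR_def)
  have "arc_index m \<theta> (cayley u) = idx u"
    using N_arc_iff[OF z(2) idx_less, of u] by (intro arc_indexI idx_less) simp
  then show ?thesis
    by (simp add: z billiard_map_arg_def billiard_map_def unarg_cayley_arg T_def Let_def
        reflection_cayley_N[OF z(2) idx_less] reflection_cayley_N[OF z(3) idx_less] narg_cayley)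
qed

lemma billiard_set_arg_eq: "billiard_set_arg m \<theta> = map_prod cayley_arg cayley_arg ` XR"
proof (intro equalityI subsetI)
  fix p assume "p \<in> billiard_set_arg m \<theta>"
  then obtain \<sigma> \<rho> a b where p: "p = (narg \<sigma>, narg \<rho>)" and n: "norm \<sigma> = 1" "norm \<rho> = 1"
    and t: "\<not> terminating m \<theta> \<sigma>" "\<not> terminating m \<theta> \<rho>"
    and ab: "a < m" "b < m" "a \<noteq> b" "\<sigma> \<in> half_open_arc m \<theta> a" "\<rho> \<in> half_open_arc m \<theta> b"
    by (auto simp: billiard_set_arg_def billiard_set_def)
  have "\<sigma> \<noteq> 1" "\<rho> \<noteq> 1" using t terminating_\<theta>[of 0] m3 \<theta>_0 by auto
  then obtain u w where uw: "\<sigma> = cayley u" "\<rho> = cayley w" using ex_cayley n by meson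
  have N: "u \<in> N" "w \<in> N" using t by (auto simp: N_def uw)
  have "idx u = a" "idx w = b" using ab N_arc_iff[OF N(1)] N_arc_iff[OF N(2)] by (auto simp: uw)
  then have "(u, w) \<in> XR" using N ab by (simp add: XR_def)
  moreover have "p = map_prod cayley_arg cayley_arg (u, w)" by (simp add: p uw narg_cayley)
  ultimately show "p \<in> map_prod cayley_arg cayley_arg ` XR" by (rule rev_image_eqI)
next
  fix p assume "p \<in> map_prod cayley_arg cayley_arg ` XR"
  then obtain u w where uw: "(u, w) \<in> XR" "p = (cayley_arg u, cayley_arg w)" by auto
  then have N: "u \<in> N" "w \<in> N" "idx u \<noteq> idx w" by (auto simp: XR_def)
  have "(cayley u, cayley w) \<in> billiard_set m \<theta>"
    using N N_arc_iff[OF N(1) idx_less, of u] N_arc_iff[OF N(2) idx_less, of w] idx_less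
    by (auto simp: billiard_set_def norm_cayley N_def)
  then show "p \<in> billiard_set_arg m \<theta>"
    unfolding billiard_set_arg_def by (rule rev_image_eqI) (simp add: uw narg_cayley)
qed

end

section \<open>Return to argument coordinates\<close>

definition cayley_jac :: "real \<Rightarrow> real" where
  "cayley_jac u = 1 / (pi * (1 + u\<^sup>2))"

lemma one_plus_square_pos: "0 < 1 + (u::real)\<^sup>2"
  by (simp add: add_pos_nonneg)

lemma cayley_jac_pos: "0 < cayley_jac u"
  using one_plus_square_pos[of u] by (simp add: cayley_jac_def)

lemma cayley_jac_measurable[measurable]: "cayley_jac \<in> borel_measurable borel"
  unfolding cayley_jac_def[abs_def] by measurable

lemma cayley_arg_measurable[measurable]: "cayley_arg \<in> borel_measurable borel"
proof -
  have "cayley_arg \<in> borel_measurable borel"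
    unfolding cayley_arg_def[abs_def] by (intro borel_measurable_continuous_onI continuous_intros) auto
  then show ?thesis .
qed

lemma range_cayley_arg: "range cayley_arg = {0<..<1}"
proof (intro equalityI subsetI)
  fix x :: real assume "x \<in> {0<..<1}"
  then show "x \<in> range cayley_arg" using cayley_arg_tan[of x] by (metis greaterThanLessThan_iff rangeI)
qed (use cayley_arg_bounds in auto)

lemma nn_integral_cayley_arg:
  fixes f :: "real \<Rightarrow> ennreal"
  assumes f: "f \<in> borel_measurable borel"
  shows "(\<integral>\<^sup>+u. f (cayley_arg u) * ennreal (cayley_jac u) \<partial>lborel) = (\<integral>\<^sup>+x\<in>{0<..<1}. f x \<partial>lborel)"
proof -
  have der: "(cayley_arg has_field_derivative cayley_jac u) (at u)" for u
  proof -
    have "((\<lambda>u. 1 / 2 + arctan u / pi) has_field_derivative inverse (1 + u\<^sup>2) / pi) (at u)"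
      by (auto intro!: derivative_eq_intros)
    then show ?thesis
      by (simp add: cayley_arg_def[abs_def] cayley_jac_def inverse_eq_divide mult.commute)
  qed
  have "(\<integral>\<^sup>+u\<in>UNIV. f (cayley_arg u) * ennreal \<bar>cayley_jac u\<bar> \<partial>lborel) = (\<integral>\<^sup>+x\<in>range cayley_arg. f x \<partial>lborel)"
    by (rule nn_integral_change_of_variables_real)
      (use f der in \<open>auto simp: range_cayley_arg inj_on_def cayley_arg_eq_iff\<close>)
  then show ?thesis using cayley_jac_pos by (simp add: range_cayley_arg abs_of_pos)
qed

section \<open>The sine kernel and the cotangents in the Cayley coordinate\<close>

lemma sin_diff_arctan: "sin (arctan u - arctan w) = (u - w) / (sqrt (1 + u\<^sup>2) * sqrt (1 + w\<^sup>2))"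
  by (simp add: sin_diff sin_arctan cos_arctan diff_divide_distrib)

lemma cos_diff_arctan: "cos (arctan u - arctan w) = (1 + u * w) / (sqrt (1 + u\<^sup>2) * sqrt (1 + w\<^sup>2))"
  by (simp add: cos_diff sin_arctan cos_arctan add_divide_distrib)

lemma pi_cayley_arg_diff: "pi * (cayley_arg u - cayley_arg w) = arctan u - arctan w"
  by (simp add: cayley_arg_def field_simps)

text \<open>The pole at \<open>w\<close> is separated from the term \<open>- pi * u\<close>, which
  does not depend on \<open>w\<close>. That term cancels in the difference of cotangents in
  \<open>hfun\<close>, and for an endpoint at infinity it is all that is left.\<close>

lemma cot_cayley_arg_diff:
  assumes "u \<noteq> w"
  shows "pi / tan (pi * (cayley_arg u - cayley_arg w)) = pi * ((1 + u\<^sup>2) / (u - w) - u)"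
proof -
  have "sqrt (1 + u\<^sup>2) * sqrt (1 + w\<^sup>2) \<noteq> 0"
    using one_plus_square_pos[of u] one_plus_square_pos[of w] by simp
  then have "pi / tan (pi * (cayley_arg u - cayley_arg w)) = pi * ((1 + u * w) / (u - w))"
    by (simp add: pi_cayley_arg_diff tan_def sin_diff_arctan cos_diff_arctan)
  also have "(1 + u * w) / (u - w) = (1 + u\<^sup>2) / (u - w) - u"
    using assms by (simp add: field_simps power2_eq_square)
  finally show ?thesis .
qed

lemma cot_cayley_arg: "pi / tan (pi * cayley_arg u) = - pi * u"
proof -
  have "pi * cayley_arg u = pi / 2 + arctan u" by (simp add: cayley_arg_def field_simps)
  then have eq: "tan (pi * cayley_arg u) = cos (arctan u) / - sin (arctan u)"
    by (simp add: tan_def sin_add cos_add)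
  have "pi / tan (pi * cayley_arg u) = - pi * (sin (arctan u) / cos (arctan u))"
    unfolding eq by simp
  also have "sin (arctan u) / cos (arctan u) = u" using tan_arctan[of u] by (simp add: tan_def)
  finally show ?thesis .
qed

lemma cot_cayley_arg_1: "pi / tan (pi * (cayley_arg u - 1)) = - pi * u"
proof -
  have "pi * (cayley_arg u - 1) = arctan u - pi / 2" by (simp add: cayley_arg_def field_simps)
  then have eq: "tan (pi * (cayley_arg u - 1)) = - cos (arctan u) / sin (arctan u)"
    by (simp add: tan_def sin_diff cos_diff)
  have "pi / tan (pi * (cayley_arg u - 1)) = - pi * (sin (arctan u) / cos (arctan u))"
    unfolding eq by simp
  also have "sin (arctan u) / cos (arctan u) = u" using tan_arctan[of u] by (simp add: tan_def)
  finally show ?thesis .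
qed

context circle_partition begin

abbreviation K :: "real \<Rightarrow> real \<Rightarrow> ennreal" where
  "K x y \<equiv> ennreal (pi\<^sup>2 * inverse ((sin (pi * (x - y)))\<^sup>2))"

abbreviation "X \<equiv> billiard_set_arg m \<theta>"
abbreviation "p2 \<equiv> map_prod cayley_arg cayley_arg"

lemma K_measurable: "(\<lambda>z. K (fst z) (snd z)) \<in> borel_measurable (borel \<Otimes>\<^sub>M borel)"
  by measurable

text \<open>The sine of the difference of two arctangents is \<open>u - w\<close> divided by the
  square roots of \<open>1 + u\<^sup>2\<close> and \<open>1 + w\<^sup>2\<close>. Up to a factor
  \<open>pi\<close> each, the squares of these roots are the inverse Jacobians, which accounts for
  \<open>pi\<^sup>2\<close> in the kernel.\<close>

lemma \<kappa>_cayley: "\<kappa> u w = ennreal (cayley_jac u) * (K (cayley_arg u) (cayley_arg w) * ennreal (cayley_jac w))"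
proof -
  define U W where "U = 1 + u\<^sup>2" and "W = 1 + w\<^sup>2"
  have UW: "0 < U" "0 < W" by (auto simp: U_def W_def one_plus_square_pos)
  have "(sin (pi * (cayley_arg u - cayley_arg w)))\<^sup>2 = (u - w)\<^sup>2 / (U * W)"
    using UW unfolding pi_cayley_arg_diff sin_diff_arctan U_def[symmetric] W_def[symmetric]
    by (simp add: power_divide power_mult_distrib)
  then have "1 / (u - w)\<^sup>2 = cayley_jac u * (pi\<^sup>2 * inverse ((sin (pi * (cayley_arg u - cayley_arg w)))\<^sup>2) * cayley_jac w)"
    using UW unfolding cayley_jac_def U_def[symmetric] W_def[symmetric]
    by (simp add: power2_eq_square field_simps)
  then show ?thesis
    unfolding \<kappa>_def using cayley_jac_pos[of u] cayley_jac_pos[of w]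
    by (simp add: ennreal_mult less_imp_le)
qed

definition uncayley :: "real \<Rightarrow> real" where
  "uncayley x = tan (pi * (x - 1 / 2))"

lemma uncayley_cayley_arg: "uncayley (cayley_arg u) = u"
  by (simp add: uncayley_def cayley_arg_def tan_arctan)

lemma cayley_arg_uncayley: "0 < x \<Longrightarrow> x < 1 \<Longrightarrow> cayley_arg (uncayley x) = x"
  unfolding uncayley_def by (rule cayley_arg_tan)

lemma uncayley_measurable[measurable]: "uncayley \<in> borel_measurable borel"
  unfolding uncayley_def[abs_def] tan_def by measurable

text \<open>Through the measurable inverse \<open>uncayley\<close>, \<open>X\<close> is described as
  a preimage of \<open>XR\<close>, which makes it a Borel set.\<close>

lemma mem_X: "z \<in> X \<longleftrightarrow> fst z \<in> {0<..<1} \<and> snd z \<in> {0<..<1} \<and> (uncayley (fst z), uncayley (snd z)) \<in> XR"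
proof
  assume "z \<in> X"
  then obtain u w where "(u, w) \<in> XR" "z = (cayley_arg u, cayley_arg w)"
    by (auto simp: billiard_set_arg_eq)
  then show "fst z \<in> {0<..<1} \<and> snd z \<in> {0<..<1} \<and> (uncayley (fst z), uncayley (snd z)) \<in> XR"
    using cayley_arg_bounds by (simp add: uncayley_cayley_arg)
next
  assume *: "fst z \<in> {0<..<1} \<and> snd z \<in> {0<..<1} \<and> (uncayley (fst z), uncayley (snd z)) \<in> XR"
  then have "z = p2 (uncayley (fst z), uncayley (snd z))"
    by (simp add: cayley_arg_uncayley)
  then show "z \<in> X" unfolding billiard_set_arg_eq using * by blast
qed

lemma p2_in_X: "p2 z \<in> X \<longleftrightarrow> z \<in> XR"
  using cayley_arg_bounds by (cases z) (simp add: mem_X uncayley_cayley_arg)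

lemma X_borel: "X \<in> sets (borel \<Otimes>\<^sub>M borel)"
proof -
  have "{z \<in> space (borel \<Otimes>\<^sub>M borel). fst z \<in> {0<..<1} \<and> snd z \<in> {0<..<1} \<and>
      (uncayley (fst z), uncayley (snd z)) \<in> XR} \<in> sets (borel \<Otimes>\<^sub>M borel)" by measurable
  also have "{z \<in> space (borel \<Otimes>\<^sub>M borel). fst z \<in> {0<..<1} \<and> snd z \<in> {0<..<1} \<and>
      (uncayley (fst z), uncayley (snd z)) \<in> XR} = X"
    using mem_X by (auto simp: space_pair_measure)
  finally show ?thesis .
qed

definition MX :: "(real \<times> real) measure" where
  "MX = density (restrict_space lborel X) (\<lambda>(x, y). K x y)"

lemma sets_MX: "sets MX = sets (restrict_space (borel \<Otimes>\<^sub>M borel) X)"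
  by (simp add: MX_def sets_restrict_space borel_prod)

lemma space_MX: "space MX = X"
  by (simp add: MX_def space_restrict_space)

lemma p2_measurable: "p2 \<in> measurable MR MX"
proof -
  have "(\<lambda>z. (cayley_arg (fst z), cayley_arg (snd z))) \<in>
      measurable (restrict_space (borel \<Otimes>\<^sub>M borel) XR) (restrict_space (borel \<Otimes>\<^sub>M borel) X)"
    by (intro measurable_restrict_space2 measurable_restrict_space1)
      (use p2_in_X in \<open>auto simp: space_restrict_space\<close>)
  moreover have "p2 = (\<lambda>z. (cayley_arg (fst z), cayley_arg (snd z)))" by auto
  ultimately show ?thesis by (simp add: measurable_cong_sets[OF sets_MR sets_MX])
qed

lemma distr_p2: "distr MR MX p2 = MX"
proof (rule measure_eqI)
  fix A assume "A \<in> sets (distr MR MX p2)"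
  then have A: "A \<in> sets MX" by simp
  then have A': "A \<in> sets (restrict_space lborel X)" by (simp add: MX_def)
  have Ab[measurable]: "A \<in> sets (borel \<Otimes>\<^sub>M borel)" and AX: "A \<subseteq> X"
    using A X_borel unfolding sets_MX by (auto simp: sets_restrict_space_iff)
  note [measurable] = K_measurable
  define G where "G x y = indicator A (x, y) * K x y" for x y
  have G1[measurable]: "(\<lambda>y. G x y) \<in> borel_measurable borel" for x
    unfolding G_def by measurable
  have pA: "p2 -` A \<inter> space MR \<in> sets MR" using p2_measurable A by (rule measurable_sets)
  have "emeasure (distr MR MX p2) A = emeasure MR (p2 -` A \<inter> space MR)"
    using p2_measurable A by (rule emeasure_distr)
  also have "\<dots> = (\<integral>\<^sup>+u. \<integral>\<^sup>+w. ennreal (cayley_jac u) * (G (cayley_arg u) (cayley_arg w) * ennreal (cayley_jac w)) \<partial>lborel \<partial>lborel)"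
    unfolding emeasure_MR[OF pA]
  proof (intro nn_integral_cong)
    fix u w
    have "(u, w) \<in> p2 -` A \<inter> space MR \<longleftrightarrow> (cayley_arg u, cayley_arg w) \<in> A"
      using AX p2_in_X[of "(u, w)"] by (auto simp: space_MR)
    then show "indicator (p2 -` A \<inter> space MR) (u, w) * \<kappa> u w =
        ennreal (cayley_jac u) * (G (cayley_arg u) (cayley_arg w) * ennreal (cayley_jac w))"
      by (simp add: \<kappa>_cayley G_def indicator_def)
  qed
  also have "\<dots> = (\<integral>\<^sup>+u. ennreal (cayley_jac u) * (\<integral>\<^sup>+w. G (cayley_arg u) (cayley_arg w) * ennreal (cayley_jac w) \<partial>lborel) \<partial>lborel)"
    by (intro nn_integral_cong nn_integral_cmult) measurable
  also have "\<dots> = (\<integral>\<^sup>+u. (\<integral>\<^sup>+y\<in>{0<..<1}. G (cayley_arg u) y \<partial>lborel) * ennreal (cayley_jac u) \<partial>lborel)"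
    by (intro nn_integral_cong, subst nn_integral_cayley_arg) (auto simp: mult.commute)
  also have "\<dots> = (\<integral>\<^sup>+x\<in>{0<..<1}. (\<integral>\<^sup>+y\<in>{0<..<1}. G x y \<partial>lborel) \<partial>lborel)"
  proof (rule nn_integral_cayley_arg)
    have "(\<lambda>x. \<integral>\<^sup>+y. (\<lambda>(x, y). G x y * indicator {0<..<1} y) (x, y) \<partial>lborel) \<in> borel_measurable borel"
      by (rule lborel.borel_measurable_nn_integral_fst) (simp add: G_def case_prod_beta')
    then show "(\<lambda>x. \<integral>\<^sup>+y\<in>{0<..<1}. G x y \<partial>lborel) \<in> borel_measurable borel" by simp
  qed
  also have "\<dots> = (\<integral>\<^sup>+x. \<integral>\<^sup>+y. indicator A (x, y) * K x y \<partial>lborel \<partial>lborel)"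
  proof (rule nn_integral_cong)
    fix x
    show "(\<integral>\<^sup>+y\<in>{0<..<1}. G x y \<partial>lborel) * indicator {0<..<1} x = (\<integral>\<^sup>+y. indicator A (x, y) * K x y \<partial>lborel)"
    proof (cases "x \<in> {0<..<1}")
      case True
      have "G x y * indicator {0<..<1} y = indicator A (x, y) * K x y" for y
        using AX mem_X[of "(x, y)"] by (auto simp: G_def indicator_def)
      then show ?thesis using True by simp
    next
      case False
      then have "(x, y) \<notin> A" for y using AX mem_X[of "(x, y)"] by auto
      then show ?thesis using False by simp
    qed
  qed
  also have "\<dots> = emeasure MX A"
    unfolding MX_def by (rule emeasure_density_restrict_prod[OF X_borel K_measurable A', symmetric])
  finally show "emeasure (distr MR MX p2) A = emeasure MX A" .
qed simp

lemma billiard_map_measurable: "billiard_map_arg m \<theta> \<in> measurable MX MX"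
proof -
  have "(\<lambda>z. p2 (T (uncayley (fst z), uncayley (snd z)))) \<in> measurable MX MX"
  proof (rule measurable_compose[OF _ p2_measurable], rule measurable_compose[OF _ T_measurable_MR])
    have "(\<lambda>z. (uncayley (fst z), uncayley (snd z))) \<in>
        measurable (restrict_space (borel \<Otimes>\<^sub>M borel) X) (restrict_space (borel \<Otimes>\<^sub>M borel) XR)"
      by (intro measurable_restrict_space2 measurable_restrict_space1)
        (use mem_X in \<open>auto simp: space_restrict_space\<close>)
    then show "(\<lambda>z. (uncayley (fst z), uncayley (snd z))) \<in> measurable MX MR"
      by (simp add: measurable_cong_sets[OF sets_MX sets_MR])
  qed
  also have "?this \<longleftrightarrow> ?thesis"
  proof (rule measurable_cong)
    fix z assume "z \<in> space MX"
    then obtain w where w: "w \<in> XR" "z = p2 w" by (auto simp: space_MX billiard_set_arg_eq)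
    then show "p2 (T (uncayley (fst z), uncayley (snd z))) = billiard_map_arg m \<theta> z"
      by (cases w) (simp add: uncayley_cayley_arg T_billiard del: map_prod_simp flip: map_prod_simp)
  qed
  finally show ?thesis .
qed

lemma factor_p2: "measure_factor MR T MX (billiard_map_arg m \<theta>) p2"
  by unfold_locales (use p2_measurable distr_p2 billiard_map_measurable T_billiard in \<open>auto simp: space_MR\<close>)

definition H :: "real \<Rightarrow> real" where
  "H x = (\<Sum>a<m. hfun m \<theta> a x)"

definition MI :: "real measure" where
  "MI = density (restrict_space lborel {0..<1}) (\<lambda>x. ennreal (H x))"

lemma H_measurable[measurable]: "H \<in> borel_measurable borel"
  unfolding H_def[abs_def] hfun_def tan_def by measurable

text \<open>Only the summand of the side of \<open>u\<close> survives, and the poles of its two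
  cotangents give the two terms; an endpoint at infinity contributes none. The Jacobian cancels the
  factor \<open>pi * (1 + u\<^sup>2)\<close>.\<close>

lemma H_cayley:
  assumes u: "u \<in> N"
  shows "H (cayley_arg u) * cayley_jac u =
    (if 0 < idx u then 1 / (u - v (idx u)) else 0) +
    (if Suc (idx u) < m then 1 / (v (Suc (idx u)) - u) else 0)"
proof -
  define a where "a = idx u"
  have a: "a < m" by (simp add: a_def idx_less)
  have l: "0 < a \<Longrightarrow> v a < u" using idx_gt[of u] by (simp add: a_def)
  have r: "Suc a < m \<Longrightarrow> u < v (Suc a)" using idx_le[of u] not_v[OF u, of "Suc a"] by (auto simp: a_def)
  have ub: "0 \<le> cayley_arg u" "cayley_arg u < 1" using cayley_arg_bounds[of u] by auto
  have "hfun m \<theta> b (cayley_arg u) = 0" if "b < m" "b \<noteq> a" for b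
  proof (rule ccontr)
    assume "hfun m \<theta> b (cayley_arg u) \<noteq> 0"
    then have "cayley u \<in> half_open_arc m \<theta> b"
      using arc_iff[OF that(1) ub] by (auto simp: hfun_def unarg_cayley_arg split: if_splits)
    then show False using N_arc_iff[OF u that(1)] that(2) by (simp add: a_def)
  qed
  then have "H (cayley_arg u) = hfun m \<theta> a (cayley_arg u)"
    unfolding H_def using a by (subst sum.remove[of _ a]) auto
  also have "\<dots> = pi / tan (pi * (cayley_arg u - part_arg m \<theta> a)) - pi / tan (pi * (cayley_arg u - part_arg m \<theta> (Suc a)))"
  proof -
    have "part_arg m \<theta> a < cayley_arg u"
      using l a cayley_arg_bounds[of u] by (cases "a = 0") (auto simp: part_arg_0 part_arg_cayley cayley_arg_less_iff)
    moreover have "cayley_arg u < part_arg m \<theta> (Suc a)"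
      using r a ub by (cases "Suc a = m") (auto simp: part_arg_def[of m \<theta> m] part_arg_cayley cayley_arg_less_iff)
    ultimately show ?thesis by (simp add: hfun_def)
  qed
  also have "pi / tan (pi * (cayley_arg u - part_arg m \<theta> a)) =
      pi * (1 + u\<^sup>2) * (if 0 < a then 1 / (u - v a) else 0) - pi * u"
    using l a cot_cayley_arg[of u] cot_cayley_arg_diff[of u "v a"]
    by (cases "a = 0") (auto simp: part_arg_0 part_arg_cayley right_diff_distrib)
  also have "pi / tan (pi * (cayley_arg u - part_arg m \<theta> (Suc a))) =
      - pi * (1 + u\<^sup>2) * (if Suc a < m then 1 / (v (Suc a) - u) else 0) - pi * u"
  proof (cases "Suc a = m")
    case True
    then show ?thesis using cot_cayley_arg_1[of u] by (simp add: part_arg_def)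
  next
    case False
    then have sa: "Suc a < m" using a by simp
    then have "pi / tan (pi * (cayley_arg u - part_arg m \<theta> (Suc a))) = pi * ((1 + u\<^sup>2) / (u - v (Suc a)) - u)"
      using r cot_cayley_arg_diff[of u "v (Suc a)"] by (simp add: part_arg_cayley)
    also have "(1 + u\<^sup>2) / (u - v (Suc a)) = - (1 + u\<^sup>2) * (1 / (v (Suc a) - u))"
      using r[OF sa] by (simp add: field_simps)
    also have "pi * (- (1 + u\<^sup>2) * w - u) = - pi * (1 + u\<^sup>2) * w - pi * u" for w
      by (simp add: algebra_simps)
    finally show ?thesis using sa by simp
  qed
  finally have "H (cayley_arg u) = pi * (1 + u\<^sup>2) * ((if 0 < a then 1 / (u - v a) else 0) +
      (if Suc a < m then 1 / (v (Suc a) - u) else 0))"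
    by (simp add: algebra_simps)
  then show ?thesis
    using one_plus_square_pos[of u] unfolding cayley_jac_def a_def[symmetric] by simp
qed

lemma H_cayley_pos: "u \<in> N \<Longrightarrow> 0 < H (cayley_arg u)"
proof -
  assume u: "u \<in> N"
  have "0 < (if 0 < idx u then 1 / (u - v (idx u)) else 0) +
    (if Suc (idx u) < m then 1 / (v (Suc (idx u)) - u) else 0)"
  proof -
    have "0 < idx u \<or> Suc (idx u) < m" using idx_less[of u] m_ge_3 by linarith
    moreover have "0 < idx u \<Longrightarrow> v (idx u) < u" by (rule idx_gt)
    moreover have "u < v (Suc (idx u))" if "Suc (idx u) < m"
      using idx_le[OF that] not_v[OF u, of "Suc (idx u)"] that by simp
    ultimately show ?thesis by (auto intro: add_pos_pos)
  qed
  then show ?thesis using H_cayley[OF u] cayley_jac_pos[of u] by (metis zero_less_mult_pos2)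
qed

text \<open>Up to a null set, \<open>w\<close> ranges over the complement of the side of
  \<open>u\<close>, which consists of one or two half-lines. The integrals of
  \<open>\<kappa>\<close> over them are the terms of \<open>H_cayley\<close>, so the density of the
  factor is the marginal.\<close>

lemma nn_integral_XR_row:
  assumes u: "u \<in> N"
  shows "(\<integral>\<^sup>+w. \<kappa> u w * indicator XR (u, w) \<partial>lborel) = ennreal (H (cayley_arg u) * cayley_jac u)"
proof -
  define a where "a = idx u"
  have a: "a < m" by (simp add: a_def idx_less)
  have l: "0 < a \<Longrightarrow> v a < u" using idx_gt[of u] by (simp add: a_def)
  have r: "Suc a < m \<Longrightarrow> u < v (Suc a)" using idx_le[of u] not_v[OF u, of "Suc a"] by (auto simp: a_def)
  define A B where "A = (if 0 < a then {..v a} else {})" and "B = (if Suc a < m then {v (Suc a)..} else {})"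
  have AB: "A \<in> sets borel" "B \<in> sets borel" by (auto simp: A_def B_def)
  have "(\<integral>\<^sup>+w. \<kappa> u w * indicator XR (u, w) \<partial>lborel) = (\<integral>\<^sup>+w. \<kappa> u w * indicator A w + \<kappa> u w * indicator B w \<partial>lborel)"
    using AE_N
  proof (intro nn_integral_cong_AE, eventually_elim)
    fix w assume w: "w \<in> N"
    have "(u, w) \<in> XR \<longleftrightarrow> \<not> ((0 < a \<longrightarrow> v a < w) \<and> (Suc a < m \<longrightarrow> w \<le> v (Suc a)))"
      using u w idx_iff[OF a, of w] by (auto simp: XR_def a_def)
    moreover have "Suc a < m \<Longrightarrow> w \<noteq> v (Suc a)" using not_v[OF w, of "Suc a"] by auto
    moreover have "\<not> (w \<in> A \<and> w \<in> B)" using l r by (auto simp: A_def B_def)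
    ultimately show "\<kappa> u w * indicator XR (u, w) = \<kappa> u w * indicator A w + \<kappa> u w * indicator B w"
      by (auto simp: A_def B_def indicator_def)
  qed
  also have "\<dots> = (\<integral>\<^sup>+w. \<kappa> u w * indicator A w \<partial>lborel) + (\<integral>\<^sup>+w. \<kappa> u w * indicator B w \<partial>lborel)"
    using AB by (subst nn_integral_add) auto
  also have "(\<integral>\<^sup>+w. \<kappa> u w * indicator A w \<partial>lborel) = ennreal (if 0 < a then 1 / (u - v a) else 0)"
    using nn_integral_\<kappa>_left[of "v a" u] l by (simp add: A_def)
  also have "(\<integral>\<^sup>+w. \<kappa> u w * indicator B w \<partial>lborel) = ennreal (if Suc a < m then 1 / (v (Suc a) - u) else 0)"
    using nn_integral_\<kappa>_right[of u "v (Suc a)"] r by (simp add: B_def)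
  finally show ?thesis
    unfolding H_cayley[OF u] a_def[symmetric] using l r by (subst ennreal_plus) auto
qed

abbreviation "p1 \<equiv> (\<lambda>z :: real \<times> real. cayley_arg (fst z))"

lemma sets_MI: "sets MI = sets (restrict_space borel {0..<1})"
  by (simp add: MI_def sets_restrict_space)

lemma p1_measurable: "p1 \<in> measurable MR MI"
proof -
  have "p1 \<in> measurable (restrict_space (borel \<Otimes>\<^sub>M borel) XR) (restrict_space borel {0..<1})"
    by (intro measurable_restrict_space2 measurable_restrict_space1)
      (use cayley_arg_bounds in \<open>auto simp: less_imp_le\<close>)
  then show ?thesis by (simp add: measurable_cong_sets[OF sets_MR sets_MI])
qed

lemma distr_p1: "distr MR MI p1 = MI"
proof (rule measure_eqI)
  fix A assume "A \<in> sets (distr MR MI p1)"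
  then have A: "A \<in> sets MI" by simp
  then have Ab[measurable]: "A \<in> sets borel" and A01: "A \<subseteq> {0..<1}"
    unfolding sets_MI by (auto simp: sets_restrict_space_iff)
  have pA: "p1 -` A \<inter> space MR \<in> sets MR" using p1_measurable A by (rule measurable_sets)
  have "emeasure (distr MR MI p1) A = emeasure MR (p1 -` A \<inter> space MR)"
    using p1_measurable A by (rule emeasure_distr)
  also have "\<dots> = (\<integral>\<^sup>+u. (indicator A (cayley_arg u) * ennreal (H (cayley_arg u))) * ennreal (cayley_jac u) \<partial>lborel)"
    unfolding emeasure_MR[OF pA] using AE_N
  proof (intro nn_integral_cong_AE, eventually_elim)
    fix u assume u: "u \<in> N"
    have "(\<integral>\<^sup>+w. indicator (p1 -` A \<inter> space MR) (u, w) * \<kappa> u w \<partial>lborel) =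
        (\<integral>\<^sup>+w. indicator A (cayley_arg u) * (\<kappa> u w * indicator XR (u, w)) \<partial>lborel)"
      by (intro nn_integral_cong) (auto simp: space_MR indicator_def)
    also have "\<dots> = indicator A (cayley_arg u) * (\<integral>\<^sup>+w. \<kappa> u w * indicator XR (u, w) \<partial>lborel)"
      by (rule nn_integral_cmult) measurable
    finally show "(\<integral>\<^sup>+w. indicator (p1 -` A \<inter> space MR) (u, w) * \<kappa> u w \<partial>lborel) =
        indicator A (cayley_arg u) * ennreal (H (cayley_arg u)) * ennreal (cayley_jac u)"
      unfolding nn_integral_XR_row[OF u] using H_cayley_pos[OF u] cayley_jac_pos[of u]
      by (simp add: ennreal_mult mult.assoc)
  qed
  also have "\<dots> = (\<integral>\<^sup>+x\<in>{0<..<1}. (indicator A x * ennreal (H x)) \<partial>lborel)"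
    by (rule nn_integral_cayley_arg) measurable
  also have "\<dots> = (\<integral>\<^sup>+x. ennreal (H x) * indicator A x \<partial>lborel)"
    using AE_lborel_singleton[of 0]
  proof (intro nn_integral_cong_AE, eventually_elim)
    fix x :: real assume "x \<noteq> 0"
    then show "indicator A x * ennreal (H x) * indicator {0<..<1} x = ennreal (H x) * indicator A x"
      using A01 by (auto simp: indicator_def)
  qed
  also have "\<dots> = emeasure MI A"
  proof -
    have "emeasure MI A = (\<integral>\<^sup>+x. ennreal (H x) * indicator A x \<partial>restrict_space lborel {0..<1})"
      unfolding MI_def using A by (intro emeasure_density) (auto simp: MI_def intro!: measurable_restrict_space1)
    also have "\<dots> = (\<integral>\<^sup>+x. ennreal (H x) * indicator A x \<partial>lborel)"
      using A01 by (subst nn_integral_restrict_space) (auto intro!: nn_integral_cong split: split_indicator)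
    finally show ?thesis ..
  qed
  finally show "emeasure (distr MR MI p1) A = emeasure MI A" .
qed simp

text \<open>The factor map agrees with the conjugate of the measurable map \<open>S\<close> outside
  the countable set of terminating points, and changes on a countable set keep
  measurability.\<close>

lemma factor_map_measurable: "factor_map_arg m \<theta> \<in> measurable MI MI"
proof -
  have "factor_map_arg m \<theta> \<in> measurable (restrict_space borel {0..<1}) (restrict_space borel {0..<1})"
  proof (rule measurable_discrete_difference)
    show "(\<lambda>x. cayley_arg (S (uncayley x))) \<in> measurable (restrict_space borel {0..<1}) (restrict_space borel {0..<1})"
      by (intro measurable_restrict_space2 measurable_restrict_space1)
        (use cayley_arg_bounds in \<open>auto simp: less_imp_le\<close>)
    show "countable ({0..<1} \<inter> ({0} \<union> cayley_arg ` (- N)))"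
      using countable_compl by (intro countable_Int2 countable_Un countable_image) auto
    show "{x} \<in> sets (restrict_space borel {0..<1})" if "x \<in> {0..<1} \<inter> ({0} \<union> cayley_arg ` (- N))" for x
      using that by (auto simp: sets_restrict_space_iff)
    show "factor_map_arg m \<theta> x \<in> space (restrict_space borel {0..<1})" for x
      using narg_bounds by (simp add: factor_map_arg_def space_restrict_space)
    fix x assume x: "x \<in> space (restrict_space borel {0..<1::real})" "x \<notin> {0..<1} \<inter> ({0} \<union> cayley_arg ` (- N))"
    then have "0 < x" "x < 1" by (auto simp: space_restrict_space less_le)
    then have e: "cayley_arg (uncayley x) = x" by (rule cayley_arg_uncayley)
    then have "uncayley x \<in> N" using x by (force simp: space_restrict_space)
    from S_factor[OF this] show "cayley_arg (S (uncayley x)) = factor_map_arg m \<theta> x" unfolding e ..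
  qed
  then show ?thesis by (simp add: measurable_cong_sets[OF sets_MI sets_MI])
qed

lemma factor_p1: "measure_factor MR T MI (factor_map_arg m \<theta>) p1"
proof unfold_locales
  show "p1 (T z) = factor_map_arg m \<theta> (p1 z)" if "z \<in> space MR" for z
    using that by (auto simp: space_MR XR_def fst_T S_factor)
qed (use p1_measurable distr_p1 factor_map_measurable in auto)

lemma emeasure_MR_nonzero: "emeasure MR (space MR) \<noteq> 0"
proof
  assume "emeasure MR (space MR) = 0"
  then have "(\<integral>\<^sup>+y. fibre XR y N \<partial>lborel) = 0"
    using emeasure_MR_snd[OF sets.top[of MR]] by (simp add: space_MR)
  then have "AE y in lborel. fibre XR y N = 0"
    using fibre_measurable[of XR] T_inv_XR by (subst (asm) nn_integral_0_iff_AE) (auto simp: T_inv_def)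
  with AE_N have "AE y in lborel :: real measure. False"
    by eventually_elim (use fibre_pos in auto)
  then show False by (simp add: ae_filter_eq_bot_iff)
qed

text \<open>The sweeping set in the coordinates of the two factors: \<open>DX\<close> and
  \<open>DI\<close> both have the preimage \<open>D2\<close>, so one finiteness estimate and one
  recurrence statement serve both.\<close>

definition DX :: "(real \<times> real) set" where
  "DX = {z \<in> X. uncayley (fst z) \<in> D}"

definition DI :: "real set" where
  "DI = {x \<in> {0<..<1}. uncayley x \<in> D}"

lemma DX_sets: "DX \<in> sets MX"
proof -
  have "{z \<in> space (borel \<Otimes>\<^sub>M borel). uncayley (fst z) \<in> D} \<in> sets (borel \<Otimes>\<^sub>M borel)" by measurable
  then have "X \<inter> {z \<in> space (borel \<Otimes>\<^sub>M borel). uncayley (fst z) \<in> D} \<in> sets (borel \<Otimes>\<^sub>M borel)"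
    using X_borel by (rule sets.Int[rotated])
  moreover have "DX = X \<inter> {z \<in> space (borel \<Otimes>\<^sub>M borel). uncayley (fst z) \<in> D}"
    by (auto simp: DX_def space_pair_measure)
  ultimately show ?thesis unfolding sets_MX using X_borel by (auto simp: sets_restrict_space_iff)
qed

lemma DI_sets: "DI \<in> sets MI"
proof -
  have "{x \<in> space borel. x \<in> {0<..<1} \<and> uncayley x \<in> D} \<in> sets borel" by measurable
  then have "DI \<in> sets borel" by (simp add: DI_def)
  then show ?thesis unfolding sets_MI by (auto simp: sets_restrict_space_iff DI_def)
qed

lemma vimage_DX: "p2 -` DX \<inter> space MR = D2"
  using p2_in_X by (auto simp: DX_def D2_def space_MR uncayley_cayley_arg)

lemma vimage_DI: "p1 -` DI \<inter> space MR = D2"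
  using cayley_arg_bounds by (auto simp: DI_def D2_def space_MR uncayley_cayley_arg)

lemma billiard_map_arg_ergodic:
  "unique_ac_invariant_measure X (billiard_map_arg m \<theta>) MX \<and>
    ergodic MX (billiard_map_arg m \<theta>) \<and> conservative MX (billiard_map_arg m \<theta>)"
proof (rule measure_factor_conclusion[OF factor_p2 measure_preserving_T ergodic_T emeasure_MR_nonzero DX_sets,
      unfolded vimage_DX, OF emeasure_D2 AE_sweeping,
      where f = "\<lambda>(x, y). pi\<^sup>2 * inverse ((sin (pi * (x - y)))\<^sup>2)"])
  show "X \<in> sets borel" using X_borel unfolding borel_prod .
  show "(\<lambda>(x, y). pi\<^sup>2 * inverse ((sin (pi * (x - y)))\<^sup>2)) \<in> borel_measurable (restrict_space lborel X)"
  proof (rule measurable_restrict_space1)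
    have "(\<lambda>z :: real \<times> real. pi\<^sup>2 * inverse ((sin (pi * (fst z - snd z)))\<^sup>2)) \<in> borel_measurable (borel \<Otimes>\<^sub>M borel)"
      by measurable
    then show "(\<lambda>(x, y). pi\<^sup>2 * inverse ((sin (pi * (x - y)))\<^sup>2)) \<in> borel_measurable (lborel :: (real \<times> real) measure)"
      by (simp add: case_prod_beta' borel_prod)
  qed
  show "MX = density (restrict_space lborel X) (\<lambda>z. ennreal (case z of (x, y) \<Rightarrow> pi\<^sup>2 * inverse ((sin (pi * (x - y)))\<^sup>2)))"
    by (simp add: MX_def case_prod_beta')
  show "AE z in restrict_space lborel X. 0 < (case z of (x, y) \<Rightarrow> pi\<^sup>2 * inverse ((sin (pi * (x - y)))\<^sup>2))"
  proof (rule AE_I2)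
    fix z assume "z \<in> space (restrict_space lborel X)"
    then have "z \<in> X" by (simp add: space_restrict_space)
    then obtain u w where uw: "z = (cayley_arg u, cayley_arg w)" "(u, w) \<in> XR"
      by (auto simp: billiard_set_arg_eq)
    then have "u \<noteq> w" by (auto simp: XR_def)
    then have "sin (pi * (cayley_arg u - cayley_arg w)) \<noteq> 0"
      using one_plus_square_pos[of u] one_plus_square_pos[of w]
      by (simp add: pi_cayley_arg_diff sin_diff_arctan)
    then show "0 < (case z of (x, y) \<Rightarrow> pi\<^sup>2 * inverse ((sin (pi * (x - y)))\<^sup>2))"
      by (simp add: uw)
  qed
qed

lemma factor_map_arg_ergodic:
  "unique_ac_invariant_measure {0..<1} (factor_map_arg m \<theta>) MI \<and>
    ergodic MI (factor_map_arg m \<theta>) \<and> conservative MI (factor_map_arg m \<theta>)"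
proof (rule measure_factor_conclusion[OF factor_p1 measure_preserving_T ergodic_T emeasure_MR_nonzero DI_sets,
      unfolded vimage_DI, OF emeasure_D2 AE_sweeping _ _ _ MI_def])
  show "H \<in> borel_measurable (restrict_space lborel {0..<1})"
    by (rule measurable_restrict_space1) simp
  have "countable ({0} \<union> cayley_arg ` (- N))" using countable_compl by auto
  then have "AE x in lborel. x \<notin> {0} \<union> cayley_arg ` (- N)"
    by (intro AE_not_in countable_imp_null_set_lborel)
  then have "AE x in lborel. x \<in> {0..<1} \<longrightarrow> 0 < H x"
  proof eventually_elim
    fix x assume x: "x \<notin> {0} \<union> cayley_arg ` (- N)"
    show "x \<in> {0..<1} \<longrightarrow> 0 < H x"
    proof
      assume "x \<in> {0..<1}"
      then have "0 < x" "x < 1" using x by (auto simp: less_le)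
      then have e: "cayley_arg (uncayley x) = x" by (rule cayley_arg_uncayley)
      then have "uncayley x \<in> N" using x by force
      from H_cayley_pos[OF this] show "0 < H x" unfolding e .
    qed
  qed
  then show "AE x in restrict_space lborel {0..<1}. 0 < H x"
    by (subst AE_restrict_space_iff) auto
qed auto

end

lemma norm_circle_point:
  assumes "pythagorean_triple t"
  shows "norm (circle_point t) = 1"
proof -
  define x y z where "x = real_of_int (t $ 1)" and "y = real_of_int (t $ 2)" and "z = real_of_int (t $ 3)"
  have "real_of_int ((t $ 1)\<^sup>2 + (t $ 2)\<^sup>2) = real_of_int ((t $ 3)\<^sup>2)"
    using assms by (simp only: pythagorean_triple_def)
  then have xyz: "x\<^sup>2 + y\<^sup>2 = z\<^sup>2" "z > 0"
    using assms by (auto simp: pythagorean_triple_def x_def y_def z_def)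
  have "circle_point t = Complex x y / complex_of_real z"
    by (simp add: circle_point_def Complex_eq x_def y_def z_def mult.commute)
  then have "norm (circle_point t) = sqrt (x\<^sup>2 + y\<^sup>2) / z"
    using xyz by (simp add: norm_divide complex_norm)
  then show ?thesis using xyz by simp
qed

theorem theorem7p2:
  fixes m :: nat and t :: "nat \<Rightarrow> int ^ 3" and \<theta> :: "nat \<Rightarrow> complex"
    and X :: "(real \<times> real) set" and \<mu>' :: "(real \<times> real) measure" and \<mu> :: "real measure"
  assumes "unimodular_partition m t"
    and "\<theta> = (\<lambda>a. circle_point (t a))"
    and "\<theta> 0 = 1"
    and "X = billiard_set_arg m \<theta>"
    and "\<mu>' = density (restrict_space lborel X)
                (\<lambda>(x, y). ennreal (pi\<^sup>2 * inverse ((sin (pi * (x - y)))\<^sup>2)))"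
    and "\<mu> = density (restrict_space lborel {0..<1}) (\<lambda>x. ennreal (\<Sum>a<m. hfun m \<theta> a x))"
  shows "unique_ac_invariant_measure X (billiard_map_arg m \<theta>) \<mu>' \<and>
         unique_ac_invariant_measure {0..<1} (factor_map_arg m \<theta>) \<mu> \<and>
         ergodic \<mu>' (billiard_map_arg m \<theta>) \<and> conservative \<mu>' (billiard_map_arg m \<theta>) \<and>
         ergodic \<mu> (factor_map_arg m \<theta>) \<and> conservative \<mu> (factor_map_arg m \<theta>)"
proof -
  interpret circle_partition m \<theta>
  proof
    show "3 \<le> m" "\<theta> 0 = 1" using assms(1,3) by (auto simp: unimodular_partition_def)
    show "norm (\<theta> a) = 1" if "a < m" for a
      using assms(1) that by (auto simp: assms(2) unimodular_partition_def intro: norm_circle_point)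
    show "strict_mono_on {..<m} (\<lambda>a. narg (\<theta> a))"
      using assms(1,3) by (simp add: assms(2) unimodular_partition_def)
  qed
  have "\<mu>' = MX" "\<mu> = MI"
    by (simp_all add: assms(4,5,6) MX_def MI_def H_def[abs_def])
  then show ?thesis using billiard_map_arg_ergodic factor_map_arg_ergodic assms(4) by blast
qed

end
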